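(* Consider the triple mixed Ising model with spins $(\tfrac12,1,\tfrac32)$ on the Cayley tree $\Gamma^2$ of order $k=2$ with coupling $J>0$, inverse temperature $\beta>0$, and let $\theta=e^{\beta J/2}>1$. Let $\mathcal G_T^{(2)}$ denote the set of translation-invariant splitting Gibbs measures for this model. 1. Suppose that the fixed-point equation $x=f(x,\theta,2)$, $x>0$, has the unique solution $x=1$ (in particular, this holds whenever $s_2(\theta):=f'(1,\theta,2)-1\le0$ and no additional fixed points appear). Then $\mathcal G_T^{(2)}=\{\mu_0\}$, where $\mu_0$ is the disordered translation-invariant splitting Gibbs measure corresponding to $x=1$. 2. Suppose that the equation $x=f(x,\theta,2)$ has exactly three positive solutions $x_-(\theta)<1<x_+(\theta)$ (the third being $x=1$). Then $$\mathcal G_T^{(2)}=\{\mu_-,\mu_0,\mu_+\},$$ where $\mu_-$ and $\mu_+$ are the translation-invariant splitting Gibbs measures associated with $x_-(\theta)$ and $x_+(\theta)$, and $\mu_-$ and $\mu_+$ are extremal Gibbs measures in the full convex set of Gibbs measures.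
   Context: Tree. $\Gamma^2=(V,L)$ is the semi-infinite Cayley tree of order $2$: an infinite tree with root $x^{(0)}$ in which the root has exactly $2$ edges and every other vertex has exactly $3$ edges. $d$ is graph distance, $W_n=\{x: d(x,x^{(0)})=n\}$, $V_n=\bigcup_{m=0}^n W_m$, $L_n$ is the set of edges with both endpoints in $V_n$, and $\Gamma^2_i=\{x\in V: d(x^{(0)},x)\equiv i \pmod 3\}$ for $i=0,1,2$. Model. $\Psi=\{-\tfrac12,\tfrac12\}$, $\Phi=\{-1,0,1\}$, $\Upsilon=\{-\tfrac32,-\tfrac12,\tfrac12,\tfrac32\}$. The spin set $S_x$ of a vertex $x$ is $\Psi$, $\Phi$ or $\Upsilon$ according to whether $x\in\Gamma^2_0$, $\Gamma^2_1$ or $\Gamma^2_2$. Configurations are $\xi\in\Xi=\prod_{x\in V}S_x$, and $\Xi_n=\prod_{x\in V_n}S_x$. The Hamiltonian is $H(\xi)=-J\sum_{\langle x,y\rangle\in L}\xi(x)\xi(y)$, and $H_n(\xi)=-J\sum_{\langle x,y\rangle\in L_n}\xi(x)\xi(y)$ for $\xi\in\Xi_n$. Gibbs measures. A Gibbs measure is a probability measure on $\Xi$ satisfying the DLR equations for this nearest-neighbour Hamiltonian at inverse temperature $\beta$. It is extremal if it cannot be represented as a non-trivial convex combination of other Gibbs measures. Splitting Gibbs measures. Given a family of real vectors $h_x=(h_{s,x})_{s\in S_x}$, $x\in V$, let $\mu_n^h(\xi)=\frac1{Z_n}\exp\{-\beta H_n(\xi)+\sum_{x\in W_n}h_{\xi(x),x}\}$,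 $\xi\in\Xi_n$. If $\sum_{\omega\in\prod_{x\in W_n}S_x}\mu_n^h(\xi_{n-1}\vee\omega)=\mu_{n-1}^h(\xi_{n-1})$ for all $n\ge1$ and $\xi_{n-1}\in\Xi_{n-1}$ ($\vee$ denotes concatenation), the unique probability measure on $\Xi$ with marginals $\mu_n^h$ on $V_n$ is called a splitting Gibbs measure. Put $X_x=e^{h_{1/2,x}-h_{-1/2,x}}$ for $x\in\Gamma_0^2$; $Y_x=e^{h_{-1,x}-h_{0,x}}$, $Z_x=e^{h_{1,x}-h_{0,x}}$ for $x\in\Gamma_1^2$; $T_x=e^{h_{-3/2,x}-h_{-1/2,x}}$, $U_x=e^{h_{1/2,x}-h_{-1/2,x}}$, $N_x=e^{h_{3/2,x}-h_{-1/2,x}}$ for $x\in\Gamma_2^2$. A splitting Gibbs measure is translation-invariant if it comes from a compatible family $h$ for which these quantities are constants $X,Y,Z,T,U,N>0$ not depending on $x$. Scalar map (with $k=2$). For $x>0$ let $$T(x)=\Big(\tfrac{x^2+\theta^3}{\theta^2+\theta x^2}\Big)^2,\quad U(x)=\Big(\tfrac{\theta x^2+1}{x^2+\theta}\Big)^2,\quad N(x)=\Big(\tfrac{\theta^3x^2+1}{\theta^2+\theta x^2}\Big)^2,$$ $$p(x)=\Big(\tfrac{\theta^6T(x)+\theta^4+\theta^2U(x)+N(x)}{\theta^3(T(x)+1+U(x)+N(x))}\Big)^2,\quad q(x)=\Big(\tfrac{T(x)+\theta^2+\theta^4U(x)+\theta^6N(x)}{\theta^3(T(x)+1+U(x)+N(x))}\Big)^2,$$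 $$f(x,\theta,2)=\frac{p(x)+\theta+\theta^2q(x)}{\theta^2p(x)+\theta+q(x)},$$ and let $f'(\cdot,\theta,2)$ be its derivative in $x$. The translation-invariant splitting Gibbs measure associated with a positive fixed point $x=f(x,\theta,2)$ is the one with $X=x^2$, $T=T(x)$, $U=U(x)$, $N=N(x)$, $Y=p(x)$, $Z=q(x)$. *)

theory Defs
  imports "HOL-Probability.Probability"
begin

section \<open>The semi-infinite Cayley tree of order 2\<close>

text \<open>A vertex is the word of left/right choices leading to it, most recent choice first, so the
  children of \<open>x\<close> are \<open>True # x\<close> and \<open>False # x\<close>, and \<open>[]\<close> is the root. Edges are unordered.\<close>

type_synonym vertex = "bool list"

definition root :: vertex where
  "root = []"

definition tree_edges :: "vertex set set" where
  "tree_edges = {{x, b # x} | x b. True}"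

definition tree_dist :: "vertex \<Rightarrow> vertex \<Rightarrow> nat" where
  "tree_dist x y = (LEAST n. (x, y) \<in> {(u, v). {u, v} \<in> tree_edges} ^^ n)"

definition level :: "nat \<Rightarrow> vertex set" where
  "level n = {x. tree_dist x root = n}"

definition tree_ball :: "nat \<Rightarrow> vertex set" where
  "tree_ball n = (\<Union>m\<le>n. level m)"

definition ball_edges :: "nat \<Rightarrow> vertex set set" where
  "ball_edges n = {e \<in> tree_edges. e \<subseteq> tree_ball n}"

definition tree_class :: "nat \<Rightarrow> vertex set" where
  "tree_class i = {x. tree_dist root x mod 3 = i}"

lemma edge_iff: "{x, y} \<in> tree_edges \<longleftrightarrow> (\<exists>b. y = b # x) \<or> (\<exists>b. x = b # y)"
  unfolding tree_edges_def by (auto simp: doubleton_eq_iff)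

lemma root_degree: "card {e \<in> tree_edges. root \<in> e} = 2"
proof -
  have "{e \<in> tree_edges. root \<in> e} = {{[], [True]}, {[], [False]}}"
    unfolding tree_edges_def root_def by auto
  then show ?thesis by (simp add: doubleton_eq_iff)
qed

lemma edges_at:
  "{e \<in> tree_edges. c # x \<in> e} = {{c # x, x}, {c # x, True # c # x}, {c # x, False # c # x}}"
  unfolding tree_edges_def by auto

lemma nonroot_degree:
  assumes "x \<noteq> root"
  shows "card {e \<in> tree_edges. x \<in> e} = 3"
proof -
  obtain c y where "x = c # y"
    using assms by (cases x) (auto simp: root_def)
  then show ?thesis
    by (simp add: edges_at doubleton_eq_iff)
qed

lemma finite_edges_at: "finite {e \<in> tree_edges. x \<in> e}"
  by (rule card_ge_0_finite) (cases "x = root"; simp add: root_degree nonroot_degree)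

lemma tree_dist_commute: "tree_dist x y = tree_dist y x"
proof -
  let ?E = "{(u, v). {u, v} \<in> tree_edges}"
  have *: "(v, u) \<in> ?E ^^ n" if "(u, v) \<in> ?E ^^ n" for u v n
    using that
  proof (induction n arbitrary: v)
    case (Suc n)
    then obtain w where "(u, w) \<in> ?E ^^ n" "(w, v) \<in> ?E" by auto
    with Suc.IH[of w] have "(v, w) \<in> ?E" "(w, u) \<in> ?E ^^ n"
      by (auto simp: insert_commute)
    then show ?case by (rule relpow_Suc_I2)
  qed simp
  then have "(x, y) \<in> ?E ^^ n \<longleftrightarrow> (y, x) \<in> ?E ^^ n" for n
    by blast
  then show ?thesis by (simp add: tree_dist_def)
qed

lemma tree_dist_root: "tree_dist x root = length x"
proof -
  let ?E = "{(u, v). {u, v} \<in> tree_edges}"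
  have up: "(x, root) \<in> ?E ^^ length x"
  proof (induction x)
    case Nil
    then show ?case by (simp add: root_def)
  next
    case (Cons b x)
    have "(b # x, x) \<in> ?E" by (simp add: edge_iff)
    with Cons show ?case by (simp only: length_Cons) (rule relpow_Suc_I2)
  qed
  have low: "length u \<le> length v + n" if "(u, v) \<in> ?E ^^ n" for u v n
    using that
  proof (induction n arbitrary: v)
    case (Suc n)
    then obtain w where "(u, w) \<in> ?E ^^ n" "(w, v) \<in> ?E" by auto
    with Suc.IH[of w] show ?case by (auto simp: edge_iff)
  qed simp
  show ?thesis
    unfolding tree_dist_def
  proof (rule Least_equality)
    show "(x, root) \<in> ?E ^^ length x" by (rule up)
    show "length x \<le> n" if "(x, root) \<in> ?E ^^ n" for n
      using low[OF that] by (simp add: root_def)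
  qed
qed

lemma finite_tree_ball: "finite (tree_ball n)"
proof -
  have "tree_ball n = {x. set x \<subseteq> UNIV \<and> length x \<le> n}"
    by (auto simp: tree_ball_def level_def tree_dist_root)
  then show ?thesis by (metis finite_lists_length_le finite)
qed

lemma finite_ball_edges: "finite (ball_edges n)"
  by (rule finite_subset[of _ "Pow (tree_ball n)"]) (auto simp: ball_edges_def finite_tree_ball)


section \<open>Configurations and energies\<close>

definition spin_set :: "vertex \<Rightarrow> real set" where
  "spin_set x =
    (if x \<in> tree_class 0 then {-1/2, 1/2}
     else if x \<in> tree_class 1 then {-1, 0, 1}
     else {-3/2, -1/2, 1/2, 3/2})"

definition config_space :: "(vertex \<Rightarrow> real) measure" where
  "config_space = (\<Pi>\<^sub>M x\<in>UNIV. count_space (spin_set x))"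

definition configs :: "vertex set \<Rightarrow> (vertex \<Rightarrow> real) set" where
  "configs \<Lambda> = (\<Pi>\<^sub>E x\<in>\<Lambda>. spin_set x)"

lemma space_config_space: "space config_space = configs UNIV"
  by (simp add: config_space_def configs_def space_PiM)

text \<open>An edge is a two-element set, so the product over its vertices is the product of the two
  neighbouring spins.\<close>

definition ball_energy :: "real \<Rightarrow> nat \<Rightarrow> (vertex \<Rightarrow> real) \<Rightarrow> real" where
  "ball_energy J n \<xi> = - J * (\<Sum>e\<in>ball_edges n. \<Prod>x\<in>e. \<xi> x)"

definition touching_edges :: "vertex set \<Rightarrow> vertex set set" where
  "touching_edges \<Lambda> = {e \<in> tree_edges. e \<inter> \<Lambda> \<noteq> {}}"

lemma finite_touching_edges:
  assumes "finite \<Lambda>"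
  shows "finite (touching_edges \<Lambda>)"
proof -
  have "touching_edges \<Lambda> = (\<Union>x\<in>\<Lambda>. {e \<in> tree_edges. x \<in> e})"
    by (auto simp: touching_edges_def)
  then show ?thesis using assms finite_edges_at by simp
qed

definition local_energy :: "real \<Rightarrow> vertex set \<Rightarrow> (vertex \<Rightarrow> real) \<Rightarrow> real" where
  "local_energy J \<Lambda> \<xi> = - J * (\<Sum>e\<in>touching_edges \<Lambda>. \<Prod>x\<in>e. \<xi> x)"


section \<open>Gibbs measures\<close>

definition glue :: "vertex set \<Rightarrow> (vertex \<Rightarrow> real) \<Rightarrow> (vertex \<Rightarrow> real) \<Rightarrow> vertex \<Rightarrow> real" where
  "glue \<Lambda> \<sigma> \<omega> = merge \<Lambda> (- \<Lambda>) (\<sigma>, \<omega>)"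

text \<open>The Gibbsian specification: the probability of \<open>A\<close> in volume \<open>\<Lambda>\<close> with boundary condition \<open>\<omega>\<close>.\<close>

definition gibbs_kernel ::
  "real \<Rightarrow> real \<Rightarrow> vertex set \<Rightarrow> (vertex \<Rightarrow> real) \<Rightarrow> (vertex \<Rightarrow> real) set \<Rightarrow> real" where
  "gibbs_kernel J \<beta> \<Lambda> \<omega> A =
    (\<Sum>\<sigma>\<in>configs \<Lambda>. exp (- \<beta> * local_energy J \<Lambda> (glue \<Lambda> \<sigma> \<omega>)) * indicator A (glue \<Lambda> \<sigma> \<omega>)) /
    (\<Sum>\<sigma>\<in>configs \<Lambda>. exp (- \<beta> * local_energy J \<Lambda> (glue \<Lambda> \<sigma> \<omega>)))"

definition gibbs_measure :: "real \<Rightarrow> real \<Rightarrow> (vertex \<Rightarrow> real) measure \<Rightarrow> bool" where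
  "gibbs_measure J \<beta> \<mu> \<longleftrightarrow>
    prob_space \<mu> \<and> sets \<mu> = sets config_space \<and>
    (\<forall>\<Lambda> A. finite \<Lambda> \<longrightarrow> A \<in> sets config_space \<longrightarrow>
       measure \<mu> A = (\<integral>\<omega>. gibbs_kernel J \<beta> \<Lambda> \<omega> A \<partial>\<mu>))"

definition extremal_gibbs_measure :: "real \<Rightarrow> real \<Rightarrow> (vertex \<Rightarrow> real) measure \<Rightarrow> bool" where
  "extremal_gibbs_measure J \<beta> \<mu> \<longleftrightarrow>
    gibbs_measure J \<beta> \<mu> \<and>
    \<not> (\<exists>\<mu>\<^sub>1 \<mu>\<^sub>2 t. gibbs_measure J \<beta> \<mu>\<^sub>1 \<and> gibbs_measure J \<beta> \<mu>\<^sub>2 \<and>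
         \<mu>\<^sub>1 \<noteq> \<mu> \<and> \<mu>\<^sub>2 \<noteq> \<mu> \<and> 0 < t \<and> t < 1 \<and>
         (\<forall>A\<in>sets config_space. measure \<mu> A = t * measure \<mu>\<^sub>1 A + (1 - t) * measure \<mu>\<^sub>2 A))"


section \<open>Splitting Gibbs measures\<close>

text \<open>In a family \<open>h\<close> of boundary fields, \<open>h x s\<close> is the component of the vector at the vertex \<open>x\<close>
  for the spin value \<open>s\<close>; values for \<open>s \<notin> spin_set x\<close> are irrelevant.\<close>

definition field_weight ::
  "real \<Rightarrow> real \<Rightarrow> (vertex \<Rightarrow> real \<Rightarrow> real) \<Rightarrow> nat \<Rightarrow> (vertex \<Rightarrow> real) \<Rightarrow> real" where
  "field_weight J \<beta> h n \<xi> = exp (- \<beta> * ball_energy J n \<xi> + (\<Sum>x\<in>level n. h x (\<xi> x)))"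

definition field_dist ::
  "real \<Rightarrow> real \<Rightarrow> (vertex \<Rightarrow> real \<Rightarrow> real) \<Rightarrow> nat \<Rightarrow> (vertex \<Rightarrow> real) \<Rightarrow> real" where
  "field_dist J \<beta> h n \<xi> =
    field_weight J \<beta> h n \<xi> / (\<Sum>\<eta>\<in>configs (tree_ball n). field_weight J \<beta> h n \<eta>)"

definition compatible :: "real \<Rightarrow> real \<Rightarrow> (vertex \<Rightarrow> real \<Rightarrow> real) \<Rightarrow> bool" where
  "compatible J \<beta> h \<longleftrightarrow>
    (\<forall>n\<ge>1. \<forall>\<xi>\<in>configs (tree_ball (n - 1)).
       (\<Sum>\<omega>\<in>configs (level n).
          field_dist J \<beta> h n (merge (tree_ball (n - 1)) (level n) (\<xi>, \<omega>))) =
       field_dist J \<beta> h (n - 1) \<xi>)"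

definition splitting_gibbs_measure ::
  "real \<Rightarrow> real \<Rightarrow> (vertex \<Rightarrow> real \<Rightarrow> real) \<Rightarrow> (vertex \<Rightarrow> real) measure \<Rightarrow> bool" where
  "splitting_gibbs_measure J \<beta> h \<mu> \<longleftrightarrow>
    compatible J \<beta> h \<and> prob_space \<mu> \<and> sets \<mu> = sets config_space \<and>
    (\<forall>n. \<forall>\<xi>\<in>configs (tree_ball n).
       measure \<mu> {\<omega> \<in> space config_space. \<forall>x\<in>tree_ball n. \<omega> x = \<xi> x} = field_dist J \<beta> h n \<xi>)"

definition constant_ratios ::
  "(vertex \<Rightarrow> real \<Rightarrow> real) \<Rightarrow> real \<Rightarrow> real \<Rightarrow> real \<Rightarrow> real \<Rightarrow> real \<Rightarrow> real \<Rightarrow> bool" where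
  "constant_ratios h X Y Z T U N \<longleftrightarrow>
    (\<forall>x\<in>tree_class 0. exp (h x (1/2) - h x (-1/2)) = X) \<and>
    (\<forall>x\<in>tree_class 1. exp (h x (-1) - h x 0) = Y \<and> exp (h x 1 - h x 0) = Z) \<and>
    (\<forall>x\<in>tree_class 2. exp (h x (-3/2) - h x (-1/2)) = T \<and>
       exp (h x (1/2) - h x (-1/2)) = U \<and> exp (h x (3/2) - h x (-1/2)) = N)"

definition TISGM :: "real \<Rightarrow> real \<Rightarrow> (vertex \<Rightarrow> real) measure set" where
  "TISGM J \<beta> = {\<mu>. \<exists>h X Y Z T U N.
     splitting_gibbs_measure J \<beta> h \<mu> \<and> constant_ratios h X Y Z T U N}"


section \<open>The scalar fixed-point map\<close>

definition T_map :: "real \<Rightarrow> real \<Rightarrow> real" where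
  "T_map \<theta> x = ((x^2 + \<theta>^3) / (\<theta>^2 + \<theta> * x^2))^2"

definition U_map :: "real \<Rightarrow> real \<Rightarrow> real" where
  "U_map \<theta> x = ((\<theta> * x^2 + 1) / (x^2 + \<theta>))^2"

definition N_map :: "real \<Rightarrow> real \<Rightarrow> real" where
  "N_map \<theta> x = ((\<theta>^3 * x^2 + 1) / (\<theta>^2 + \<theta> * x^2))^2"

definition p_map :: "real \<Rightarrow> real \<Rightarrow> real" where
  "p_map \<theta> x =
    ((\<theta>^6 * T_map \<theta> x + \<theta>^4 + \<theta>^2 * U_map \<theta> x + N_map \<theta> x) /
     (\<theta>^3 * (T_map \<theta> x + 1 + U_map \<theta> x + N_map \<theta> x)))^2"

definition q_map :: "real \<Rightarrow> real \<Rightarrow> real" where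
  "q_map \<theta> x =
    ((T_map \<theta> x + \<theta>^2 + \<theta>^4 * U_map \<theta> x + \<theta>^6 * N_map \<theta> x) /
     (\<theta>^3 * (T_map \<theta> x + 1 + U_map \<theta> x + N_map \<theta> x)))^2"

definition f_map :: "real \<Rightarrow> real \<Rightarrow> real" where
  "f_map \<theta> x =
    (p_map \<theta> x + \<theta> + \<theta>^2 * q_map \<theta> x) / (\<theta>^2 * p_map \<theta> x + \<theta> + q_map \<theta> x)"

definition positive_fixed_points :: "real \<Rightarrow> real set" where
  "positive_fixed_points \<theta> = {x. 0 < x \<and> x = f_map \<theta> x}"

definition s2 :: "real \<Rightarrow> real" where
  "s2 \<theta> = deriv (f_map \<theta>) 1 - 1"

text \<open>Existence and uniqueness of the measure associated with \<open>x\<close> is not built in, hence a predicate.\<close>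

definition associated_measure ::
  "real \<Rightarrow> real \<Rightarrow> real \<Rightarrow> real \<Rightarrow> (vertex \<Rightarrow> real) measure \<Rightarrow> bool" where
  "associated_measure J \<beta> \<theta> x \<mu> \<longleftrightarrow>
    (\<exists>h. splitting_gibbs_measure J \<beta> h \<mu> \<and>
       constant_ratios h (x^2) (p_map \<theta> x) (q_map \<theta> x) (T_map \<theta> x) (U_map \<theta> x) (N_map \<theta> x))"

end

theory Submission
  imports Defs
begin

text \<open>Summing out the spins on the outermost level of a ball turns a field of single-site weights (a
\<^emph>\<open>message\<close>) on level \<open>n + 1\<close> into one on level \<open>n\<close>; this map is \<open>transfer\<close>. Everything rests on it.

A field is compatible exactly if the message \<open>exp (h v s)\<close> is, at every vertex, proportional to its own
transfer (\<open>compatible_iff\<close>). With constant ratios, the class-0 ratio \<open>X = x^2\<close> determines the ratios in the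
two other classes, so that the message is proportional to \<open>boundary_law \<theta> x\<close>, and three transfers replace \<open>x\<close> by
\<open>f_map \<theta> x\<close> (\<open>transfer_law_0\<close>, \<open>transfer_law_1\<close>, \<open>transfer_law_2\<close>). Hence the
translation-invariant splitting Gibbs measures are exactly the measures associated with the positive
fixed points (\<open>TISGM_eq\<close>). Each fixed point has exactly one such measure: it is the law of a Markov chain
indexed by the tree (\<open>splitting_exists\<close>), and its finite-dimensional marginals are prescribed. The two
classifications follow.

Extremality of the two outer measures is stochastic domination. For \<open>J > 0\<close> the edge weight
\<open>exp (\<beta> * J * s * t)\<close> is totally positive of order two, so the transfer preserves the likelihood-ratio order of
messages, and the probability of an increasing event is monotone in the boundary message
(\<open>partition_ratio_mono\<close>). Under any boundary condition at distance \<open>3 * (j + k) + 3\<close> the message seen on level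
\<open>3 * (j + k)\<close> lies between the boundary laws of \<open>inverse (\<theta>^2)\<close> and \<open>\<theta>^2\<close>, hence the message on level \<open>3 * j\<close> lies between
the laws of the \<open>k\<close>-fold iterates of \<open>f_map \<theta>\<close> at these points. The iterates converge monotonically to the
smallest and the largest fixed point. By the DLR equations every Gibbs measure therefore gives each
increasing local event a probability between those under the smallest and the largest law
(\<open>top_law_dominates\<close>, \<open>bottom_law_dominated\<close>). If such an outermost measure is a
proper mixture of two Gibbs measures, both components agree with it on increasing local events, which
form a generator closed under intersection, and so they equal it (\<open>extremal_if_dominating\<close>). That splitting measures
are Gibbs measures at all is \<open>splitting_is_gibbs\<close>.\<close>

section \<open>Geometry of the tree and finite-volume sums\<close>

lemma level_eq: "level n = {v. length v = n}"
  by (simp add: level_def tree_dist_root)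

lemma tree_ball_eq: "tree_ball n = {v. length v \<le> n}"
  by (auto simp: tree_ball_def level_eq)

lemma tree_class_eq: "tree_class i = {v. length v mod 3 = i}"
  by (simp add: tree_class_def tree_dist_commute[of root] tree_dist_root)

lemma tree_ball_Suc: "tree_ball (Suc n) = tree_ball n \<union> level (Suc n)"
  by (auto simp: tree_ball_eq level_eq)

lemma tree_ball_level_disjoint: "tree_ball n \<inter> level (Suc n) = {}"
  by (auto simp: tree_ball_eq level_eq)

lemma level_subset_ball: "level n \<subseteq> tree_ball n"
  by (auto simp: tree_ball_eq level_eq)

lemma finite_level: "finite (level n)"
  using finite_tree_ball level_subset_ball by (rule finite_subset[rotated])

lemma finite_subset_tree_ball:
  assumes "finite A"
  obtains n where "A \<subseteq> tree_ball n"
proof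
  show "A \<subseteq> tree_ball (Max (length ` A))"
    using assms by (auto simp: tree_ball_eq)
qed

lemma tree_ball_mono: "m \<le> n \<Longrightarrow> tree_ball m \<subseteq> tree_ball n"
  by (auto simp: tree_ball_eq)

lemma spin_set_cases:
  "spin_set v =
    (if length v mod 3 = 0 then {-1/2, 1/2}
     else if length v mod 3 = 1 then {-1, 0, 1} else {-3/2, -1/2, 1/2, 3/2})"
  by (simp add: spin_set_def tree_class_eq)

lemma finite_spin_set [simp]: "finite (spin_set v)"
  by (simp add: spin_set_cases)

lemma spin_set_nonempty [simp]: "spin_set v \<noteq> {}"
  by (simp add: spin_set_cases)

lemma finite_configs: "finite A \<Longrightarrow> finite (configs A)"
  by (simp add: configs_def finite_PiE)

lemma configs_nonempty: "configs A \<noteq> {}"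
  by (simp add: configs_def PiE_eq_empty_iff)

lemma configs_spin: "\<xi> \<in> configs A \<Longrightarrow> v \<in> A \<Longrightarrow> \<xi> v \<in> spin_set v"
  by (auto simp: configs_def)

lemma restrict_configs: "\<xi> \<in> configs B \<Longrightarrow> A \<subseteq> B \<Longrightarrow> restrict \<xi> A \<in> configs A"
  by (auto simp: configs_def)

lemma merge_configs:
  assumes "\<xi> \<in> configs A" "\<omega> \<in> configs B"
  shows "merge A B (\<xi>, \<omega>) \<in> configs (A \<union> B)"
  using assms by (auto simp: configs_def merge_def)

lemma sum_configs_Un:
  assumes "A \<inter> B = {}"
  shows "(\<Sum>\<xi>\<in>configs (A \<union> B). F \<xi>) =
    (\<Sum>\<xi>\<in>configs A. \<Sum>\<omega>\<in>configs B. F (merge A B (\<xi>, \<omega>)))"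
proof -
  have "(\<Sum>\<xi>\<in>configs (A \<union> B). F \<xi>) =
      (\<Sum>p\<in>configs A \<times> configs B. F (merge A B p))"
  proof (rule sum.reindex_bij_witness[where
        i = "merge A B" and j = "\<lambda>\<xi>. (restrict \<xi> A, restrict \<xi> B)"])
    fix \<xi> assume \<xi>: "\<xi> \<in> configs (A \<union> B)"
    show *: "merge A B (restrict \<xi> A, restrict \<xi> B) = \<xi>"
      using \<xi> by (auto simp: merge_def configs_def PiE_def extensional_def)
    then show "F (merge A B (restrict \<xi> A, restrict \<xi> B)) = F \<xi>" by simp
    show "(restrict \<xi> A, restrict \<xi> B) \<in> configs A \<times> configs B"
      using \<xi> by (auto simp: configs_def)
  next
    fix p assume p: "p \<in> configs A \<times> configs B"
    then show "merge A B p \<in> configs (A \<union> B)"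
      by (auto intro: merge_configs)
    show "(restrict (merge A B p) A, restrict (merge A B p) B) = p"
      using p assms by (cases p) (auto simp: merge_def configs_def PiE_def extensional_def fun_eq_iff)
  qed
  then show ?thesis by (simp add: sum.cartesian_product)
qed

lemma level_Suc_image: "level (Suc n) = (\<lambda>(v, b). b # v) ` (level n \<times> UNIV)"
  by (auto simp: level_eq length_Suc_conv)

lemma prod_level_Suc:
  "(\<Prod>y\<in>level (Suc n). F y) = (\<Prod>v\<in>level n. \<Prod>b\<in>(UNIV::bool set). F (b # v))"
proof -
  have "inj_on (\<lambda>(v, b). b # v) (level n \<times> (UNIV::bool set))"
    by (auto simp: inj_on_def)
  then show ?thesis
    by (simp add: level_Suc_image prod.reindex prod.cartesian_product case_prod_unfold)
qed

lemma ball_edges_0: "ball_edges 0 = {}"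
  by (auto simp: ball_edges_def tree_edges_def tree_ball_eq)

lemma ball_edges_Suc:
  "ball_edges (Suc n) = ball_edges n \<union> (\<lambda>(v, b). {v, b # v}) ` (level n \<times> UNIV)"
proof -
  have iff: "e \<in> ball_edges m \<longleftrightarrow> (\<exists>v b. e = {v, b # v} \<and> Suc (length v) \<le> m)" for e m
    unfolding ball_edges_def tree_edges_def tree_ball_eq by auto
  show ?thesis
  proof (rule set_eqI)
    fix e
    have "e \<in> (\<lambda>(v, b). {v, b # v}) ` (level n \<times> UNIV) \<longleftrightarrow>
        (\<exists>v b. e = {v, b # v} \<and> length v = n)"
      unfolding level_eq by (simp add: image_iff) blast
    moreover have "Suc (length v) \<le> Suc n \<longleftrightarrow> Suc (length v) \<le> n \<or> length v = n" for v :: vertex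
      by linarith
    ultimately show "e \<in> ball_edges (Suc n) \<longleftrightarrow>
        e \<in> ball_edges n \<union> (\<lambda>(v, b). {v, b # v}) ` (level n \<times> UNIV)"
      by (simp only: Un_iff iff conj_disj_distribL ex_disj_distrib)
  qed
qed

text \<open>This identifies the energy that enters the Gibbs kernel of a ball with the energy of the next larger ball, so
that conditioning on the outside of a ball becomes a field on its outermost level.\<close>

lemma touching_edges_ball: "touching_edges (tree_ball n) = ball_edges (Suc n)"
proof (rule set_eqI)
  fix e
  show "e \<in> touching_edges (tree_ball n) \<longleftrightarrow> e \<in> ball_edges (Suc n)"
  proof (cases "e \<in> tree_edges")
    case True
    then obtain v b where "e = {v, b # v}"
      unfolding tree_edges_def by blast
    then show ?thesis
      using True by (simp add: touching_edges_def ball_edges_def tree_ball_eq) linarith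
  qed (simp add: touching_edges_def ball_edges_def)
qed

lemma touching_edges_subset:
  assumes "\<Lambda> \<subseteq> tree_ball n"
  shows "touching_edges \<Lambda> \<subseteq> ball_edges (Suc n)"
  using assms by (auto simp: touching_edges_ball[symmetric] touching_edges_def)

lemma ball_energy_Suc:
  "ball_energy J (Suc n) \<xi> =
    ball_energy J n \<xi> - J * (\<Sum>v\<in>level n. \<Sum>b\<in>UNIV. \<xi> v * \<xi> (b # v))"
proof -
  let ?e = "\<lambda>(v, b). {v, b # v}" and ?N = "level n \<times> (UNIV :: bool set)"
  have disj: "ball_edges n \<inter> ?e ` ?N = {}"
    unfolding ball_edges_def tree_ball_eq level_eq by auto
  have inj: "inj_on ?e ?N"
    by (auto simp: inj_on_def doubleton_eq_iff)
  have pair: "(\<Prod>x\<in>?e p. \<xi> x) = (case p of (v, b) \<Rightarrow> \<xi> v * \<xi> (b # v))" for p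
    by (cases p) simp
  have "(\<Sum>e\<in>ball_edges (Suc n). \<Prod>x\<in>e. \<xi> x) =
      (\<Sum>e\<in>ball_edges n. \<Prod>x\<in>e. \<xi> x) + (\<Sum>p\<in>?N. \<Prod>x\<in>?e p. \<xi> x)"
    unfolding ball_edges_Suc
    by (subst sum.union_disjoint)
       (use disj in \<open>auto simp: finite_ball_edges finite_level sum.reindex[OF inj] comp_def\<close>)
  also have "(\<Sum>p\<in>?N. \<Prod>x\<in>?e p. \<xi> x) = (\<Sum>v\<in>level n. \<Sum>b\<in>UNIV. \<xi> v * \<xi> (b # v))"
    by (simp only: pair sum.cartesian_product)
  finally show ?thesis by (simp add: ball_energy_def algebra_simps)
qed

lemma ball_energy_cong:
  assumes "\<And>v. v \<in> tree_ball n \<Longrightarrow> \<xi> v = \<eta> v"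
  shows "ball_energy J n \<xi> = ball_energy J n \<eta>"
proof -
  have "(\<Prod>x\<in>e. \<xi> x) = (\<Prod>x\<in>e. \<eta> x)" if "e \<in> ball_edges n" for e
    using that assms by (intro prod.cong) (auto simp: ball_edges_def)
  then show ?thesis by (simp add: ball_energy_def)
qed

locale ferromagnet =
  fixes J \<beta> :: real
  assumes J_pos: "J > 0" and beta_pos: "\<beta> > 0"
begin

definition boltz :: "nat \<Rightarrow> (vertex \<Rightarrow> real) \<Rightarrow> real" where
  "boltz n \<xi> = exp (- \<beta> * ball_energy J n \<xi>)"

text \<open>One step of the belief-propagation recursion: the weight of spin \<open>s\<close> at \<open>v\<close> after both children have been summed
out. It depends on \<open>w\<close> only through the children of \<open>v\<close>.\<close>

definition transfer :: "(vertex \<Rightarrow> real \<Rightarrow> real) \<Rightarrow> vertex \<Rightarrow> real \<Rightarrow> real" where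
  "transfer w v s = (\<Prod>b\<in>UNIV. \<Sum>t\<in>spin_set (b # v). exp (\<beta> * J * s * t) * w (b # v) t)"

text \<open>The weights \<open>u\<close> on the whole ball serve to insert indicators of product events, while \<open>w\<close> is the boundary
message; the probability of such an event is a ratio of two partition functions with the same \<open>w\<close>.\<close>

definition partition_fun ::
  "nat \<Rightarrow> (vertex \<Rightarrow> real \<Rightarrow> real) \<Rightarrow> (vertex \<Rightarrow> real \<Rightarrow> real) \<Rightarrow> real" where
  "partition_fun n u w =
    (\<Sum>\<xi>\<in>configs (tree_ball n).
       boltz n \<xi> * (\<Prod>v\<in>tree_ball n. u v (\<xi> v)) * (\<Prod>v\<in>level n. w v (\<xi> v)))"

lemma boltz_pos: "boltz n \<xi> > 0"
  by (simp add: boltz_def)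

lemma boltz_0: "boltz 0 \<xi> = 1"
  by (simp add: boltz_def ball_energy_def ball_edges_0)

lemma boltz_cong: "(\<And>v. v \<in> tree_ball n \<Longrightarrow> \<xi> v = \<eta> v) \<Longrightarrow> boltz n \<xi> = boltz n \<eta>"
  unfolding boltz_def by (subst ball_energy_cong[of n \<xi> \<eta>]) auto

lemma boltz_Suc:
  "boltz (Suc n) \<xi> =
    boltz n \<xi> * (\<Prod>v\<in>level n. \<Prod>b\<in>UNIV. exp (\<beta> * J * \<xi> v * \<xi> (b # v)))"
proof -
  have "- \<beta> * ball_energy J (Suc n) \<xi> =
      - \<beta> * ball_energy J n \<xi> + (\<Sum>v\<in>level n. \<Sum>b\<in>UNIV. \<beta> * J * \<xi> v * \<xi> (b # v))"
  proof -
    have "(\<Sum>v\<in>level n. \<Sum>b\<in>UNIV. \<beta> * J * \<xi> v * \<xi> (b # v)) =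
        \<beta> * J * (\<Sum>v\<in>level n. \<Sum>b\<in>UNIV. \<xi> v * \<xi> (b # v))"
      by (simp only: sum_distrib_left mult.assoc)
    then show ?thesis
      by (simp only: ball_energy_Suc right_diff_distrib)
  qed
  then show ?thesis
    by (simp only: boltz_def exp_add exp_sum finite_level finite)
qed

text \<open>Given the spins on level \<open>n\<close>, the spins on level \<open>n + 1\<close> interact only with their parents, so the sum over all of
them factorises into a product of single-vertex sums.\<close>

lemma sum_outer_level:
  assumes "\<xi> \<in> configs (tree_ball n)"
  shows "(\<Sum>\<omega>\<in>configs (level (Suc n)).
      (\<Prod>v\<in>level n. \<Prod>b\<in>UNIV. exp (\<beta> * J * \<xi> v * \<omega> (b # v))) * (\<Prod>y\<in>level (Suc n). w y (\<omega> y))) =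
    (\<Prod>v\<in>level n. transfer w v (\<xi> v))"
proof -
  let ?F = "\<lambda>y t. exp (\<beta> * J * \<xi> (tl y) * t) * w y t"
  have "(\<Sum>\<omega>\<in>configs (level (Suc n)).
      (\<Prod>v\<in>level n. \<Prod>b\<in>UNIV. exp (\<beta> * J * \<xi> v * \<omega> (b # v))) * (\<Prod>y\<in>level (Suc n). w y (\<omega> y))) =
    (\<Sum>\<omega>\<in>configs (level (Suc n)). \<Prod>y\<in>level (Suc n). ?F y (\<omega> y))"
    by (simp only: prod_level_Suc prod.distrib list.sel)
  also have "\<dots> = (\<Prod>y\<in>level (Suc n). \<Sum>t\<in>spin_set y. ?F y t)"
    unfolding configs_def by (rule prod_sum_PiE[symmetric]) (auto simp: finite_level)
  also have "\<dots> = (\<Prod>v\<in>level n. transfer w v (\<xi> v))"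
    by (simp only: prod_level_Suc transfer_def list.sel)
  finally show ?thesis .
qed

lemma merge_ball_level:
  "v \<in> tree_ball n \<Longrightarrow> merge (tree_ball n) (level (Suc n)) (\<xi>, \<omega>) v = \<xi> v"
  "v \<in> level (Suc n) \<Longrightarrow> merge (tree_ball n) (level (Suc n)) (\<xi>, \<omega>) v = \<omega> v"
  using tree_ball_level_disjoint by (auto simp: merge_def)

lemma boltz_merge:
  "boltz (Suc n) (merge (tree_ball n) (level (Suc n)) (\<xi>, \<omega>)) =
    boltz n \<xi> * (\<Prod>v\<in>level n. \<Prod>b\<in>UNIV. exp (\<beta> * J * \<xi> v * \<omega> (b # v)))"
proof -
  let ?m = "merge (tree_ball n) (level (Suc n)) (\<xi>, \<omega>)"
  have "boltz n ?m = boltz n \<xi>"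
    by (rule boltz_cong) (simp add: merge_ball_level)
  moreover have "?m v = \<xi> v \<and> ?m (b # v) = \<omega> (b # v)" if "v \<in> level n" for v b
    using that level_subset_ball by (subst (1 2) merge_ball_level) (auto simp: level_eq)
  ultimately show ?thesis by (simp add: boltz_Suc cong: prod.cong)
qed

lemma partition_fun_peel:
  "partition_fun (Suc n) u w = partition_fun n u (transfer (\<lambda>v t. u v t * w v t))"
proof -
  let ?m = "\<lambda>\<xi> \<omega>. merge (tree_ball n) (level (Suc n)) (\<xi>, \<omega>)"
  have split: "(\<Prod>v\<in>tree_ball (Suc n). u v (?m \<xi> \<omega> v)) =
      (\<Prod>v\<in>tree_ball n. u v (\<xi> v)) * (\<Prod>v\<in>level (Suc n). u v (\<omega> v))" for \<xi> \<omega>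
    unfolding tree_ball_Suc
    by (subst prod.union_disjoint)
       (auto simp: finite_level finite_tree_ball tree_ball_level_disjoint merge_ball_level cong: prod.cong)
  have lev: "(\<Prod>v\<in>level (Suc n). w v (?m \<xi> \<omega> v)) = (\<Prod>v\<in>level (Suc n). w v (\<omega> v))" for \<xi> \<omega>
    by (simp add: merge_ball_level cong: prod.cong)
  have "partition_fun (Suc n) u w =
    (\<Sum>\<xi>\<in>configs (tree_ball n). \<Sum>\<omega>\<in>configs (level (Suc n)).
       boltz n \<xi> * (\<Prod>v\<in>tree_ball n. u v (\<xi> v)) *
       ((\<Prod>v\<in>level n. \<Prod>b\<in>UNIV. exp (\<beta> * J * \<xi> v * \<omega> (b # v))) *
        (\<Prod>y\<in>level (Suc n). u y (\<omega> y) * w y (\<omega> y))))"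
    unfolding partition_fun_def
    by (subst (1) tree_ball_Suc, subst sum_configs_Un[OF tree_ball_level_disjoint])
       (simp add: boltz_merge split lev prod.distrib mult_ac)
  also have "\<dots> = partition_fun n u (transfer (\<lambda>v t. u v t * w v t))"
    unfolding partition_fun_def sum_distrib_left[symmetric]
    by (intro sum.cong refl arg_cong2[where f="(*)"])
       (rule sum_outer_level[where w = "\<lambda>v t. u v t * w v t"])
  finally show ?thesis .
qed

lemma partition_fun_0: "partition_fun 0 u w = (\<Sum>s\<in>spin_set []. u [] s * w [] s)"
proof -
  have ball0: "tree_ball 0 = {[]}" "level 0 = {[]}"
    by (auto simp: tree_ball_eq level_eq)
  have "partition_fun 0 u w = (\<Sum>\<xi>\<in>configs {[]}. \<Prod>v\<in>{[]}. u v (\<xi> v) * w v (\<xi> v))"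
    by (simp add: partition_fun_def ball0 boltz_0)
  also have "\<dots> = (\<Prod>v\<in>{[]}. \<Sum>s\<in>spin_set v. u v s * w v s)"
    unfolding configs_def by (rule prod_sum_PiE[symmetric]) auto
  finally show ?thesis by simp
qed

lemma partition_fun_cong:
  assumes "\<And>v s. v \<in> tree_ball n \<Longrightarrow> s \<in> spin_set v \<Longrightarrow> u v s = u' v s"
    and "\<And>v s. v \<in> level n \<Longrightarrow> s \<in> spin_set v \<Longrightarrow> w v s = w' v s"
  shows "partition_fun n u w = partition_fun n u' w'"
  unfolding partition_fun_def
proof (intro sum.cong refl arg_cong2[where f="(*)"] prod.cong)
qed (use assms level_subset_ball[of n] in \<open>auto simp: configs_spin subset_iff\<close>)

lemma partition_fun_scale:
  "partition_fun n u (\<lambda>v s. c v * w v s) = (\<Prod>v\<in>level n. c v) * partition_fun n u w"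
  by (simp add: partition_fun_def prod.distrib sum_distrib_left mult_ac)

lemma partition_fun_pos:
  assumes "\<And>v s. v \<in> level n \<Longrightarrow> s \<in> spin_set v \<Longrightarrow> w v s > 0"
  shows "partition_fun n (\<lambda>_ _. 1) w > 0"
  unfolding partition_fun_def
proof (intro sum_pos)
  fix \<xi> assume "\<xi> \<in> configs (tree_ball n)"
  then show "0 < boltz n \<xi> * (\<Prod>v\<in>tree_ball n. 1) * (\<Prod>v\<in>level n. w v (\<xi> v))"
    using assms level_subset_ball[of n]
    by (auto intro!: mult_pos_pos prod_pos simp: boltz_pos configs_spin subset_iff)
qed (auto simp: finite_configs finite_tree_ball configs_nonempty)

lemma transfer_pos:
  assumes "\<And>b t. t \<in> spin_set (b # v) \<Longrightarrow> w (b # v) t > 0"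
  shows "transfer w v s > 0"
  unfolding transfer_def by (intro prod_pos ballI sum_pos) (auto simp: assms)

end

section \<open>Likelihood-ratio order and comparison of partition functions\<close>

text \<open>The likelihood-ratio order in cross-multiplied form: \<open>w' / w\<close> is increasing on \<open>S\<close>. It is insensitive to
normalisation, so that messages can be compared without normalising them.\<close>

definition lr_le :: "'a::linorder set \<Rightarrow> ('a \<Rightarrow> real) \<Rightarrow> ('a \<Rightarrow> real) \<Rightarrow> bool" where
  "lr_le S w w' \<longleftrightarrow> (\<forall>s\<in>S. \<forall>t\<in>S. t \<le> s \<longrightarrow> w s * w' t \<le> w t * w' s)"

lemma lr_leD: "lr_le S w w' \<Longrightarrow> s \<in> S \<Longrightarrow> t \<in> S \<Longrightarrow> t \<le> s \<Longrightarrow> w s * w' t \<le> w t * w' s"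
  by (auto simp: lr_le_def)

lemma lr_le_refl: "lr_le S w w"
  by (simp add: lr_le_def mult.commute)

text \<open>Chebyshev's association argument. The difference of the two averages of \<open>k\<close> is, after symmetrising the
double sum, a sum of terms \<open>(k s - k t) * (w' s * w t - w s * w' t)\<close>, and both factors have the same sign.\<close>

lemma weighted_average_mono:
  fixes S :: "'a::linorder set"
  assumes fin: "finite S" and ne: "S \<noteq> {}"
    and pos: "\<And>s. s \<in> S \<Longrightarrow> w s > 0" "\<And>s. s \<in> S \<Longrightarrow> w' s > 0"
    and lr: "lr_le S w w'"
    and mono: "\<And>s t. s \<in> S \<Longrightarrow> t \<in> S \<Longrightarrow> t \<le> s \<Longrightarrow> k t \<le> k s"
    and le: "\<And>s. s \<in> S \<Longrightarrow> k s \<le> k' s"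
  shows "(\<Sum>s\<in>S. k s * w s) / (\<Sum>s\<in>S. w s) \<le> (\<Sum>s\<in>S. k' s * w' s) / (\<Sum>s\<in>S. w' s)"
proof -
  have W: "(\<Sum>s\<in>S. w s) > 0" "(\<Sum>s\<in>S. w' s) > 0"
    using fin ne pos by (auto intro!: sum_pos)
  let ?d = "\<lambda>s t. k s * (w' s * w t - w s * w' t)"
  have swap: "(\<Sum>s\<in>S. \<Sum>t\<in>S. ?d s t) = (\<Sum>s\<in>S. \<Sum>t\<in>S. ?d t s)"
    by (rule sum.swap)
  have "2 * (\<Sum>s\<in>S. \<Sum>t\<in>S. ?d s t) = (\<Sum>s\<in>S. \<Sum>t\<in>S. ?d s t + ?d t s)"
    unfolding sum.distrib using swap by simp
  also have "\<dots> = (\<Sum>s\<in>S. \<Sum>t\<in>S. (k s - k t) * (w' s * w t - w s * w' t))"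
    by (intro sum.cong refl) (simp add: algebra_simps)
  also have "\<dots> \<ge> 0"
  proof (intro sum_nonneg)
    fix s t assume st: "s \<in> S" "t \<in> S"
    show "0 \<le> (k s - k t) * (w' s * w t - w s * w' t)"
    proof (cases "t \<le> s")
      case True
      then show ?thesis
        using mono[OF st True] lr_leD[OF lr st True]
        by (intro mult_nonneg_nonneg) (auto simp: mult.commute)
    next
      case False
      then have "s \<le> t" by simp
      then show ?thesis
        using mono[OF st(2,1)] lr_leD[OF lr st(2,1)]
        by (intro mult_nonpos_nonpos) (auto simp: mult.commute)
    qed
  qed
  finally have "0 \<le> (\<Sum>s\<in>S. \<Sum>t\<in>S. ?d s t)" by simp
  also have "(\<Sum>s\<in>S. \<Sum>t\<in>S. ?d s t) =
      (\<Sum>s\<in>S. k s * w' s) * (\<Sum>t\<in>S. w t) - (\<Sum>s\<in>S. k s * w s) * (\<Sum>t\<in>S. w' t)"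
    by (simp only: sum_product sum_subtractf[symmetric]) (intro sum.cong refl, simp add: algebra_simps)
  finally have "(\<Sum>s\<in>S. k s * w s) / (\<Sum>s\<in>S. w s) \<le> (\<Sum>s\<in>S. k s * w' s) / (\<Sum>s\<in>S. w' s)"
    using W by (simp add: field_simps)
  also have "(\<Sum>s\<in>S. k s * w' s) \<le> (\<Sum>s\<in>S. k' s * w' s)"
    using le pos by (intro sum_mono mult_right_mono) (auto intro: less_imp_le)
  then have "(\<Sum>s\<in>S. k s * w' s) / (\<Sum>s\<in>S. w' s) \<le> (\<Sum>s\<in>S. k' s * w' s) / (\<Sum>s\<in>S. w' s)"
    using W by (simp add: divide_right_mono)
  finally show ?thesis .
qed

context ferromagnet
begin

text \<open>As \<open>\<beta> * J > 0\<close>, the edge weight is totally positive of order two: a larger parent spin tilts the child towards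
larger values, and does so compatibly with a larger message.\<close>

lemma kernel_lr_le:
  assumes "s' \<le> s" "lr_le S w w'"
    and pos: "\<And>t. t \<in> S \<Longrightarrow> w t > 0" "\<And>t. t \<in> S \<Longrightarrow> w' t > 0"
  shows "lr_le S (\<lambda>t. exp (\<beta> * J * s' * t) * w t) (\<lambda>t. exp (\<beta> * J * s * t) * w' t)"
  unfolding lr_le_def
proof (intro ballI impI)
  fix a b assume ab: "a \<in> S" "b \<in> S" "b \<le> a"
  have "0 \<le> \<beta> * J * ((s - s') * (a - b))"
    using J_pos beta_pos assms(1) ab(3) by (intro mult_nonneg_nonneg) auto
  then have "\<beta> * J * s' * a + \<beta> * J * s * b \<le> \<beta> * J * s' * b + \<beta> * J * s * a"
    by (simp add: algebra_simps)
  then have e: "exp (\<beta> * J * s' * a) * exp (\<beta> * J * s * b) \<le> exp (\<beta> * J * s' * b) * exp (\<beta> * J * s * a)"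
    by (simp add: exp_add[symmetric])
  have "exp (\<beta> * J * s' * a) * exp (\<beta> * J * s * b) * (w a * w' b) \<le>
      exp (\<beta> * J * s' * b) * exp (\<beta> * J * s * a) * (w b * w' a)"
    using pos ab by (intro mult_mono[OF e lr_leD[OF assms(2) ab]] mult_nonneg_nonneg)
      (auto intro: less_imp_le)
  then show "exp (\<beta> * J * s' * a) * w a * (exp (\<beta> * J * s * b) * w' b) \<le>
      exp (\<beta> * J * s' * b) * w b * (exp (\<beta> * J * s * a) * w' a)"
    by (simp add: mult_ac)
qed

text \<open>For each child, the quotient of the factors of the transferred weights at \<open>s\<close> and at \<open>t \<le> s\<close> is an average of the increasing function
\<open>exp (\<beta> * J * (s - t) * r)\<close> under the child's law given parent spin \<open>t\<close>, so it grows with the message.\<close>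

lemma transfer_lr_le:
  assumes lr: "\<And>b. lr_le (spin_set (b # v)) (w (b # v)) (w' (b # v))"
    and pos: "\<And>b t. t \<in> spin_set (b # v) \<Longrightarrow> w (b # v) t > 0"
      "\<And>b t. t \<in> spin_set (b # v) \<Longrightarrow> w' (b # v) t > 0"
  shows "lr_le S (transfer w v) (transfer w' v)"
  unfolding lr_le_def
proof (intro ballI impI)
  fix s t assume "s \<in> S" "t \<in> S" "t \<le> s"
  let ?A = "\<lambda>w b s. \<Sum>r\<in>spin_set (b # v). exp (\<beta> * J * s * r) * w (b # v) r"
  have Apos: "?A w b a > 0" "?A w' b a > 0" for b a
    using pos by (auto intro!: sum_pos)
  have "?A w b s * ?A w' b t \<le> ?A w b t * ?A w' b s" for b
  proof -
    let ?S = "spin_set (b # v)" and ?k = "\<lambda>r. exp (\<beta> * J * (s - t) * r)"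
    have cross: "x / y \<le> z / u \<Longrightarrow> y > 0 \<Longrightarrow> u > 0 \<Longrightarrow> x * u \<le> y * z" for x y z u :: real
      by (simp add: field_simps)
    have shift: "?k r * (exp (\<beta> * J * t * r) * c) = exp (\<beta> * J * s * r) * c" for r c
    proof -
      have "\<beta> * J * (s - t) * r + \<beta> * J * t * r = \<beta> * J * s * r"
        by (simp add: algebra_simps)
      then show ?thesis
        by (simp only: mult.assoc[of _ _ c, symmetric] exp_add[symmetric])
    qed
    have "(\<Sum>r\<in>?S. ?k r * (exp (\<beta> * J * t * r) * w (b # v) r)) / ?A w b t \<le>
        (\<Sum>r\<in>?S. ?k r * (exp (\<beta> * J * t * r) * w' (b # v) r)) / ?A w' b t"
    proof (rule weighted_average_mono)
      show "lr_le ?S (\<lambda>r. exp (\<beta> * J * t * r) * w (b # v) r) (\<lambda>r. exp (\<beta> * J * t * r) * w' (b # v) r)"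
        by (rule kernel_lr_le[OF order_refl lr]) (rule pos, assumption)+
      show "?k r \<le> ?k r'" if "r \<le> r'" for r r'
        unfolding exp_le_cancel_iff using that \<open>t \<le> s\<close> J_pos beta_pos
        by (intro mult_left_mono mult_nonneg_nonneg) auto
    qed (use pos in auto)
    then show ?thesis
      unfolding shift by (rule cross) (rule Apos)+
  qed
  then have "(\<Prod>b\<in>UNIV. ?A w b s * ?A w' b t) \<le> (\<Prod>b\<in>UNIV. ?A w b t * ?A w' b s)"
    using Apos by (intro prod_mono) (auto intro!: mult_nonneg_nonneg less_imp_le)
  then show "transfer w v s * transfer w' v t \<le> transfer w v t * transfer w' v s"
    by (simp add: transfer_def prod.distrib)
qed

text \<open>The extra factor is the conditional expectation of \<open>k\<close> at the children given the spin \<open>s\<close> of the parent. Peeling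
off a level thus keeps messages of the form (conditional expectation) times (weight).\<close>

lemma transfer_ratio:
  assumes "\<And>b t. t \<in> spin_set (b # v) \<Longrightarrow> w (b # v) t > 0"
  shows "transfer (\<lambda>v t. k v t * w v t) v s =
    (\<Prod>b\<in>UNIV. (\<Sum>t\<in>spin_set (b # v). k (b # v) t * (exp (\<beta> * J * s * t) * w (b # v) t)) /
        (\<Sum>t\<in>spin_set (b # v). exp (\<beta> * J * s * t) * w (b # v) t)) * transfer w v s"
proof -
  have "(\<Sum>t\<in>spin_set (b # v). exp (\<beta> * J * s * t) * w (b # v) t) > 0" for b
    using assms by (intro sum_pos) auto
  then have "(\<Sum>t\<in>spin_set (b # v). exp (\<beta> * J * s * t) * w (b # v) t) \<noteq> 0" for b
    by (metis less_irrefl)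
  then show ?thesis
    unfolding transfer_def prod.distrib[symmetric]
    by (intro prod.cong refl) (simp add: mult.left_commute)
qed

text \<open>The induction peels off one level at a time and therefore needs the generality of \<open>g\<close>: after peeling, \<open>g v s\<close> is the
conditional probability of the part of the event below \<open>v\<close> given the spin \<open>s\<close>. Conditional expectations of increasing
functions are increasing in the parent spin and in the message, so the hypotheses reproduce themselves. At
the root the claim is \<open>weighted_average_mono\<close>.\<close>

lemma partition_ratio_mono_aux:
  assumes pos: "\<And>v s. v \<in> level n \<Longrightarrow> s \<in> spin_set v \<Longrightarrow> w v s > 0"
      "\<And>v s. v \<in> level n \<Longrightarrow> s \<in> spin_set v \<Longrightarrow> w' v s > 0"
    and lr: "\<And>v. v \<in> level n \<Longrightarrow> lr_le (spin_set v) (w v) (w' v)"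
    and u_nonneg: "\<And>v s. 0 \<le> u v s"
    and u_mono: "\<And>v s t. t \<le> s \<Longrightarrow> u v t \<le> u v s"
    and g_nonneg: "\<And>v s. v \<in> level n \<Longrightarrow> s \<in> spin_set v \<Longrightarrow> 0 \<le> g v s"
    and g_mono: "\<And>v s t. v \<in> level n \<Longrightarrow> s \<in> spin_set v \<Longrightarrow> t \<in> spin_set v \<Longrightarrow> t \<le> s \<Longrightarrow> g v t \<le> g v s"
    and g_le: "\<And>v s. v \<in> level n \<Longrightarrow> s \<in> spin_set v \<Longrightarrow> g v s \<le> g' v s"
  shows "partition_fun n u (\<lambda>v s. g v s * w v s) / partition_fun n (\<lambda>_ _. 1) w \<le>
    partition_fun n u (\<lambda>v s. g' v s * w' v s) / partition_fun n (\<lambda>_ _. 1) w'"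
  using pos lr g_nonneg g_mono g_le
proof (induction n arbitrary: w w' g g')
  case 0
  have root: "[] \<in> level 0" by (simp add: level_eq)
  have "(\<Sum>s\<in>spin_set []. (u [] s * g [] s) * w [] s) / (\<Sum>s\<in>spin_set []. w [] s) \<le>
      (\<Sum>s\<in>spin_set []. (u [] s * g' [] s) * w' [] s) / (\<Sum>s\<in>spin_set []. w' [] s)"
  proof (rule weighted_average_mono)
    fix s t assume "s \<in> spin_set []" "t \<in> spin_set []" "t \<le> s"
    then show "u [] t * g [] t \<le> u [] s * g [] s"
      using 0 u_nonneg u_mono root by (intro mult_mono) auto
  qed (use 0 root u_nonneg in \<open>auto intro: mult_left_mono\<close>)
  then show ?case by (simp add: partition_fun_0 mult.assoc)
next
  case (Suc n)
  have child: "b # v \<in> level (Suc n)" if "v \<in> level n" for v b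
    using that by (simp add: level_eq)
  define avg where "avg k m v s = (\<Prod>b\<in>UNIV.
      (\<Sum>t\<in>spin_set (b # v). (u (b # v) t * k (b # v) t) * (exp (\<beta> * J * s * t) * m (b # v) t)) /
      (\<Sum>t\<in>spin_set (b # v). exp (\<beta> * J * s * t) * m (b # v) t))" for k m v s
  have peel: "partition_fun (Suc n) u (\<lambda>v s. k v s * m v s) / partition_fun (Suc n) (\<lambda>_ _. 1) m =
      partition_fun n u (\<lambda>v s. avg k m v s * transfer m v s) / partition_fun n (\<lambda>_ _. 1) (transfer m)"
    if "\<And>v s. v \<in> level (Suc n) \<Longrightarrow> s \<in> spin_set v \<Longrightarrow> m v s > 0" for k m
  proof -
    have "transfer (\<lambda>v t. u v t * (k v t * m v t)) v s = avg k m v s * transfer m v s"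
      if "v \<in> level n" for v s
      using transfer_ratio[where w = m and k = "\<lambda>v t. u v t * k v t" and v = v and s = s]
        \<open>\<And>v s. v \<in> level (Suc n) \<Longrightarrow> s \<in> spin_set v \<Longrightarrow> m v s > 0\<close> child[OF that]
      by (simp add: avg_def mult.assoc)
    then show ?thesis
      by (simp add: partition_fun_peel cong: partition_fun_cong)
  qed
  have tpos: "transfer m v s > 0"
    if "\<And>v s. v \<in> level (Suc n) \<Longrightarrow> s \<in> spin_set v \<Longrightarrow> m v s > 0" "v \<in> level n" for m v s
    using that child by (intro transfer_pos) auto
  have avg_le: "avg k m v t \<le> avg k' m' v s"
    if "v \<in> level n" "t \<le> s"
      and m: "\<And>v s. v \<in> level (Suc n) \<Longrightarrow> s \<in> spin_set v \<Longrightarrow> m v s > 0"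
      and m': "\<And>v s. v \<in> level (Suc n) \<Longrightarrow> s \<in> spin_set v \<Longrightarrow> m' v s > 0"
      and lr: "\<And>v. v \<in> level (Suc n) \<Longrightarrow> lr_le (spin_set v) (m v) (m' v)"
      and k0: "\<And>v s. v \<in> level (Suc n) \<Longrightarrow> s \<in> spin_set v \<Longrightarrow> 0 \<le> k v s"
      and km: "\<And>v s t. v \<in> level (Suc n) \<Longrightarrow> s \<in> spin_set v \<Longrightarrow> t \<in> spin_set v \<Longrightarrow> t \<le> s \<Longrightarrow> k v t \<le> k v s"
      and kk: "\<And>v s. v \<in> level (Suc n) \<Longrightarrow> s \<in> spin_set v \<Longrightarrow> k v s \<le> k' v s"
    for k k' m m' v s t
    unfolding avg_def
  proof (rule prod_mono, intro conjI)
    fix b :: bool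
    let ?S = "spin_set (b # v)"
    note c = child[OF that(1), of b]
    show "0 \<le> (\<Sum>r\<in>?S. u (b # v) r * k (b # v) r * (exp (\<beta> * J * t * r) * m (b # v) r)) /
        (\<Sum>r\<in>?S. exp (\<beta> * J * t * r) * m (b # v) r)"
      using c m k0 u_nonneg by (intro divide_nonneg_nonneg sum_nonneg mult_nonneg_nonneg) (auto intro: less_imp_le)
    show "(\<Sum>r\<in>?S. u (b # v) r * k (b # v) r * (exp (\<beta> * J * t * r) * m (b # v) r)) /
        (\<Sum>r\<in>?S. exp (\<beta> * J * t * r) * m (b # v) r) \<le>
      (\<Sum>r\<in>?S. u (b # v) r * k' (b # v) r * (exp (\<beta> * J * s * r) * m' (b # v) r)) /
        (\<Sum>r\<in>?S. exp (\<beta> * J * s * r) * m' (b # v) r)"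
    proof (rule weighted_average_mono)
      show "lr_le ?S (\<lambda>r. exp (\<beta> * J * t * r) * m (b # v) r) (\<lambda>r. exp (\<beta> * J * s * r) * m' (b # v) r)"
        using c m m' lr that(2) by (intro kernel_lr_le) auto
      fix x y assume "x \<in> ?S" "y \<in> ?S" "y \<le> x"
      then show "u (b # v) y * k (b # v) y \<le> u (b # v) x * k (b # v) x"
        using c u_nonneg u_mono k0 km by (intro mult_mono) auto
    qed (use c m m' kk u_nonneg in \<open>auto intro: mult_left_mono\<close>)
  qed
  have avg_nonneg: "0 \<le> avg g w v s" if "v \<in> level n" for v s
    unfolding avg_def using that child Suc.prems(1,4) u_nonneg
    by (intro prod_nonneg ballI divide_nonneg_nonneg sum_nonneg mult_nonneg_nonneg)
       (auto intro: less_imp_le)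
  have left: "partition_fun (Suc n) u (\<lambda>v s. g v s * w v s) / partition_fun (Suc n) (\<lambda>_ _. 1) w =
      partition_fun n u (\<lambda>v s. avg g w v s * transfer w v s) / partition_fun n (\<lambda>_ _. 1) (transfer w)"
    by (rule peel) (rule Suc.prems(1))
  have right: "partition_fun (Suc n) u (\<lambda>v s. g' v s * w' v s) / partition_fun (Suc n) (\<lambda>_ _. 1) w' =
      partition_fun n u (\<lambda>v s. avg g' w' v s * transfer w' v s) / partition_fun n (\<lambda>_ _. 1) (transfer w')"
    by (rule peel) (rule Suc.prems(2))
  show ?case
    unfolding left right
  proof (rule Suc.IH)
    fix v assume v: "v \<in> level n"
    show "lr_le (spin_set v) (transfer w v) (transfer w' v)"
      using Suc.prems(1-3) child[OF v] by (intro transfer_lr_le) auto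
    show "avg g w v t \<le> avg g w v s" if "t \<le> s" for s t
      using v that Suc.prems by (intro avg_le) (auto simp: lr_le_refl)
    show "avg g w v s \<le> avg g' w' v s" for s
      using v Suc.prems by (intro avg_le) auto
  qed (use tpos Suc.prems avg_nonneg in auto)
qed

lemma partition_ratio_mono:
  assumes pos: "\<And>v s. v \<in> level n \<Longrightarrow> s \<in> spin_set v \<Longrightarrow> w v s > 0"
      "\<And>v s. v \<in> level n \<Longrightarrow> s \<in> spin_set v \<Longrightarrow> w' v s > 0"
    and lr: "\<And>v. v \<in> level n \<Longrightarrow> lr_le (spin_set v) (w v) (w' v)"
    and u: "\<And>v s. 0 \<le> u v s" "\<And>v s t. t \<le> s \<Longrightarrow> u v t \<le> u v s"
  shows "partition_fun n u w / partition_fun n (\<lambda>_ _. 1) w \<le>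
    partition_fun n u w' / partition_fun n (\<lambda>_ _. 1) w'"
proof -
  have "partition_fun n u (\<lambda>v s. 1 * w v s) / partition_fun n (\<lambda>_ _. 1) w \<le>
      partition_fun n u (\<lambda>v s. 1 * w' v s) / partition_fun n (\<lambda>_ _. 1) w'"
    by (rule partition_ratio_mono_aux) (simp_all add: pos lr u)
  then show ?thesis by simp
qed

end

section \<open>Proportional messages and boundary laws\<close>

text \<open>Messages matter only up to a positive constant at each vertex; the constants cancel in all probabilities.\<close>

definition proportional :: "'a set \<Rightarrow> ('a \<Rightarrow> real) \<Rightarrow> ('a \<Rightarrow> real) \<Rightarrow> bool" where
  "proportional S w w' \<longleftrightarrow> (\<exists>c>0. \<forall>s\<in>S. w s = c * w' s)"

lemma proportionalI: "c > 0 \<Longrightarrow> (\<And>s. s \<in> S \<Longrightarrow> w s = c * w' s) \<Longrightarrow> proportional S w w'"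
  by (auto simp: proportional_def)

lemma proportionalE:
  assumes "proportional S w w'"
  obtains c where "c > 0" "\<And>s. s \<in> S \<Longrightarrow> w s = c * w' s"
  using assms by (auto simp: proportional_def)

lemma proportional_refl: "proportional S w w"
  by (rule proportionalI[of 1]) auto

lemma proportional_sym:
  assumes "proportional S w w'"
  shows "proportional S w' w"
proof -
  obtain c where "c > 0" "\<And>s. s \<in> S \<Longrightarrow> w s = c * w' s"
    using assms by (rule proportionalE) blast
  then show ?thesis by (intro proportionalI[of "inverse c"]) auto
qed

lemma proportional_trans:
  assumes "proportional S w w'" "proportional S w' w''"
  shows "proportional S w w''"
proof -
  obtain c where "c > 0" "\<And>s. s \<in> S \<Longrightarrow> w s = c * w' s"
    using assms(1) by (rule proportionalE) blast
  moreover obtain d where "d > 0" "\<And>s. s \<in> S \<Longrightarrow> w' s = d * w'' s"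
    using assms(2) by (rule proportionalE) blast
  ultimately show ?thesis by (intro proportionalI[of "c * d"]) auto
qed

lemma lr_le_proportional:
  assumes lr: "lr_le S w w'" and "proportional S v w" "proportional S v' w'"
  shows "lr_le S v v'"
proof -
  obtain c where c: "c > 0" "\<And>s. s \<in> S \<Longrightarrow> v s = c * w s"
    using assms(2) by (rule proportionalE) blast
  obtain d where d: "d > 0" "\<And>s. s \<in> S \<Longrightarrow> v' s = d * w' s"
    using assms(3) by (rule proportionalE) blast
  show ?thesis
    unfolding lr_le_def
  proof (intro ballI impI)
    fix s t assume "s \<in> S" "t \<in> S" "t \<le> s"
    with lr_leD[OF lr this] c(1) d(1) have "(c * d) * (w s * w' t) \<le> (c * d) * (w t * w' s)"
      by (intro mult_left_mono) auto
    with \<open>s \<in> S\<close> \<open>t \<in> S\<close> show "v s * v' t \<le> v t * v' s"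
      by (simp add: c(2) d(2) mult_ac)
  qed
qed

text \<open>The message that the parameter \<open>x\<close> determines, normalised to \<open>1\<close> at the reference spin of each class (\<open>-1/2\<close>, \<open>0\<close>
and \<open>-1/2\<close>).\<close>

definition boundary_law :: "real \<Rightarrow> real \<Rightarrow> vertex \<Rightarrow> real \<Rightarrow> real" where
  "boundary_law \<theta> x v s =
    (if length v mod 3 = 0 then if s = 1/2 then x^2 else 1
     else if length v mod 3 = 1 then if s = -1 then p_map \<theta> x else if s = 1 then q_map \<theta> x else 1
     else if s = -3/2 then T_map \<theta> x else if s = 1/2 then U_map \<theta> x
     else if s = 3/2 then N_map \<theta> x else 1)"

lemma map_pos:
  assumes "\<theta> > 0" "x > 0"
  shows "T_map \<theta> x > 0" "U_map \<theta> x > 0" "N_map \<theta> x > 0" "p_map \<theta> x > 0" "q_map \<theta> x > 0"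
    "f_map \<theta> x > 0"
proof -
  show TUN: "T_map \<theta> x > 0" "U_map \<theta> x > 0" "N_map \<theta> x > 0"
    using assms unfolding T_map_def U_map_def N_map_def
    by (intro zero_less_power divide_pos_pos add_pos_pos mult_pos_pos; simp)+
  show pq: "p_map \<theta> x > 0" "q_map \<theta> x > 0"
    using assms TUN unfolding p_map_def q_map_def
    by (intro zero_less_power divide_pos_pos add_pos_pos mult_pos_pos; simp)+
  show "f_map \<theta> x > 0"
    using assms pq unfolding f_map_def
    by (intro divide_pos_pos add_pos_pos mult_pos_pos; simp)
qed

lemma boundary_law_pos: "\<theta> > 0 \<Longrightarrow> x > 0 \<Longrightarrow> boundary_law \<theta> x v s > 0"
  by (simp add: boundary_law_def map_pos)

lemma divide_le_cross: "b > 0 \<Longrightarrow> d > 0 \<Longrightarrow> a * d \<le> b * c \<Longrightarrow> a / b \<le> c / d" for a b c d :: real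
  by (simp add: field_simps)

lemma f_map_bounds:
  assumes "\<theta> \<ge> 1" "x > 0"
  shows "f_map \<theta> x \<le> \<theta>^2" "inverse (\<theta>^2) \<le> f_map \<theta> x"
proof -
  let ?p = "p_map \<theta> x" and ?q = "q_map \<theta> x"
  have pos: "?p > 0" "?q > 0" using map_pos[of \<theta> x] assms by auto
  have t: "1 \<le> \<theta>^2" using assms by simp
  have "1 \<le> \<theta>^2 * \<theta>^2" using mult_mono[OF t t] by simp
  then have p: "?p \<le> \<theta>^2 * (\<theta>^2 * ?p)" and q: "?q \<le> \<theta>^2 * (\<theta>^2 * ?q)"
    using pos by (simp_all add: mult.assoc[symmetric])
  have th: "\<theta> \<le> \<theta>^2 * \<theta>" using t assms by simp
  have D: "\<theta>^2 * ?p + \<theta> + ?q > 0" "?p + \<theta> + \<theta>^2 * ?q > 0"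
    using pos assms by (auto intro!: add_pos_pos)
  have "?p + \<theta> + \<theta>^2 * ?q \<le> \<theta>^2 * (\<theta>^2 * ?p + \<theta> + ?q)"
    using p th by (simp add: distrib_left)
  then show "f_map \<theta> x \<le> \<theta>^2"
    unfolding f_map_def using D by (simp add: pos_divide_le_eq)
  have "\<theta>^2 * ?p + \<theta> + ?q \<le> \<theta>^2 * (?p + \<theta> + \<theta>^2 * ?q)"
    using q th by (simp add: distrib_left)
  then show "inverse (\<theta>^2) \<le> f_map \<theta> x"
    unfolding f_map_def inverse_eq_divide
    using D t by (intro divide_le_cross) auto
qed

lemma f_map_one:
  assumes "\<theta> > 0"
  shows "f_map \<theta> 1 = 1"
proof -
  have "T_map \<theta> 1 = N_map \<theta> 1" "U_map \<theta> 1 = 1"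
    using assms by (simp_all add: T_map_def N_map_def U_map_def add_ac)
  then have "q_map \<theta> 1 = p_map \<theta> 1"
    by (simp add: p_map_def q_map_def algebra_simps)
  moreover have "\<theta>^2 * p_map \<theta> 1 + \<theta> + p_map \<theta> 1 > 0"
    using assms map_pos[of \<theta> 1] by (auto intro!: add_pos_pos)
  ultimately show ?thesis by (simp add: f_map_def add_ac)
qed

lemma isCont_f_map:
  assumes "\<theta> > 0" "x > 0"
  shows "isCont (f_map \<theta>) x"
proof -
  have nz: "\<theta>^2 + \<theta> * x^2 \<noteq> 0" "x^2 + \<theta> \<noteq> 0"
    using assms by (auto intro!: less_imp_neq[symmetric] add_pos_pos)
  have T: "isCont (T_map \<theta>) x" "isCont (U_map \<theta>) x" "isCont (N_map \<theta>) x"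
    unfolding T_map_def[abs_def] U_map_def[abs_def] N_map_def[abs_def]
    by (intro continuous_intros; use nz in simp)+
  have nz2: "\<theta>^3 * (T_map \<theta> x + 1 + U_map \<theta> x + N_map \<theta> x) \<noteq> 0"
    using assms map_pos[of \<theta> x] by (auto intro!: less_imp_neq[symmetric] add_pos_pos)
  have p: "isCont (p_map \<theta>) x" "isCont (q_map \<theta>) x"
    unfolding p_map_def[abs_def] q_map_def[abs_def]
    by (intro continuous_intros T; use nz2 in simp)+
  have nz3: "\<theta>^2 * p_map \<theta> x + \<theta> + q_map \<theta> x \<noteq> 0"
    using assms map_pos[of \<theta> x] by (auto intro!: less_imp_neq[symmetric] add_pos_pos)
  show ?thesis
    unfolding f_map_def[abs_def]
    by (intro continuous_intros p; use nz3 in simp)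
qed

lemma exp_diff_eqD: "exp (a - b) = c \<Longrightarrow> exp a = exp b * c" for a b c :: real
  by (auto simp: exp_diff)

lemma constant_ratios_iff:
  assumes "\<theta> > 0" "x > 0"
  shows "constant_ratios h (x^2) (p_map \<theta> x) (q_map \<theta> x) (T_map \<theta> x) (U_map \<theta> x) (N_map \<theta> x) \<longleftrightarrow>
    (\<forall>v. proportional (spin_set v) (\<lambda>s. exp (h v s)) (boundary_law \<theta> x v))" (is "?L \<longleftrightarrow> ?R")
proof
  assume L: ?L
  show ?R
  proof
    fix v :: vertex
    have "length v mod 3 = 0 \<or> length v mod 3 = 1 \<or> length v mod 3 = 2" by linarith
    then show "proportional (spin_set v) (\<lambda>s. exp (h v s)) (boundary_law \<theta> x v)"
    proof (elim disjE)
      assume v: "length v mod 3 = 0"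
      then have "exp (h v (1/2)) = exp (h v (-1/2)) * x^2"
        using L by (intro exp_diff_eqD) (simp add: constant_ratios_def tree_class_eq)
      then show ?thesis
        unfolding proportional_def using v
        by (intro exI[of _ "exp (h v (-1/2))"]) (simp add: spin_set_cases boundary_law_def)
    next
      assume v: "length v mod 3 = 1"
      then have "exp (h v (-1)) = exp (h v 0) * p_map \<theta> x" "exp (h v 1) = exp (h v 0) * q_map \<theta> x"
        using L by (intro exp_diff_eqD; simp add: constant_ratios_def tree_class_eq)+
      then show ?thesis
        unfolding proportional_def using v
        by (intro exI[of _ "exp (h v 0)"]) (simp add: spin_set_cases boundary_law_def)
    next
      assume v: "length v mod 3 = 2"
      then have "exp (h v (-3/2)) = exp (h v (-1/2)) * T_map \<theta> x"
        "exp (h v (1/2)) = exp (h v (-1/2)) * U_map \<theta> x"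
        "exp (h v (3/2)) = exp (h v (-1/2)) * N_map \<theta> x"
        using L by (intro exp_diff_eqD; simp add: constant_ratios_def tree_class_eq)+
      then show ?thesis
        unfolding proportional_def using v
        by (intro exI[of _ "exp (h v (-1/2))"]) (simp add: spin_set_cases boundary_law_def)
    qed
  qed
next
  assume R: ?R
  have *: "exp (h v s - h v t) = boundary_law \<theta> x v s / boundary_law \<theta> x v t"
    if st: "s \<in> spin_set v" "t \<in> spin_set v" for v s t
  proof -
    obtain c where "c > 0" "\<And>s. s \<in> spin_set v \<Longrightarrow> exp (h v s) = c * boundary_law \<theta> x v s"
      using R[rule_format, of v] by (rule proportionalE) blast
    then show ?thesis using st by (simp add: exp_diff)
  qed
  show ?L
    unfolding constant_ratios_def tree_class_eq
    by (auto simp: * spin_set_cases boundary_law_def)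
qed

context ferromagnet
begin

abbreviation theta :: real where "theta \<equiv> exp (\<beta> * J / 2)"

lemma theta_gt_1: "theta > 1"
  using J_pos beta_pos by simp

lemma transfer_proportional:
  assumes "\<And>b. proportional (spin_set (b # v)) (w (b # v)) (w' (b # v))"
  shows "proportional S (transfer w v) (transfer w' v)"
proof -
  have "\<forall>b. \<exists>c>0. \<forall>s\<in>spin_set (b # v). w (b # v) s = c * w' (b # v) s"
    using assms by (auto simp: proportional_def)
  then obtain c where c: "\<And>b. c b > 0"
    "\<And>b s. s \<in> spin_set (b # v) \<Longrightarrow> w (b # v) s = c b * w' (b # v) s"
    by metis
  show ?thesis
  proof (rule proportionalI)
    show "(\<Prod>b\<in>UNIV. c b) > 0" using c(1) by (simp add: prod_pos)
    fix s
    have "(\<Sum>t\<in>spin_set (b # v). exp (\<beta> * J * s * t) * w (b # v) t) =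
        c b * (\<Sum>t\<in>spin_set (b # v). exp (\<beta> * J * s * t) * w' (b # v) t)" for b
      by (simp add: c(2) sum_distrib_left mult_ac)
    then show "transfer w v s = (\<Prod>b\<in>UNIV. c b) * transfer w' v s"
      by (simp only: transfer_def prod.distrib)
  qed
qed

lemma exp_spin_product:
  "s * t = real n / 4 \<Longrightarrow> exp (\<beta> * J * s * t) = exp (\<beta> * J / 4) ^ n"
  "s * t = - (real n / 4) \<Longrightarrow> exp (\<beta> * J * s * t) = inverse (exp (\<beta> * J / 4) ^ n)"
  unfolding mult.assoc[of _ s t] exp_of_nat_mult[symmetric] exp_minus[symmetric]
  by (simp_all add: mult.commute)

lemma exp_spin_product_theta:
  "s * t = real n / 2 \<Longrightarrow> exp (\<beta> * J * s * t) = theta ^ n"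
  "s * t = - (real n / 2) \<Longrightarrow> exp (\<beta> * J * s * t) = inverse (theta ^ n)"
  unfolding mult.assoc[of _ s t] exp_of_nat_mult[symmetric] exp_minus[symmetric]
  by (simp_all add: mult.commute)

lemma theta_sqrt: "theta = exp (\<beta> * J / 4) ^ 2"
  by (simp add: exp_of_nat_mult[symmetric] power2_eq_square exp_add[symmetric])

text \<open>The square is the contribution of the two children, whose messages depend on their common class only.\<close>

lemma transfer_spin_sum:
  assumes "\<And>b. spin_set (b # v) = S" "\<And>b t. t \<in> S \<Longrightarrow> w (b # v) t = m t"
  shows "transfer w v s = (\<Sum>t\<in>S. exp (\<beta> * J * s * t) * m t) ^ 2"
  unfolding transfer_def assms(1)
  by (simp add: assms(2) UNIV_bool power2_eq_square cong: sum.cong)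

text \<open>The children of a class-2 vertex carry the class-0 law with ratio \<open>x^2\<close>; the common factor is the transferred
weight of the reference spin \<open>-1/2\<close>. Powers of \<open>r = exp (\<beta> * J / 4)\<close> are used because the products of a
class-2 and a class-0 spin are odd multiples of \<open>1/4\<close>, so that \<open>\<theta> = r^2\<close> enters with half-integer powers.\<close>

lemma transfer_law_2:
  assumes "x > 0" and v: "length v mod 3 = 2"
  shows "proportional (spin_set v) (transfer (boundary_law theta x) v) (boundary_law theta x v)"
proof -
  define r where "r = exp (\<beta> * J / 4)"
  have r: "r > 0" by (simp add: r_def)
  have th: "theta = r^2" by (simp add: theta_sqrt r_def)
  have child: "length (b # v) mod 3 = 0" for b using v by (simp add: mod_Suc)
  have tr: "transfer (boundary_law theta x) v s =
      (exp (\<beta> * J * s * (-1/2)) + exp (\<beta> * J * s * (1/2)) * x^2) ^ 2" for s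
  proof -
    have "transfer (boundary_law theta x) v s =
        (\<Sum>t\<in>{-1/2, 1/2}. exp (\<beta> * J * s * t) * (if t = 1/2 then x^2 else 1)) ^ 2"
      by (rule transfer_spin_sum) (use child in \<open>auto simp: spin_set_cases boundary_law_def\<close>)
    then show ?thesis by simp
  qed
  have D: "r^2 + x^2 > 0" "(r^2)^2 + r^2 * x^2 = r^2 * (r^2 + x^2)" "x^2 + r^2 = r^2 + x^2"
    using r by (auto intro!: add_pos_nonneg simp: power2_eq_square algebra_simps)
  have TUN: "T_map theta x = ((x^2 + (r^2)^3) / (r^2 * (r^2 + x^2)))^2"
    "U_map theta x = ((r^2 * x^2 + 1) / (r^2 + x^2))^2"
    "N_map theta x = (((r^2)^3 * x^2 + 1) / (r^2 * (r^2 + x^2)))^2"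
    by (simp_all only: T_map_def U_map_def N_map_def th D)
  show ?thesis
  proof (rule proportionalI)
    show "(r + inverse r * x^2)^2 > 0"
      using r by (intro zero_less_power add_pos_nonneg) auto
    fix s assume "s \<in> spin_set v"
    then consider "s = -3/2" | "s = -1/2" | "s = 1/2" | "s = 3/2"
      using v by (auto simp: spin_set_cases)
    then show "transfer (boundary_law theta x) v s =
        (r + inverse r * x^2)^2 * boundary_law theta x v s"
    proof cases
      case 1
      have "r^3 + inverse (r^3) * x^2 = (r + inverse r * x^2) * ((x^2 + (r^2)^3) / (r^2 * (r^2 + x^2)))"
        using r D(1) by (simp add: divide_simps) algebra
      moreover have "exp (\<beta> * J * s * (-1/2)) = r^3" "exp (\<beta> * J * s * (1/2)) = inverse (r^3)"
        unfolding r_def using 1 by (intro exp_spin_product; simp)+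
      moreover have "boundary_law theta x v s = ((x^2 + (r^2)^3) / (r^2 * (r^2 + x^2)))^2"
        unfolding TUN(1)[symmetric] using 1 v
        by (simp add: boundary_law_def)
      ultimately show ?thesis by (simp only: tr power_mult_distrib)
    next
      case 2
      then have "exp (\<beta> * J * s * (-1/2)) = r^1" "exp (\<beta> * J * s * (1/2)) = inverse (r^1)"
        unfolding r_def by (intro exp_spin_product; simp)+
      moreover have "boundary_law theta x v s = 1"
        using 2 v by (simp add: boundary_law_def)
      ultimately show ?thesis by (simp only: tr power_one_right mult_1_right)
    next
      case 3
      have "inverse r + r * x^2 = (r + inverse r * x^2) * ((r^2 * x^2 + 1) / (r^2 + x^2))"
        using r D(1) by (simp add: divide_simps) algebra
      moreover have "exp (\<beta> * J * s * (-1/2)) = inverse (r^1)" "exp (\<beta> * J * s * (1/2)) = r^1"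
        unfolding r_def using 3 by (intro exp_spin_product; simp)+
      moreover have "boundary_law theta x v s = ((r^2 * x^2 + 1) / (r^2 + x^2))^2"
        unfolding TUN(2)[symmetric] using 3 v
        by (simp add: boundary_law_def)
      ultimately show ?thesis by (simp only: tr power_mult_distrib power_one_right)
    next
      case 4
      have "inverse (r^3) + r^3 * x^2 = (r + inverse r * x^2) * (((r^2)^3 * x^2 + 1) / (r^2 * (r^2 + x^2)))"
        using r D(1) by (simp add: divide_simps) algebra
      moreover have "exp (\<beta> * J * s * (-1/2)) = inverse (r^3)" "exp (\<beta> * J * s * (1/2)) = r^3"
        unfolding r_def using 4 by (intro exp_spin_product; simp)+
      moreover have "boundary_law theta x v s = (((r^2)^3 * x^2 + 1) / (r^2 * (r^2 + x^2)))^2"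
        unfolding TUN(3)[symmetric] using 4 v
        by (simp add: boundary_law_def)
      ultimately show ?thesis by (simp only: tr power_mult_distrib)
    qed
  qed
qed

lemma transfer_law_1:
  assumes "x > 0" and v: "length v mod 3 = 1"
  shows "proportional (spin_set v) (transfer (boundary_law theta x) v) (boundary_law theta x v)"
proof -
  define \<theta> where "\<theta> = theta"
  define T U N where "T = T_map \<theta> x" and "U = U_map \<theta> x" and "N = N_map \<theta> x"
  have \<theta>: "\<theta> > 0" by (simp add: \<theta>_def)
  have pos: "T > 0" "U > 0" "N > 0"
    using map_pos[of \<theta> x] \<theta> \<open>x > 0\<close> by (auto simp: T_def U_def N_def)
  have child: "length (b # v) mod 3 = 2" for b using v by (simp add: mod_Suc)
  have tr: "transfer (boundary_law theta x) v s =
      (exp (\<beta> * J * s * (-3/2)) * T + exp (\<beta> * J * s * (-1/2)) +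
       exp (\<beta> * J * s * (1/2)) * U + exp (\<beta> * J * s * (3/2)) * N) ^ 2" for s
  proof -
    have "transfer (boundary_law theta x) v s =
      (\<Sum>t\<in>{-3/2, -1/2, 1/2, 3/2}. exp (\<beta> * J * s * t) *
        (if t = -3/2 then T else if t = 1/2 then U else if t = 3/2 then N else 1)) ^ 2"
      by (rule transfer_spin_sum)
         (use child in \<open>auto simp: spin_set_cases boundary_law_def T_def U_def N_def \<theta>_def\<close>)
    then show ?thesis by (simp add: add.assoc)
  qed
  have D: "T + 1 + U + N > 0" using pos by simp
  show ?thesis
  proof (rule proportionalI)
    show "(T + 1 + U + N)^2 > 0" using D by simp
    fix s assume "s \<in> spin_set v"
    then consider "s = -1" | "s = 0" | "s = 1"
      using v by (auto simp: spin_set_cases)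
    then show "transfer (boundary_law theta x) v s = (T + 1 + U + N)^2 * boundary_law theta x v s"
    proof cases
      case 1
      have "\<theta>^3 * T + \<theta> + inverse \<theta> * U + inverse (\<theta>^3) * N =
          (T + 1 + U + N) * ((\<theta>^6 * T + \<theta>^4 + \<theta>^2 * U + N) / (\<theta>^3 * (T + 1 + U + N)))"
        using \<theta> D by (simp add: divide_simps) algebra
      moreover have "exp (\<beta> * J * s * (-3/2)) = \<theta>^3" "exp (\<beta> * J * s * (-1/2)) = \<theta>^1"
        "exp (\<beta> * J * s * (1/2)) = inverse (\<theta>^1)" "exp (\<beta> * J * s * (3/2)) = inverse (\<theta>^3)"
        unfolding \<theta>_def using 1 by (intro exp_spin_product_theta; simp)+
      moreover have "boundary_law theta x v s =
          ((\<theta>^6 * T + \<theta>^4 + \<theta>^2 * U + N) / (\<theta>^3 * (T + 1 + U + N)))^2"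
        using 1 v by (simp only: T_def U_def N_def \<theta>_def) (simp add: boundary_law_def p_map_def)
      ultimately show ?thesis by (simp only: tr power_mult_distrib power_one_right)
    next
      case 2
      then show ?thesis
        using v by (simp add: tr boundary_law_def)
    next
      case 3
      have "inverse (\<theta>^3) * T + inverse \<theta> + \<theta> * U + \<theta>^3 * N =
          (T + 1 + U + N) * ((T + \<theta>^2 + \<theta>^4 * U + \<theta>^6 * N) / (\<theta>^3 * (T + 1 + U + N)))"
        using \<theta> D by (simp add: divide_simps) algebra
      moreover have "exp (\<beta> * J * s * (-3/2)) = inverse (\<theta>^3)" "exp (\<beta> * J * s * (-1/2)) = inverse (\<theta>^1)"
        "exp (\<beta> * J * s * (1/2)) = \<theta>^1" "exp (\<beta> * J * s * (3/2)) = \<theta>^3"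
        unfolding \<theta>_def using 3 by (intro exp_spin_product_theta; simp)+
      moreover have "boundary_law theta x v s =
          ((T + \<theta>^2 + \<theta>^4 * U + \<theta>^6 * N) / (\<theta>^3 * (T + 1 + U + N)))^2"
        using 3 v by (simp only: T_def U_def N_def \<theta>_def) (simp add: boundary_law_def q_map_def)
      ultimately show ?thesis by (simp only: tr power_mult_distrib power_one_right)
    qed
  qed
qed

text \<open>Only at class-0 vertices does the parameter change: this is where the scalar map \<open>f_map\<close> comes from.\<close>

lemma transfer_law_0:
  assumes "x > 0" and v: "length v mod 3 = 0"
  shows "proportional (spin_set v) (transfer (boundary_law theta x) v)
    (boundary_law theta (f_map theta x) v)"
proof -
  define \<theta> where "\<theta> = theta"
  define p q where "p = p_map \<theta> x" and "q = q_map \<theta> x"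
  have \<theta>: "\<theta> > 0" by (simp add: \<theta>_def)
  have pos: "p > 0" "q > 0"
    using map_pos[of \<theta> x] \<theta> \<open>x > 0\<close> by (auto simp: p_def q_def)
  have child: "length (b # v) mod 3 = 1" for b using v by (simp add: mod_Suc)
  have tr: "transfer (boundary_law theta x) v s =
      (exp (\<beta> * J * s * (-1)) * p + 1 + exp (\<beta> * J * s * 1) * q) ^ 2" for s
  proof -
    have "transfer (boundary_law theta x) v s =
      (\<Sum>t\<in>{-1, 0, 1}. exp (\<beta> * J * s * t) * (if t = -1 then p else if t = 1 then q else 1)) ^ 2"
      by (rule transfer_spin_sum)
         (use child in \<open>auto simp: spin_set_cases boundary_law_def p_def q_def \<theta>_def\<close>)
    then show ?thesis by (simp add: add.assoc)
  qed
  have D: "\<theta>^2 * p + \<theta> + q > 0" using pos \<theta> by (intro add_pos_pos) auto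
  show ?thesis
  proof (rule proportionalI)
    show "(\<theta> * p + 1 + inverse \<theta> * q)^2 > 0"
      using pos \<theta> by (intro zero_less_power add_pos_pos) auto
    fix s assume "s \<in> spin_set v"
    then consider "s = -1/2" | "s = 1/2"
      using v by (auto simp: spin_set_cases)
    then show "transfer (boundary_law theta x) v s =
        (\<theta> * p + 1 + inverse \<theta> * q)^2 * boundary_law theta (f_map theta x) v s"
    proof cases
      case 1
      then have "exp (\<beta> * J * s * (-1)) = \<theta>^1" "exp (\<beta> * J * s * 1) = inverse (\<theta>^1)"
        unfolding \<theta>_def by (intro exp_spin_product_theta; simp)+
      moreover have "boundary_law theta (f_map theta x) v s = 1"
        using 1 v by (simp add: boundary_law_def)
      ultimately show ?thesis by (simp only: tr power_one_right mult_1_right)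
    next
      case 2
      have "inverse \<theta> * p + 1 + \<theta> * q =
          (\<theta> * p + 1 + inverse \<theta> * q) * ((p + \<theta> + \<theta>^2 * q) / (\<theta>^2 * p + \<theta> + q))"
        using \<theta> D by (simp add: divide_simps) algebra
      moreover have "exp (\<beta> * J * s * (-1)) = inverse (\<theta>^1)" "exp (\<beta> * J * s * 1) = \<theta>^1"
        unfolding \<theta>_def using 2 by (intro exp_spin_product_theta; simp)+
      moreover have "boundary_law theta (f_map theta x) v s =
          ((p + \<theta> + \<theta>^2 * q) / (\<theta>^2 * p + \<theta> + q))^2"
        using 2 v by (simp only: p_def q_def \<theta>_def) (simp add: boundary_law_def f_map_def)
      ultimately show ?thesis by (simp only: tr power_mult_distrib power_one_right)
    qed
  qed
qed


section \<open>Iterating the transfer\<close>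

lemma transfer_pow_pos:
  assumes "\<And>v s. s \<in> spin_set v \<Longrightarrow> w v s > 0" "s \<in> spin_set v"
  shows "(transfer ^^ k) w v s > 0"
  using assms by (induction k arbitrary: v s) (auto intro: transfer_pos)

lemma transfer_pow_lr_le:
  assumes pos: "\<And>v s. s \<in> spin_set v \<Longrightarrow> w v s > 0" "\<And>v s. s \<in> spin_set v \<Longrightarrow> w' v s > 0"
    and lr: "\<And>v. v \<in> level (n + k) \<Longrightarrow> lr_le (spin_set v) (w v) (w' v)"
    and "v \<in> level n"
  shows "lr_le (spin_set v) ((transfer ^^ k) w v) ((transfer ^^ k) w' v)"
  using lr \<open>v \<in> level n\<close>
proof (induction k arbitrary: n v)
  case (Suc k)
  have "lr_le (spin_set (b # v)) ((transfer ^^ k) w (b # v)) ((transfer ^^ k) w' (b # v))" for b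
    using Suc.prems by (intro Suc.IH[of "Suc n"]) (auto simp: level_eq)
  then have "lr_le (spin_set v) (transfer ((transfer ^^ k) w) v) (transfer ((transfer ^^ k) w') v)"
    using pos by (intro transfer_lr_le transfer_pow_pos)
  then show ?case by simp
qed simp

lemma transfer_pow_proportional:
  assumes "\<And>v. v \<in> level (n + k) \<Longrightarrow> proportional (spin_set v) (w v) (w' v)" "v \<in> level n"
  shows "proportional (spin_set v) ((transfer ^^ k) w v) ((transfer ^^ k) w' v)"
  using assms
proof (induction k arbitrary: n v)
  case (Suc k)
  have "proportional (spin_set (b # v)) ((transfer ^^ k) w (b # v)) ((transfer ^^ k) w' (b # v))" for b
    using Suc.prems by (intro Suc.IH[of "Suc n"]) (auto simp: level_eq)
  then have "proportional (spin_set v) (transfer ((transfer ^^ k) w) v) (transfer ((transfer ^^ k) w') v)"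
    by (rule transfer_proportional)
  then show ?case by simp
qed simp

lemma transfer3_law:
  assumes "x > 0" "length v mod 3 = 0"
  shows "proportional (spin_set v) ((transfer ^^ 3) (boundary_law theta x) v)
    (boundary_law theta (f_map theta x) v)"
proof -
  let ?l = "boundary_law theta x"
  have 2: "proportional (spin_set y) (transfer ?l y) (?l y)" if "length y mod 3 = 2" for y
    using transfer_law_2[OF assms(1) that] .
  have 1: "proportional (spin_set y) (transfer (transfer ?l) y) (?l y)" if "length y mod 3 = 1" for y
  proof (rule proportional_trans)
    show "proportional (spin_set y) (transfer (transfer ?l) y) (transfer ?l y)"
      using that by (intro transfer_proportional 2) (simp add: mod_Suc)
  qed (rule transfer_law_1[OF assms(1) that])
  have "proportional (spin_set v) (transfer (transfer (transfer ?l)) v) (boundary_law theta (f_map theta x) v)"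
  proof (rule proportional_trans)
    show "proportional (spin_set v) (transfer (transfer (transfer ?l)) v) (transfer ?l v)"
      using assms(2) by (intro transfer_proportional 1) (simp add: mod_Suc)
  qed (rule transfer_law_0[OF assms])
  then show ?thesis by (simp add: numeral_3_eq_3)
qed

lemma f_iterate_pos: "x > 0 \<Longrightarrow> (f_map theta ^^ k) x > 0"
  by (induction k) (auto simp: map_pos)

lemma transfer_pow_law:
  assumes "x > 0" "length v mod 3 = 0"
  shows "proportional (spin_set v) ((transfer ^^ (3 * k)) (boundary_law theta x) v)
    (boundary_law theta ((f_map theta ^^ k) x) v)"
  using assms(2)
proof (induction k arbitrary: v)
  case 0
  then show ?case by (simp add: proportional_refl)
next
  case (Suc k)
  have "proportional (spin_set v) ((transfer ^^ 3) ((transfer ^^ (3 * k)) (boundary_law theta x)) v)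
      ((transfer ^^ 3) (boundary_law theta ((f_map theta ^^ k) x)) v)"
  proof (rule transfer_pow_proportional)
    show "v \<in> level (length v)" by (simp add: level_eq)
    fix y assume "y \<in> level (length v + 3)"
    with Suc.prems show "proportional (spin_set y) ((transfer ^^ (3 * k)) (boundary_law theta x) y)
        (boundary_law theta ((f_map theta ^^ k) x) y)"
      by (intro Suc.IH) (simp add: level_eq)
  qed
  from proportional_trans[OF this transfer3_law[OF f_iterate_pos[OF assms(1)] Suc.prems]]
  have "proportional (spin_set v) ((transfer ^^ (3 + 3 * k)) (boundary_law theta x) v)
      (boundary_law theta ((f_map theta ^^ Suc k) x) v)"
    by (simp only: funpow_add comp_def) simp
  then show ?case by (simp only: mult_Suc_right)
qed

lemma lr_le_half:
  assumes "length v mod 3 = 0"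
  shows "lr_le (spin_set v) w w' \<longleftrightarrow> w (1/2) * w' (-1/2) \<le> w (-1/2) * w' (1/2)"
  using assms by (auto simp: lr_le_def spin_set_cases mult.commute)

text \<open>Monotonicity of the scalar map is inherited from the transfer: three transfers preserve the
likelihood-ratio order and act on the parameter as \<open>f_map\<close>.\<close>

lemma f_map_mono:
  assumes "0 < x" "x \<le> y"
  shows "f_map theta x \<le> f_map theta y"
proof -
  let ?l = "boundary_law theta"
  have y: "y > 0" using assms by simp
  have "lr_le (spin_set []) ((transfer ^^ 3) (?l x) []) ((transfer ^^ 3) (?l y) [])"
  proof (rule transfer_pow_lr_le)
    show "[] \<in> level 0" by (simp add: level_eq)
    fix v :: vertex assume "v \<in> level (0 + 3)"
    then show "lr_le (spin_set v) (?l x v) (?l y v)"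
      using assms by (subst lr_le_half) (auto simp: level_eq boundary_law_def power_mono)
  qed (use assms y in \<open>auto simp: boundary_law_pos\<close>)
  then have "lr_le (spin_set []) (?l (f_map theta x) []) (?l (f_map theta y) [])"
    by (rule lr_le_proportional) (intro proportional_sym[OF transfer3_law], use assms y in simp_all)+
  then have "(f_map theta x)^2 \<le> (f_map theta y)^2"
    by (simp add: lr_le_half boundary_law_def)
  then show ?thesis
    by (rule power2_le_imp_le) (use map_pos(6)[of theta y] y in simp)
qed

text \<open>Spins of class 1 are at most \<open>1\<close> in modulus, so each child changes the ratio of the weights of \<open>1/2\<close> and \<open>-1/2\<close> by at
most a factor \<open>exp (\<beta> * J) = \<theta>^2\<close>. This bounds what any boundary condition can achieve.\<close>

lemma transfer_law_bounds:
  assumes pos: "\<And>v s. s \<in> spin_set v \<Longrightarrow> w v s > 0" and v: "length v mod 3 = 0"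
  shows "lr_le (spin_set v) (transfer w v) (boundary_law theta (theta^2) v)"
    and "lr_le (spin_set v) (boundary_law theta (inverse (theta^2)) v) (transfer w v)"
proof -
  let ?A = "\<lambda>b s. \<Sum>t\<in>spin_set (b # v). exp (\<beta> * J * s * t) * w (b # v) t"
  have S: "spin_set (b # v) = {-1, 0, 1}" for b
    using v by (simp add: spin_set_cases mod_Suc)
  have A0: "?A b s \<ge> 0" for b s
    using pos by (intro sum_nonneg mult_nonneg_nonneg) (auto intro: less_imp_le)
  have e: "theta^2 = exp (\<beta> * J)"
    by (simp add: exp_double[symmetric])
  have step: "?A b s \<le> theta^2 * ?A b s'" if "\<bar>s - s'\<bar> \<le> 1" for b s s'
    unfolding sum_distrib_left
  proof (rule sum_mono)
    fix t assume t: "t \<in> spin_set (b # v)"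
    then have "\<bar>t\<bar> \<le> 1" by (auto simp: S)
    with that have "\<bar>s - s'\<bar> * \<bar>t\<bar> \<le> 1 * 1"
      by (intro mult_mono) auto
    then have "(s - s') * t \<le> 1"
      by (simp add: abs_mult[symmetric] abs_le_iff)
    then have "\<beta> * J * ((s - s') * t) \<le> \<beta> * J * 1"
      using J_pos beta_pos by (intro mult_left_mono) auto
    then have "\<beta> * J * s * t \<le> \<beta> * J + \<beta> * J * s' * t"
      by (simp add: algebra_simps)
    then have "exp (\<beta> * J * s * t) \<le> theta^2 * exp (\<beta> * J * s' * t)"
      unfolding e exp_add[symmetric] exp_le_cancel_iff .
    with pos[OF t] show "exp (\<beta> * J * s * t) * w (b # v) t \<le>
        theta^2 * (exp (\<beta> * J * s' * t) * w (b # v) t)"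
      by (simp add: mult.assoc[symmetric])
  qed
  have "transfer w v s \<le> (\<Prod>b\<in>(UNIV::bool set). theta^2) * transfer w v s'" if "\<bar>s - s'\<bar> \<le> 1" for s s'
    unfolding transfer_def prod.distrib[symmetric]
    by (rule prod_mono) (use step[OF that] A0 in auto)
  then have "transfer w v s \<le> (theta^2)^2 * transfer w v s'" if "\<bar>s - s'\<bar> \<le> 1" for s s'
    using that by (simp only: prod_constant card_UNIV_bool)
  from this[of "1/2" "-1/2"] this[of "-1/2" "1/2"] v theta_gt_1
  show "lr_le (spin_set v) (transfer w v) (boundary_law theta (theta^2) v)"
    "lr_le (spin_set v) (boundary_law theta (inverse (theta^2)) v) (transfer w v)"
    by (simp_all only: lr_le_half) (simp_all add: boundary_law_def mult.commute field_simps)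
qed

lemma f_iterate_bounds:
  assumes x: "x > 0" "f_map theta x = x"
  shows "x \<le> (f_map theta ^^ k) (theta^2)" "(f_map theta ^^ k) (inverse (theta^2)) \<le> x"
proof -
  show "x \<le> (f_map theta ^^ k) (theta^2)"
  proof (induction k)
    case 0
    then show ?case using f_map_bounds(1)[of theta x] theta_gt_1 x by simp
  next
    case (Suc k)
    from f_map_mono[OF x(1) this] show ?case by (simp add: x(2))
  qed
  show "(f_map theta ^^ k) (inverse (theta^2)) \<le> x"
  proof (induction k)
    case 0
    then show ?case using f_map_bounds(2)[of theta x] theta_gt_1 x by simp
  next
    case (Suc k)
    from f_map_mono[OF _ this] show ?case by (simp add: x(2) f_iterate_pos)
  qed
qed

lemma f_iterate_limit:
  assumes "x0 > 0" "(\<lambda>k. (f_map theta ^^ k) x0) \<longlonglongrightarrow> L" "L > 0"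
  shows "f_map theta L = L"
proof -
  have "(\<lambda>k. f_map theta ((f_map theta ^^ k) x0)) \<longlonglongrightarrow> f_map theta L"
    by (rule isCont_tendsto_compose[OF isCont_f_map assms(2)]) (use assms(3) in auto)
  moreover have "(\<lambda>k. f_map theta ((f_map theta ^^ k) x0)) \<longlonglongrightarrow> L"
    using LIMSEQ_Suc[OF assms(2)] by simp
  ultimately show ?thesis by (rule LIMSEQ_unique)
qed

text \<open>The iterates decrease because \<open>\<theta>^2\<close> bounds the range of \<open>f_map \<theta>\<close>, and they stay above every fixed point; their limit
is a fixed point by continuity, hence the largest one.\<close>

lemma f_iterate_top:
  assumes x: "x > 0" "f_map theta x = x"
    and max: "\<And>y. y > 0 \<Longrightarrow> f_map theta y = y \<Longrightarrow> y \<le> x"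
  shows "(\<lambda>k. (f_map theta ^^ k) (theta^2)) \<longlonglongrightarrow> x"
proof -
  let ?a = "\<lambda>k. (f_map theta ^^ k) (theta^2)"
  have p: "theta^2 > 0" by simp
  have "?a (Suc k) \<le> ?a k" for k
  proof (induction k)
    case 0
    then show ?case using f_map_bounds(1)[of theta "theta^2"] theta_gt_1 by simp
  next
    case (Suc k)
    from f_map_mono[OF f_iterate_pos[OF p, of "Suc k"] this] show ?case by simp
  qed
  then have "decseq ?a" by (rule decseq_SucI)
  then obtain L where L: "?a \<longlonglongrightarrow> L"
    by (rule decseq_convergent[of ?a x]) (use f_iterate_bounds(1)[OF x] in auto)
  have "x \<le> L"
    by (rule LIMSEQ_le_const[OF L]) (use f_iterate_bounds(1)[OF x] in auto)
  moreover from this have "L \<le> x"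
    using f_iterate_limit[OF p L] x by (intro max) auto
  ultimately show ?thesis using L by simp
qed

lemma f_iterate_bot:
  assumes x: "x > 0" "f_map theta x = x"
    and min: "\<And>y. y > 0 \<Longrightarrow> f_map theta y = y \<Longrightarrow> x \<le> y"
  shows "(\<lambda>k. (f_map theta ^^ k) (inverse (theta^2))) \<longlonglongrightarrow> x"
proof -
  let ?a = "\<lambda>k. (f_map theta ^^ k) (inverse (theta^2))"
  have p: "inverse (theta^2) > 0" by simp
  have up: "?a k \<le> ?a (Suc k)" for k
  proof (induction k)
    case 0
    then show ?case using f_map_bounds(2)[of theta "inverse (theta^2)"] theta_gt_1 by simp
  next
    case (Suc k)
    from f_map_mono[OF f_iterate_pos[OF p, of k] this] show ?case by simp
  qed
  then have inc: "incseq ?a" by (rule incseq_SucI)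
  then obtain L where L: "?a \<longlonglongrightarrow> L"
    by (rule incseq_convergent[of ?a x]) (use f_iterate_bounds(2)[OF x] in auto)
  have "L \<le> x"
    by (rule LIMSEQ_le_const2[OF L]) (use f_iterate_bounds(2)[OF x] in auto)
  moreover have "?a 0 \<le> L" by (rule incseq_le[OF inc L])
  then have "L > 0" by (intro less_le_trans[OF p]) simp
  with f_iterate_limit[OF p L] have "x \<le> L" by (intro min)
  ultimately show ?thesis using L by simp
qed

section \<open>Compatible fields\<close>

lemma field_weight_eq:
  "field_weight J \<beta> h n \<xi> = boltz n \<xi> * (\<Prod>v\<in>level n. exp (h v (\<xi> v)))"
  by (simp only: field_weight_def boltz_def exp_add exp_sum finite_level)

lemma field_normalisation:
  "(\<Sum>\<eta>\<in>configs (tree_ball n). field_weight J \<beta> h n \<eta>) =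
    partition_fun n (\<lambda>_ _. 1) (\<lambda>v s. exp (h v s))"
  by (simp add: field_weight_eq partition_fun_def)

lemma field_normalisation_pos: "partition_fun n (\<lambda>_ _. 1) (\<lambda>v s. exp (h v s)) > 0"
  by (rule partition_fun_pos) simp

lemma field_dist_eq:
  "field_dist J \<beta> h n \<xi> = boltz n \<xi> * (\<Prod>v\<in>level n. exp (h v (\<xi> v))) /
    partition_fun n (\<lambda>_ _. 1) (\<lambda>v s. exp (h v s))"
  by (simp only: field_dist_def field_normalisation) (simp only: field_weight_eq)

lemma field_dist_marginal:
  assumes "\<xi> \<in> configs (tree_ball n)"
  shows "(\<Sum>\<omega>\<in>configs (level (Suc n)).
      field_dist J \<beta> h (Suc n) (merge (tree_ball n) (level (Suc n)) (\<xi>, \<omega>))) =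
    boltz n \<xi> * (\<Prod>v\<in>level n. transfer (\<lambda>v s. exp (h v s)) v (\<xi> v)) /
      partition_fun n (\<lambda>_ _. 1) (transfer (\<lambda>v s. exp (h v s)))"
proof -
  let ?m = "\<lambda>\<omega>. merge (tree_ball n) (level (Suc n)) (\<xi>, \<omega>)"
  let ?Z = "partition_fun n (\<lambda>_ _. 1) (transfer (\<lambda>v s. exp (h v s)))"
  have lev: "(\<Prod>v\<in>level (Suc n). exp (h v (?m \<omega> v))) = (\<Prod>v\<in>level (Suc n). exp (h v (\<omega> v)))" for \<omega>
    by (simp add: merge_ball_level cong: prod.cong)
  have "(\<Sum>\<omega>\<in>configs (level (Suc n)). field_dist J \<beta> h (Suc n) (?m \<omega>)) =
    (\<Sum>\<omega>\<in>configs (level (Suc n)). boltz n \<xi> *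
      ((\<Prod>v\<in>level n. \<Prod>b\<in>UNIV. exp (\<beta> * J * \<xi> v * \<omega> (b # v))) *
       (\<Prod>v\<in>level (Suc n). exp (h v (\<omega> v)))) / ?Z)"
    by (simp only: field_dist_eq boltz_merge lev partition_fun_peel mult_1_left mult.assoc)
  also have "\<dots> = boltz n \<xi> * (\<Prod>v\<in>level n. transfer (\<lambda>v s. exp (h v s)) v (\<xi> v)) / ?Z"
    by (simp only: sum_divide_distrib[symmetric] sum_distrib_left[symmetric]
        sum_outer_level[OF assms, where w = "\<lambda>v s. exp (h v s)"])
  finally show ?thesis .
qed

text \<open>If the transferred message is proportional to the message, the constants cancel in the normalised marginal.
Conversely, compatibility says that the product over level \<open>n\<close> of the quotients of transferred and original
weights does not depend on the configuration; changing the spin of a single vertex shows that each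
quotient is constant in that spin.\<close>

lemma compatible_iff:
  "compatible J \<beta> h \<longleftrightarrow>
    (\<forall>v. proportional (spin_set v) (transfer (\<lambda>v s. exp (h v s)) v) (\<lambda>s. exp (h v s)))"
    (is "?L \<longleftrightarrow> ?R")
proof
  let ?w = "\<lambda>v s. exp (h v s)"
  assume R: ?R
  have "\<forall>v. \<exists>c>0. \<forall>s\<in>spin_set v. transfer ?w v s = c * ?w v s"
    using R by (simp add: proportional_def)
  then obtain c where c: "\<And>v. c v > 0" "\<And>v s. s \<in> spin_set v \<Longrightarrow> transfer ?w v s = c v * ?w v s"
    by metis
  show ?L
    unfolding compatible_def
  proof (intro allI impI ballI)
    fix n :: nat and \<xi> assume "1 \<le> n" and "\<xi> \<in> configs (tree_ball (n - 1))"
    then obtain m where n: "n = Suc m" and \<xi>: "\<xi> \<in> configs (tree_ball m)"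
      by (cases n) auto
    have "partition_fun m (\<lambda>_ _. 1) (transfer ?w) = partition_fun m (\<lambda>_ _. 1) (\<lambda>v s. c v * ?w v s)"
      by (rule partition_fun_cong) (auto simp: c)
    also have "\<dots> = (\<Prod>v\<in>level m. c v) * partition_fun m (\<lambda>_ _. 1) ?w"
      by (rule partition_fun_scale)
    finally have Z: "partition_fun m (\<lambda>_ _. 1) (transfer ?w) =
        (\<Prod>v\<in>level m. c v) * partition_fun m (\<lambda>_ _. 1) ?w" .
    have "(\<Prod>v\<in>level m. transfer ?w v (\<xi> v)) = (\<Prod>v\<in>level m. c v * ?w v (\<xi> v))"
      using level_subset_ball[of m]
      by (intro prod.cong refl c configs_spin[OF \<xi>]) auto
    then have P: "(\<Prod>v\<in>level m. transfer ?w v (\<xi> v)) =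
        (\<Prod>v\<in>level m. c v) * (\<Prod>v\<in>level m. ?w v (\<xi> v))"
      by (simp add: prod.distrib)
    have "(\<Prod>v\<in>level m. c v) > 0" using c(1) by (simp add: prod_pos)
    then show "(\<Sum>\<omega>\<in>configs (level n).
        field_dist J \<beta> h n (merge (tree_ball (n - 1)) (level n) (\<xi>, \<omega>))) = field_dist J \<beta> h (n - 1) \<xi>"
      by (simp add: n field_dist_marginal[OF \<xi>] Z P field_dist_eq[of h m])
  qed
next
  let ?w = "\<lambda>v s. exp (h v s)"
  assume L: ?L
  show ?R
  proof
    fix v :: vertex
    define n where "n = length v"
    have v: "v \<in> level n" by (simp add: n_def level_eq)
    obtain \<xi> where \<xi>: "\<xi> \<in> configs (tree_ball n)" using configs_nonempty by blast
    define A where "A = partition_fun n (\<lambda>_ _. 1) (transfer ?w)"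
    define B where "B = partition_fun n (\<lambda>_ _. 1) ?w"
    \<comment> \<open>The factors \<open>R\<close> and \<open>Q\<close> of the other vertices stay fixed while the spin at \<open>v\<close> varies.\<close>
    define R where "R = (\<Prod>x\<in>level n - {v}. transfer ?w x (\<xi> x))"
    define Q where "Q = (\<Prod>x\<in>level n - {v}. ?w x (\<xi> x))"
    have pos: "A > 0" "B > 0" "R > 0" "Q > 0"
      unfolding A_def B_def R_def Q_def
      by (auto intro!: partition_fun_pos prod_pos transfer_pos)
    have cancel: "b > 0 \<Longrightarrow> b * x / y = b * z / u \<Longrightarrow> x / y = z / u" for b x y z u :: real
      by (simp flip: times_divide_eq_right)
    show "proportional (spin_set v) (transfer ?w v) (?w v)"
    proof (rule proportionalI)
      show "(Q / B) * (A / R) > 0" using pos by simp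
      fix s assume s: "s \<in> spin_set v"
      let ?\<eta> = "\<xi>(v := s)"
      have off: "(\<Prod>x\<in>level n - {v}. F x (?\<eta> x)) = (\<Prod>x\<in>level n - {v}. F x (\<xi> x))"
        for F :: "vertex \<Rightarrow> real \<Rightarrow> real"
        by (rule prod.cong) auto
      have \<eta>: "?\<eta> \<in> configs (tree_ball n)"
        using \<xi> s v level_subset_ball[of n] by (auto simp: configs_def PiE_iff extensional_def)
      have "boltz n ?\<eta> * (\<Prod>x\<in>level n. transfer ?w x (?\<eta> x)) / A = boltz n ?\<eta> * (\<Prod>x\<in>level n. ?w x (?\<eta> x)) / B"
        using L[unfolded compatible_def, rule_format, of "Suc n" ?\<eta>] \<eta>
        by (simp add: field_dist_marginal field_dist_eq[of h n] A_def B_def)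
      then have "(\<Prod>x\<in>level n. transfer ?w x (?\<eta> x)) / A = (\<Prod>x\<in>level n. ?w x (?\<eta> x)) / B"
        by (rule cancel[OF boltz_pos])
      also have "(\<Prod>x\<in>level n. transfer ?w x (?\<eta> x)) = transfer ?w v s * R"
        by (simp only: R_def off[where F = "\<lambda>x t. transfer ?w x t"] prod.remove[OF finite_level v] fun_upd_same)
      also have "(\<Prod>x\<in>level n. ?w x (?\<eta> x)) = ?w v s * Q"
        by (simp only: Q_def off[where F = "\<lambda>x t. exp (h x t)"] prod.remove[OF finite_level v] fun_upd_same)
      finally show "transfer ?w v s = (Q / B) * (A / R) * ?w v s"
        using pos by (simp add: field_simps)
    qed
  qed
qed

lemma boundary_law_compatible_iff:
  assumes x: "x > 0" and w: "\<And>v. proportional (spin_set v) (w v) (boundary_law theta x v)"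
  shows "(\<forall>v. proportional (spin_set v) (transfer w v) (w v)) \<longleftrightarrow> f_map theta x = x"
proof -
  have T: "proportional (spin_set v) (transfer w v) (w v) \<longleftrightarrow>
      proportional (spin_set v) (transfer (boundary_law theta x) v) (boundary_law theta x v)" for v
  proof -
    have "proportional (spin_set v) (transfer w v) (transfer (boundary_law theta x) v)"
      by (rule transfer_proportional) (rule w)
    then show ?thesis
      using w[of v] proportional_trans proportional_sym by metis
  qed
  show ?thesis
    unfolding T
  proof
    assume fixed: "\<forall>v. proportional (spin_set v) (transfer (boundary_law theta x) v) (boundary_law theta x v)"
    have step: "proportional (spin_set []) (transfer (boundary_law theta x) [])
        (boundary_law theta (f_map theta x) [])"
      by (rule transfer_law_0[OF x]) simp
    have "proportional (spin_set []) (boundary_law theta (f_map theta x) []) (boundary_law theta x [])"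
      by (rule proportional_trans[OF proportional_sym[OF step] fixed[rule_format]])
    then obtain c where "\<And>s. s \<in> spin_set [] \<Longrightarrow>
        boundary_law theta (f_map theta x) [] s = c * boundary_law theta x [] s"
      by (rule proportionalE) blast
    from this[of "1/2"] this[of "-1/2"] have "(f_map theta x)^2 = x^2"
      by (simp add: spin_set_cases boundary_law_def)
    then show "f_map theta x = x"
      using x map_pos(6)[of theta x] by (simp add: power2_eq_iff_nonneg less_imp_le)
  next
    assume f: "f_map theta x = x"
    show "\<forall>v. proportional (spin_set v) (transfer (boundary_law theta x) v) (boundary_law theta x v)"
    proof
      fix v :: vertex
      have "length v mod 3 = 0 \<or> length v mod 3 = 1 \<or> length v mod 3 = 2" by linarith
      then show "proportional (spin_set v) (transfer (boundary_law theta x) v) (boundary_law theta x v)"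
        using transfer_law_0[OF x, of v] transfer_law_1[OF x, of v] transfer_law_2[OF x, of v] f by auto
    qed
  qed
qed

text \<open>Given the ratio \<open>X = x^2\<close> in class 0, compatibility forces the ratios in class 2, then those in class 1, and closes
up in class 0 with the condition that \<open>x\<close> is a fixed point.\<close>

lemma constant_ratios_compatible:
  assumes ratios: "constant_ratios h X Y Z T U N" and comp: "compatible J \<beta> h"
  obtains x where "x > 0" "f_map theta x = x"
    "\<And>v. proportional (spin_set v) (\<lambda>s. exp (h v s)) (boundary_law theta x v)"
proof -
  let ?w = "\<lambda>v s. exp (h v s)"
  have "exp (h [] (1/2) - h [] (-1/2)) = X"
    using ratios by (simp add: constant_ratios_def tree_class_eq)
  then have X: "X > 0"
    by (metis exp_gt_zero)
  define x where "x = sqrt X"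
  have x: "x > 0" "x^2 = X" using X by (auto simp: x_def)
  let ?l = "boundary_law theta x"
  have tr: "proportional (spin_set v) (?w v) (transfer ?w v)" for v
    using comp by (simp add: compatible_iff proportional_sym)
  have 0: "proportional (spin_set v) (?w v) (?l v)" if v: "length v mod 3 = 0" for v
  proof -
    have "exp (h v (1/2) - h v (-1/2)) = x^2"
      using ratios v x(2) by (simp add: constant_ratios_def tree_class_eq)
    then have "exp (h v (1/2)) = exp (h v (-1/2)) * x^2"
      by (rule exp_diff_eqD)
    then show ?thesis
      unfolding proportional_def using v
      by (intro exI[of _ "exp (h v (-1/2))"]) (simp add: spin_set_cases boundary_law_def)
  qed
  have 2: "proportional (spin_set v) (?w v) (?l v)" if v: "length v mod 3 = 2" for v
  proof -
    have "proportional (spin_set v) (transfer ?w v) (transfer ?l v)"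
      using v by (intro transfer_proportional 0) (simp add: mod_Suc)
    then show ?thesis
      by (rule proportional_trans[OF tr proportional_trans[OF _ transfer_law_2[OF x(1) v]]])
  qed
  have 1: "proportional (spin_set v) (?w v) (?l v)" if v: "length v mod 3 = 1" for v
  proof -
    have "proportional (spin_set v) (transfer ?w v) (transfer ?l v)"
      using v by (intro transfer_proportional 2) (simp add: mod_Suc)
    then show ?thesis
      by (rule proportional_trans[OF tr proportional_trans[OF _ transfer_law_1[OF x(1) v]]])
  qed
  have all: "proportional (spin_set v) (?w v) (?l v)" for v
  proof -
    have "length v mod 3 = 0 \<or> length v mod 3 = 1 \<or> length v mod 3 = 2" by linarith
    then show ?thesis using 0 1 2 by auto
  qed
  have "f_map theta x = x"
    using boundary_law_compatible_iff[OF x(1), of ?w] all comp by (simp add: compatible_iff)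
  then show ?thesis by (rule that[OF x(1) _ all])
qed


lemma partition_ratio_proportional:
  assumes "\<And>v. v \<in> level n \<Longrightarrow> proportional (spin_set v) (w v) (w' v)"
  shows "partition_fun n u w / partition_fun n (\<lambda>_ _. 1) w =
    partition_fun n u w' / partition_fun n (\<lambda>_ _. 1) w'"
proof -
  have "\<forall>v\<in>level n. \<exists>c>0. \<forall>s\<in>spin_set v. w v s = c * w' v s"
    using assms by (simp add: proportional_def)
  then obtain c where c: "\<And>v. v \<in> level n \<Longrightarrow> c v > 0"
      "\<And>v s. v \<in> level n \<Longrightarrow> s \<in> spin_set v \<Longrightarrow> w v s = c v * w' v s"
    by metis
  have "partition_fun n u w = partition_fun n u (\<lambda>v s. c v * w' v s)" for u
    by (rule partition_fun_cong) (auto simp: c)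
  then have Z: "partition_fun n u w = (\<Prod>v\<in>level n. c v) * partition_fun n u w'" for u
    by (simp only: partition_fun_scale)
  have "(\<Prod>v\<in>level n. c v) > 0" using c(1) by (simp add: prod_pos)
  then show ?thesis by (simp add: Z)
qed

text \<open>Levels on which the vertex weights are trivial can be summed out without changing these weights; only the boundary
message is transferred.\<close>

lemma partition_fun_peel_pow:
  assumes "\<And>v s. v \<notin> tree_ball n \<Longrightarrow> u v s = 1"
  shows "partition_fun (n + k) u w = partition_fun n u ((transfer ^^ k) w)"
proof (induction k arbitrary: w)
  case (Suc k)
  have "partition_fun (n + Suc k) u w = partition_fun (n + k) u (transfer (\<lambda>v t. u v t * w v t))"
    by (simp add: partition_fun_peel)
  also have "\<dots> = partition_fun (n + k) u (transfer w)"
  proof (rule partition_fun_cong)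
    fix v s assume "v \<in> level (n + k)"
    then have "u (b # v) t = 1" for b t
      by (intro assms) (simp add: level_eq tree_ball_eq)
    then show "transfer (\<lambda>v t. u v t * w v t) v s = transfer w v s"
      by (simp add: transfer_def)
  qed simp
  also have "\<dots> = partition_fun n u ((transfer ^^ k) (transfer w))"
    by (rule Suc.IH)
  finally show ?case by (simp add: funpow_swap1)
qed simp

end

section \<open>Measures on configurations\<close>

definition cylinder :: "nat \<Rightarrow> (vertex \<Rightarrow> real) \<Rightarrow> (vertex \<Rightarrow> real) set" where
  "cylinder n \<xi> = {\<omega> \<in> space config_space. \<forall>x\<in>tree_ball n. \<omega> x = \<xi> x}"

text \<open>Increasing local events of product form. They are closed under intersection and generate the
\<open>\<sigma>\<close>-algebra, so they determine measures, and they are the events that the likelihood-ratio comparison controls.\<close>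

definition up_event :: "vertex set \<Rightarrow> (vertex \<Rightarrow> real) \<Rightarrow> (vertex \<Rightarrow> real) set" where
  "up_event L a = {\<omega> \<in> space config_space. \<forall>v\<in>L. a v \<le> \<omega> v}"

definition up_weight :: "vertex set \<Rightarrow> (vertex \<Rightarrow> real) \<Rightarrow> vertex \<Rightarrow> real \<Rightarrow> real" where
  "up_weight L a v s = (if v \<in> L \<and> s < a v then 0 else 1)"

lemma config_spin: "\<omega> \<in> space config_space \<Longrightarrow> \<omega> v \<in> spin_set v"
  by (auto simp: space_config_space configs_def)

lemma config_spaceI: "(\<And>v. \<omega> v \<in> spin_set v) \<Longrightarrow> \<omega> \<in> space config_space"
  by (auto simp: space_config_space configs_def)

lemma measurable_spin: "(\<lambda>\<omega>. \<omega> v) \<in> measurable config_space (count_space (spin_set v))"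
  unfolding config_space_def by (rule measurable_component_singleton) simp

lemma borel_measurable_spin: "(\<lambda>\<omega>. \<omega> v) \<in> borel_measurable config_space"
  by (rule measurable_compose[OF measurable_spin]) simp

lemma sets_spin: "{\<omega> \<in> space config_space. P (\<omega> v)} \<in> sets config_space"
proof -
  have "{\<omega> \<in> space config_space. P (\<omega> v)} = (\<lambda>\<omega>. \<omega> v) -` {t \<in> spin_set v. P t} \<inter> space config_space"
    by (auto simp: config_spin)
  also have "\<dots> \<in> sets config_space"
    by (rule measurable_sets[OF measurable_spin]) auto
  finally show ?thesis .
qed

lemma sets_cylinder: "cylinder n \<xi> \<in> sets config_space"
  unfolding cylinder_def by (intro sets.sets_Collect_finite_All' sets.sets_Collect_finite_All finite_tree_ball sets_spin)

lemma sets_up_event: "finite L \<Longrightarrow> up_event L a \<in> sets config_space"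
  unfolding up_event_def by (intro sets.sets_Collect_finite_All sets_spin)

lemma up_event_Int:
  "up_event L a \<inter> up_event K b =
    up_event (L \<union> K) (\<lambda>v. if v \<in> L \<and> v \<in> K then max (a v) (b v) else if v \<in> L then a v else b v)"
proof -
  have "(v \<in> L \<longrightarrow> a v \<le> \<omega> v) \<and> (v \<in> K \<longrightarrow> b v \<le> \<omega> v) \<longleftrightarrow> (v \<in> L \<union> K \<longrightarrow>
      (if v \<in> L \<and> v \<in> K then max (a v) (b v) else if v \<in> L then a v else b v) \<le> \<omega> v)" for v \<omega>
    by auto
  then show ?thesis
    unfolding up_event_def Ball_def by (auto simp only: all_conj_distrib[symmetric])
qed

lemma Int_stable_up_events: "Int_stable {up_event L a | L a. finite L}"
  by (rule Int_stableI) (use up_event_Int in \<open>blast intro: finite_UnI\<close>)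

text \<open>A single spin value is the difference of the events that the spin is at least this value and that it is at
least some larger one; spin sets are finite.\<close>

lemma config_space_generated:
  "sets config_space = sigma_sets (space config_space) {up_event L a | L a. finite L}"
proof -
  let ?\<Omega> = "space config_space" and ?G = "{up_event L a | L a. finite L}"
  interpret S: sigma_algebra ?\<Omega> "sigma_sets ?\<Omega> ?G"
    by (rule sigma_algebra_sigma_sets) (auto simp: up_event_def)
  have \<Omega>: "?\<Omega> = (\<Pi>\<^sub>E i\<in>UNIV. space (count_space (spin_set i)))"
    by (simp add: space_config_space configs_def)
  have up: "{\<omega> \<in> ?\<Omega>. t \<le> \<omega> v} \<in> sigma_sets ?\<Omega> ?G" for t v
  proof (rule sigma_sets.Basic)
    have "{\<omega> \<in> ?\<Omega>. t \<le> \<omega> v} = up_event {v} (\<lambda>_. t)"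
      by (simp add: up_event_def)
    then show "{\<omega> \<in> ?\<Omega>. t \<le> \<omega> v} \<in> ?G"
      by blast
  qed
  have single: "{\<omega> \<in> ?\<Omega>. \<omega> v \<in> A} \<in> sigma_sets ?\<Omega> ?G" if A: "A \<subseteq> spin_set v" for v A
  proof -
    have "{\<omega> \<in> ?\<Omega>. \<omega> v \<in> A} =
        (\<Union>t\<in>A. {\<omega> \<in> ?\<Omega>. t \<le> \<omega> v} - (\<Union>t'\<in>{t' \<in> spin_set v. t < t'}. {\<omega> \<in> ?\<Omega>. t' \<le> \<omega> v}))"
    proof (intro set_eqI iffI)
      fix \<omega> assume "\<omega> \<in> {\<omega> \<in> ?\<Omega>. \<omega> v \<in> A}"
      then show "\<omega> \<in> (\<Union>t\<in>A. {\<omega> \<in> ?\<Omega>. t \<le> \<omega> v} - (\<Union>t'\<in>{t' \<in> spin_set v. t < t'}. {\<omega> \<in> ?\<Omega>. t' \<le> \<omega> v}))"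
        by (intro UN_I[of "\<omega> v"]) auto
    next
      fix \<omega> assume "\<omega> \<in> (\<Union>t\<in>A. {\<omega> \<in> ?\<Omega>. t \<le> \<omega> v} - (\<Union>t'\<in>{t' \<in> spin_set v. t < t'}. {\<omega> \<in> ?\<Omega>. t' \<le> \<omega> v}))"
      then obtain t where t: "t \<in> A" "\<omega> \<in> ?\<Omega>" "t \<le> \<omega> v" "\<not> (\<exists>t'\<in>spin_set v. t < t' \<and> t' \<le> \<omega> v)"
        by auto
      have "\<not> t < \<omega> v" using t(4) config_spin[OF t(2), of v] by auto
      then have "\<omega> v = t" using t(3) by simp
      with t show "\<omega> \<in> {\<omega> \<in> ?\<Omega>. \<omega> v \<in> A}" by simp
    qed
    also have "\<dots> \<in> sigma_sets ?\<Omega> ?G"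
    proof (intro S.finite_UN S.Diff up)
      show "finite A" using A finite_spin_set finite_subset by blast
    qed (auto intro!: up)
    finally show ?thesis .
  qed
  let ?R = "{{f \<in> ?\<Omega>. f i \<in> B} | i B. i \<in> UNIV \<and> B \<in> sets (count_space (spin_set i))}"
  have gen: "sets config_space = sigma_sets ?\<Omega> ?R"
    unfolding \<Omega> by (subst config_space_def) (rule sets_PiM_single)
  have "sigma_sets ?\<Omega> ?R = sigma_sets ?\<Omega> ?G"
  proof (rule sigma_sets_eqI)
    fix A assume "A \<in> ?R"
    then show "A \<in> sigma_sets ?\<Omega> ?G"
      using single by auto
  next
    fix A assume "A \<in> ?G"
    then have "A \<in> sets config_space" by (auto simp: sets_up_event)
    then show "A \<in> sigma_sets ?\<Omega> ?R" by (simp only: gen)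
  qed
  with gen show ?thesis by simp
qed

lemma config_measure_eqI:
  assumes "prob_space \<mu>" "prob_space \<nu>"
    and sets: "sets \<mu> = sets config_space" "sets \<nu> = sets config_space"
    and eq: "\<And>L a. finite L \<Longrightarrow> measure \<mu> (up_event L a) = measure \<nu> (up_event L a)"
  shows "\<mu> = \<nu>"
proof -
  interpret \<mu>: prob_space \<mu> by fact
  interpret \<nu>: prob_space \<nu> by fact
  let ?G = "{up_event L a | L a. finite L}"
  show ?thesis
  proof (rule measure_eqI_generator_eq[OF Int_stable_up_events])
    show "?G \<subseteq> Pow (space config_space)" by (auto simp: up_event_def)
    show "emeasure \<mu> X = emeasure \<nu> X" if "X \<in> ?G" for X
      using that eq by (auto simp: \<mu>.emeasure_eq_measure \<nu>.emeasure_eq_measure)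
    show "sets \<mu> = sigma_sets (space config_space) ?G" "sets \<nu> = sigma_sets (space config_space) ?G"
      by (simp_all add: sets config_space_generated)
    show "range (\<lambda>_::nat. up_event {} undefined) \<subseteq> ?G" by blast
    show "(\<Union>i::nat. up_event {} undefined) = space config_space" by (simp add: up_event_def)
  qed simp
qed

lemma integral_ball_function:
  assumes "prob_space \<mu>" and sets: "sets \<mu> = sets config_space"
  shows "(\<integral>\<omega>. F (restrict \<omega> (tree_ball n)) \<partial>\<mu>) =
    (\<Sum>\<xi>\<in>configs (tree_ball n). measure \<mu> (cylinder n \<xi>) * (F \<xi> :: real))"
proof -
  interpret \<mu>: prob_space \<mu> by fact
  have space: "space \<mu> = space config_space" using sets by (rule sets_eq_imp_space_eq)
  have "(\<integral>\<omega>. F (restrict \<omega> (tree_ball n)) \<partial>\<mu>) =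
      (\<integral>\<omega>. (\<Sum>\<xi>\<in>configs (tree_ball n). indicator (cylinder n \<xi>) \<omega> * F \<xi>) \<partial>\<mu>)"
  proof (rule Bochner_Integration.integral_cong[OF refl])
    fix \<omega> assume \<omega>: "\<omega> \<in> space \<mu>"
    have r: "restrict \<omega> (tree_ball n) \<in> configs (tree_ball n)"
      using \<omega> by (auto simp: space space_config_space intro: restrict_configs)
    have "indicator (cylinder n \<xi>) \<omega> * F \<xi> = (if \<xi> = restrict \<omega> (tree_ball n) then F \<xi> else 0)"
      if \<xi>: "\<xi> \<in> configs (tree_ball n)" for \<xi>
    proof -
      have "\<omega> \<in> cylinder n \<xi> \<longleftrightarrow> \<xi> = restrict \<omega> (tree_ball n)"
      proof
        assume "\<omega> \<in> cylinder n \<xi>"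
        then have "restrict \<xi> (tree_ball n) = restrict \<omega> (tree_ball n)"
          by (auto simp: cylinder_def)
        moreover have "restrict \<xi> (tree_ball n) = \<xi>"
          using \<xi> by (auto simp: configs_def PiE_def intro: extensional_restrict)
        ultimately show "\<xi> = restrict \<omega> (tree_ball n)" by simp
      qed (use \<omega> in \<open>auto simp: cylinder_def space\<close>)
      then have "indicator (cylinder n \<xi>) \<omega> = (if \<xi> = restrict \<omega> (tree_ball n) then 1 else (0::real))"
        by (simp add: indicator_def)
      then show ?thesis by simp
    qed
    then show "F (restrict \<omega> (tree_ball n)) =
        (\<Sum>\<xi>\<in>configs (tree_ball n). indicator (cylinder n \<xi>) \<omega> * F \<xi>)"
      using r by (simp add: finite_configs finite_tree_ball)
  qed
  also have "\<dots> = (\<Sum>\<xi>\<in>configs (tree_ball n). \<integral>\<omega>. indicator (cylinder n \<xi>) \<omega> * F \<xi> \<partial>\<mu>)"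
    by (rule Bochner_Integration.integral_sum)
       (use sets_cylinder in \<open>auto simp: sets \<mu>.emeasure_eq_measure intro!: integrable_real_indicator\<close>)
  also have "\<dots> = (\<Sum>\<xi>\<in>configs (tree_ball n). measure \<mu> (cylinder n \<xi>) * F \<xi>)"
    using sets_cylinder sets.sets_into_space by (simp add: space sets Int_absorb2 cylinder_def)
  finally show ?thesis .
qed

lemma prod_up_weight:
  assumes "L \<subseteq> B" "finite B"
  shows "(\<Prod>v\<in>B. up_weight L a v (\<xi> v)) = (if \<forall>v\<in>L. a v \<le> \<xi> v then 1 else 0)"
proof (cases "\<forall>v\<in>L. a v \<le> \<xi> v")
  case True
  then have "up_weight L a v (\<xi> v) = 1" for v
    by (auto simp: up_weight_def dest!: bspec[of L _ v])
  with True show ?thesis by simp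
next
  case False
  then obtain v where "v \<in> L" "\<xi> v < a v" by auto
  then have "\<exists>v\<in>B. up_weight L a v (\<xi> v) = 0"
    using assms(1) by (auto simp: up_weight_def)
  then show ?thesis using False assms(2) by (simp add: prod_zero)
qed

lemma up_weight_props:
  "0 \<le> up_weight L a v s" "t \<le> s \<Longrightarrow> up_weight L a v t \<le> up_weight L a v s"
  "v \<notin> L \<Longrightarrow> up_weight L a v s = 1"
  by (auto simp: up_weight_def)

lemma measure_up_event_ball:
  assumes "prob_space \<mu>" and sets: "sets \<mu> = sets config_space"
    and L: "L \<subseteq> tree_ball n"
  shows "measure \<mu> (up_event L a) =
    (\<Sum>\<xi>\<in>configs (tree_ball n). measure \<mu> (cylinder n \<xi>) * (if \<forall>v\<in>L. a v \<le> \<xi> v then 1 else 0))"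
proof -
  interpret \<mu>: prob_space \<mu> by fact
  have space: "space \<mu> = space config_space" using sets by (rule sets_eq_imp_space_eq)
  have "finite L" using L finite_tree_ball by (rule finite_subset)
  then have E: "up_event L a \<in> sets \<mu>" by (simp add: sets sets_up_event)
  then have "measure \<mu> (up_event L a) = (\<integral>\<omega>. indicator (up_event L a) \<omega> \<partial>\<mu>)"
    using sets.sets_into_space[OF E] by (simp add: Int_absorb2)
  also have "\<dots> = (\<integral>\<omega>. (\<lambda>\<xi>. if \<forall>v\<in>L. a v \<le> \<xi> v then 1 else 0) (restrict \<omega> (tree_ball n)) \<partial>\<mu>)"
  proof (rule Bochner_Integration.integral_cong[OF refl])
    fix \<omega> assume "\<omega> \<in> space \<mu>"
    moreover have "(\<forall>v\<in>L. a v \<le> restrict \<omega> (tree_ball n) v) \<longleftrightarrow> (\<forall>v\<in>L. a v \<le> \<omega> v)"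
      using L by auto
    ultimately show "indicator (up_event L a) \<omega> =
        (if \<forall>v\<in>L. a v \<le> restrict \<omega> (tree_ball n) v then 1 else (0::real))"
      by (simp add: up_event_def space indicator_def)
  qed
  also have "\<dots> = (\<Sum>\<xi>\<in>configs (tree_ball n). measure \<mu> (cylinder n \<xi>) * (if \<forall>v\<in>L. a v \<le> \<xi> v then 1 else 0))"
    by (rule integral_ball_function[OF assms(1,2)])
  finally show ?thesis .
qed

lemma splitting_cylinder:
  "splitting_gibbs_measure J \<beta> h \<mu> \<Longrightarrow> \<xi> \<in> configs (tree_ball n) \<Longrightarrow>
    measure \<mu> (cylinder n \<xi>) = field_dist J \<beta> h n \<xi>"
  by (simp add: splitting_gibbs_measure_def cylinder_def)

context ferromagnet
begin

lemma splitting_up_event: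
  assumes \<mu>: "splitting_gibbs_measure J \<beta> h \<mu>" and L: "L \<subseteq> tree_ball n"
  shows "measure \<mu> (up_event L a) =
    partition_fun n (up_weight L a) (\<lambda>v s. exp (h v s)) / partition_fun n (\<lambda>_ _. 1) (\<lambda>v s. exp (h v s))"
proof -
  have "measure \<mu> (up_event L a) =
      (\<Sum>\<xi>\<in>configs (tree_ball n). measure \<mu> (cylinder n \<xi>) * (if \<forall>v\<in>L. a v \<le> \<xi> v then 1 else 0))"
    using \<mu> by (intro measure_up_event_ball L) (auto simp: splitting_gibbs_measure_def)
  also have "\<dots> = (\<Sum>\<xi>\<in>configs (tree_ball n). field_dist J \<beta> h n \<xi> * (\<Prod>v\<in>tree_ball n. up_weight L a v (\<xi> v)))"
    by (intro sum.cong refl) (simp add: splitting_cylinder[OF \<mu>] prod_up_weight[OF L finite_tree_ball])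
  also have "\<dots> = partition_fun n (up_weight L a) (\<lambda>v s. exp (h v s)) / partition_fun n (\<lambda>_ _. 1) (\<lambda>v s. exp (h v s))"
    unfolding field_dist_eq partition_fun_def[of n "up_weight L a"] sum_divide_distrib
    by (intro sum.cong refl) (simp add: mult_ac)
  finally show ?thesis .
qed

lemma splitting_unique:
  assumes "splitting_gibbs_measure J \<beta> h \<mu>" "splitting_gibbs_measure J \<beta> h' \<nu>"
    and "\<And>v. proportional (spin_set v) (\<lambda>s. exp (h v s)) (\<lambda>s. exp (h' v s))"
  shows "\<mu> = \<nu>"
proof (rule config_measure_eqI)
  fix L :: "vertex set" and a assume "finite L"
  then obtain n where "L \<subseteq> tree_ball n" by (rule finite_subset_tree_ball)
  then show "measure \<mu> (up_event L a) = measure \<nu> (up_event L a)"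
    using assms by (simp add: splitting_up_event partition_ratio_proportional[of n "\<lambda>v s. exp (h v s)" "\<lambda>v s. exp (h' v s)"])
qed (use assms in \<open>auto simp: splitting_gibbs_measure_def\<close>)

end

section \<open>Existence: sampling along the tree\<close>

text \<open>The root has no parent; the value \<open>0\<close> makes the edge weight there equal to \<open>1\<close>, so that the root needs no separate
treatment.\<close>

definition parent_spin :: "(vertex \<Rightarrow> real) \<Rightarrow> vertex \<Rightarrow> real" where
  "parent_spin \<xi> v = (case v of [] \<Rightarrow> 0 | b # x \<Rightarrow> \<xi> x)"

text \<open>A Markov chain on the tree driven by independent choices: \<open>U (v, s)\<close> is the spin to be put at \<open>v\<close> if the
parent has spin \<open>s\<close>. Indexing the choices by the parent spin makes them independent, and the law of the chain
is then an image of an infinite product measure.\<close>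

primrec sample :: "(vertex \<times> real \<Rightarrow> real) \<Rightarrow> vertex \<Rightarrow> real" where
  "sample U [] = U ([], 0)"
| "sample U (b # x) = U (b # x, sample U x)"

text \<open>A cylinder event for the chain constrains one choice per vertex, namely the one belonging to the prescribed
spin of the parent; hence its probability is a product.\<close>

lemma sample_eq_iff:
  "(\<forall>v\<in>tree_ball n. sample U v = \<xi> v) \<longleftrightarrow> (\<forall>v\<in>tree_ball n. U (v, parent_spin \<xi> v) = \<xi> v)"
proof (intro iffI ballI)
  fix v assume *: "\<forall>v\<in>tree_ball n. sample U v = \<xi> v" and v: "v \<in> tree_ball n"
  show "U (v, parent_spin \<xi> v) = \<xi> v"
  proof (cases v)
    case (Cons b x)
    then have "x \<in> tree_ball n" using v by (simp add: tree_ball_eq)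
    then have "sample U x = \<xi> x" using * by blast
    moreover have "sample U v = \<xi> v" using * v by blast
    ultimately show ?thesis using Cons by (simp add: parent_spin_def)
  qed (use * v in \<open>auto simp: parent_spin_def\<close>)
next
  fix v assume *: "\<forall>v\<in>tree_ball n. U (v, parent_spin \<xi> v) = \<xi> v" and v: "v \<in> tree_ball n"
  from v show "sample U v = \<xi> v"
  proof (induction v)
    case (Cons b x)
    then have "sample U x = \<xi> x" by (simp add: tree_ball_eq)
    then show ?case using bspec[OF * Cons.prems] by (simp add: parent_spin_def)
  qed (use * in \<open>auto simp: parent_spin_def\<close>)
qed

context ferromagnet
begin

definition step_prob :: "(vertex \<Rightarrow> real \<Rightarrow> real) \<Rightarrow> vertex \<Rightarrow> real \<Rightarrow> real \<Rightarrow> real" where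
  "step_prob w v s t = exp (\<beta> * J * s * t) * w v t / (\<Sum>t'\<in>spin_set v. exp (\<beta> * J * s * t') * w v t')"

text \<open>The normalising constants of the transition probabilities out of level \<open>n\<close> multiply to the transferred message, which by the
fixed-point property cancels against the message on level \<open>n\<close>; only the message on the last level remains.\<close>

lemma prod_step_prob:
  assumes w: "\<And>v s. w v s > 0"
    and fixed: "\<And>v. proportional (spin_set v) (transfer w v) (w v)"
    and \<xi>: "\<And>v. v \<in> tree_ball n \<Longrightarrow> \<xi> v \<in> spin_set v"
  shows "(\<Prod>v\<in>tree_ball n. step_prob w v (parent_spin \<xi> v) (\<xi> v)) =
    boltz n \<xi> * (\<Prod>v\<in>level n. w v (\<xi> v)) / partition_fun n (\<lambda>_ _. 1) w"
  using \<xi>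
proof (induction n)
  case 0
  have "tree_ball 0 = {[]}" "level 0 = {[]}" by (auto simp: tree_ball_eq level_eq)
  then show ?case by (simp add: step_prob_def parent_spin_def boltz_0 partition_fun_0)
next
  case (Suc n)
  have "\<forall>v. \<exists>c>0. \<forall>s\<in>spin_set v. transfer w v s = c * w v s"
    using fixed by (simp add: proportional_def)
  then obtain c where c: "\<And>v. c v > 0" "\<And>v s. s \<in> spin_set v \<Longrightarrow> transfer w v s = c v * w v s"
    by metis
  let ?e = "\<lambda>v b. exp (\<beta> * J * \<xi> v * \<xi> (b # v))"
  have in_ball: "v \<in> tree_ball n \<Longrightarrow> v \<in> tree_ball (Suc n)" for v
    by (simp add: tree_ball_eq)
  have "(\<Prod>v\<in>level (Suc n). step_prob w v (parent_spin \<xi> v) (\<xi> v)) =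
      (\<Prod>v\<in>level n. (\<Prod>b\<in>UNIV. ?e v b * w (b # v) (\<xi> (b # v))) / transfer w v (\<xi> v))"
    unfolding prod_level_Suc transfer_def prod_dividef[symmetric]
    by (simp add: step_prob_def parent_spin_def)
  also have "\<dots> = (\<Prod>v\<in>level n. (\<Prod>b\<in>UNIV. ?e v b * w (b # v) (\<xi> (b # v))) / (c v * w v (\<xi> v)))"
    using level_subset_ball[of n]
    by (intro prod.cong refl arg_cong2[where f = "(/)"] c Suc.prems in_ball) auto
  also have "\<dots> = (\<Prod>v\<in>level n. \<Prod>b\<in>UNIV. ?e v b) * (\<Prod>v\<in>level (Suc n). w v (\<xi> v)) /
      ((\<Prod>v\<in>level n. c v) * (\<Prod>v\<in>level n. w v (\<xi> v)))"
    by (simp only: prod_dividef prod.distrib prod_level_Suc)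
  finally have outer: "(\<Prod>v\<in>level (Suc n). step_prob w v (parent_spin \<xi> v) (\<xi> v)) =
      (\<Prod>v\<in>level n. \<Prod>b\<in>UNIV. ?e v b) * (\<Prod>v\<in>level (Suc n). w v (\<xi> v)) /
      ((\<Prod>v\<in>level n. c v) * (\<Prod>v\<in>level n. w v (\<xi> v)))" .
  have "partition_fun (Suc n) (\<lambda>_ _. 1) w = partition_fun n (\<lambda>_ _. 1) (transfer w)"
    by (simp add: partition_fun_peel)
  also have "\<dots> = partition_fun n (\<lambda>_ _. 1) (\<lambda>v s. c v * w v s)"
    by (rule partition_fun_cong) (auto simp: c)
  finally have Z: "partition_fun (Suc n) (\<lambda>_ _. 1) w = (\<Prod>v\<in>level n. c v) * partition_fun n (\<lambda>_ _. 1) w"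
    by (simp only: partition_fun_scale)
  have pos: "(\<Prod>v\<in>level n. c v) > 0" "(\<Prod>v\<in>level n. w v (\<xi> v)) > 0"
    using c(1) w by (auto intro!: prod_pos)
  have "(\<Prod>v\<in>tree_ball (Suc n). step_prob w v (parent_spin \<xi> v) (\<xi> v)) =
      (\<Prod>v\<in>tree_ball n. step_prob w v (parent_spin \<xi> v) (\<xi> v)) *
      (\<Prod>v\<in>level (Suc n). step_prob w v (parent_spin \<xi> v) (\<xi> v))"
    unfolding tree_ball_Suc
    by (rule prod.union_disjoint[OF finite_tree_ball finite_level tree_ball_level_disjoint])
  also have "\<dots> = boltz (Suc n) \<xi> * (\<Prod>v\<in>level (Suc n). w v (\<xi> v)) / partition_fun (Suc n) (\<lambda>_ _. 1) w"
    unfolding outer Z boltz_Suc using Suc.IH[OF Suc.prems[OF in_ball]] pos by (simp add: mult_ac)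
  finally show ?case .
qed

lemma splitting_exists:
  assumes comp: "compatible J \<beta> h"
  shows "\<exists>\<mu>. splitting_gibbs_measure J \<beta> h \<mu>"
proof -
  let ?w = "\<lambda>v s. exp (h v s)"
  define M where "M i = point_measure (spin_set (fst i)) (\<lambda>t. ennreal (step_prob ?w (fst i) (snd i) t))"
    for i :: "vertex \<times> real"
  have D: "(\<Sum>t'\<in>spin_set v. exp (\<beta> * J * s * t') * ?w v t') > 0" for v s
    by (intro sum_pos) auto
  have step_nonneg: "step_prob ?w v s t \<ge> 0" for v s t
    unfolding step_prob_def using D[of s v] by (intro divide_nonneg_nonneg) auto
  have step_sum: "(\<Sum>t\<in>spin_set v. step_prob ?w v s t) = 1" for v s
    unfolding step_prob_def sum_divide_distrib[symmetric] using D[of s v] by simp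
  have M_prob: "prob_space (M i)" for i
    unfolding M_def
    by (rule prob_space_point_measure) (auto simp: sum_ennreal step_nonneg step_sum)
  interpret Mi: prob_space "M i" for i by (rule M_prob)
  interpret product_prob_space M UNIV by unfold_locales
  let ?Q = "PiM UNIV M"
  have space_M: "space (M i) = spin_set (fst i)" for i
    by (simp add: M_def space_point_measure)
  have sets_M: "sets (M i) = sets (count_space (spin_set (fst i)))" for i
    by (simp add: M_def sets_point_measure)
  have comp_M: "(\<lambda>U. U (v, s)) \<in> measurable ?Q (count_space (spin_set v))" for v s
  proof -
    have "(\<lambda>U. U (v, s)) \<in> measurable ?Q (M (v, s))"
      by (rule measurable_component_singleton) simp
    also have "measurable ?Q (M (v, s)) = measurable ?Q (count_space (spin_set v))"
      by (rule measurable_cong_sets) (simp_all add: sets_M)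
    finally show ?thesis .
  qed
  have sample_meas: "(\<lambda>U. sample U v) \<in> measurable ?Q (count_space (spin_set v))" for v
  proof (induction v)
    case (Cons b x)
    show ?case
      unfolding sample.simps
      by (rule measurable_compose_countable'[OF comp_M Cons]) (simp add: countable_finite)
  qed (simp add: comp_M)
  have meas: "sample \<in> measurable ?Q config_space"
    unfolding config_space_def
  proof (rule measurable_PiM_single'[where f = "\<lambda>v U. sample U v", simplified eta_contract_eq])
    show "sample \<in> space ?Q \<rightarrow> (\<Pi>\<^sub>E i\<in>UNIV. space (count_space (spin_set i)))"
      using measurable_space[OF sample_meas] by auto
  qed (rule sample_meas)
  define \<mu> where "\<mu> = distr ?Q config_space sample"
  have "measure \<mu> (cylinder n \<xi>) = field_dist J \<beta> h n \<xi>" if \<xi>: "\<xi> \<in> configs (tree_ball n)" for n \<xi>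
  proof -
    let ?I = "(\<lambda>v. (v, parent_spin \<xi> v)) ` tree_ball n"
    have inj: "inj_on (\<lambda>v. (v, parent_spin \<xi> v)) (tree_ball n)" by (auto simp: inj_on_def)
    have "sample -` cylinder n \<xi> \<inter> space ?Q = {U \<in> space ?Q. \<forall>i\<in>?I. U i \<in> {\<xi> (fst i)}}"
      using measurable_space[OF meas] by (auto simp: cylinder_def sample_eq_iff)
    then have "emeasure \<mu> (cylinder n \<xi>) = emeasure ?Q {U \<in> space ?Q. \<forall>i\<in>?I. U i \<in> {\<xi> (fst i)}}"
      by (simp add: \<mu>_def emeasure_distr[OF meas sets_cylinder])
    also have "\<dots> = (\<Prod>i\<in>?I. emeasure (M i) {\<xi> (fst i)})"
      by (rule emeasure_PiM_Collect) (auto simp: finite_tree_ball sets_M configs_spin[OF \<xi>])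
    also have "\<dots> = (\<Prod>v\<in>tree_ball n. emeasure (M (v, parent_spin \<xi> v)) {\<xi> v})"
      by (simp add: prod.reindex[OF inj])
    also have "\<dots> = (\<Prod>v\<in>tree_ball n. ennreal (step_prob ?w v (parent_spin \<xi> v) (\<xi> v)))"
      by (intro prod.cong refl) (simp add: M_def emeasure_point_measure_finite configs_spin[OF \<xi>])
    also have "\<dots> = ennreal (\<Prod>v\<in>tree_ball n. step_prob ?w v (parent_spin \<xi> v) (\<xi> v))"
      by (simp add: prod_ennreal step_nonneg)
    also have "(\<Prod>v\<in>tree_ball n. step_prob ?w v (parent_spin \<xi> v) (\<xi> v)) = field_dist J \<beta> h n \<xi>"
      unfolding field_dist_eq using comp
      by (intro prod_step_prob) (auto simp: compatible_iff configs_spin[OF \<xi>])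
    moreover have "field_dist J \<beta> h n \<xi> \<ge> 0"
      unfolding field_dist_eq
      by (intro divide_nonneg_pos field_normalisation_pos mult_nonneg_nonneg prod_nonneg) (auto simp: boltz_pos less_imp_le)
    ultimately show ?thesis by (simp add: measure_def)
  qed
  then have "splitting_gibbs_measure J \<beta> h \<mu>"
    unfolding splitting_gibbs_measure_def
    using comp P.prob_space_distr[OF meas] by (simp add: \<mu>_def cylinder_def)
  then show ?thesis ..
qed

end

section \<open>The Gibbs specification\<close>

lemma glue_apply: "glue \<Lambda> \<sigma> \<omega> v = (if v \<in> \<Lambda> then \<sigma> v else \<omega> v)"
  by (simp add: glue_def merge_def)

lemma glue_space:
  "\<sigma> \<in> configs \<Lambda> \<Longrightarrow> \<omega> \<in> space config_space \<Longrightarrow> glue \<Lambda> \<sigma> \<omega> \<in> space config_space"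
  by (rule config_spaceI) (auto simp: glue_apply configs_spin config_spin)

lemma measurable_glue:
  assumes "\<sigma> \<in> configs \<Lambda>"
  shows "glue \<Lambda> \<sigma> \<in> measurable config_space config_space"
proof -
  have "(\<lambda>\<omega> v. glue \<Lambda> \<sigma> \<omega> v) \<in> measurable config_space (\<Pi>\<^sub>M x\<in>UNIV. count_space (spin_set x))"
  proof (rule measurable_PiM_single')
    fix v
    show "(\<lambda>\<omega>. glue \<Lambda> \<sigma> \<omega> v) \<in> measurable config_space (count_space (spin_set v))"
      using assms by (cases "v \<in> \<Lambda>") (auto simp: glue_apply measurable_spin configs_spin)
  qed (use glue_space[OF assms] in \<open>auto simp: space_config_space configs_def\<close>)
  then show ?thesis by (simp add: config_space_def[symmetric])
qed

lemma borel_measurable_local_energy: "local_energy J \<Lambda> \<in> borel_measurable config_space"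
  unfolding local_energy_def[abs_def]
  by (intro borel_measurable_times borel_measurable_sum borel_measurable_prod borel_measurable_spin
      borel_measurable_const)

lemma borel_measurable_gibbs_kernel:
  assumes "A \<in> sets config_space"
  shows "(\<lambda>\<omega>. gibbs_kernel J \<beta> \<Lambda> \<omega> A) \<in> borel_measurable config_space"
proof -
  have e: "(\<lambda>\<omega>. exp (- \<beta> * local_energy J \<Lambda> (glue \<Lambda> \<sigma> \<omega>))) \<in> borel_measurable config_space"
    if "\<sigma> \<in> configs \<Lambda>" for \<sigma>
    by (intro borel_measurable_exp[THEN measurable_compose[rotated]] borel_measurable_times
        borel_measurable_const measurable_compose[OF measurable_glue[OF that] borel_measurable_local_energy])
  have i: "(\<lambda>\<omega>. indicator A (glue \<Lambda> \<sigma> \<omega>) :: real) \<in> borel_measurable config_space"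
    if "\<sigma> \<in> configs \<Lambda>" for \<sigma>
    by (rule measurable_compose[OF measurable_glue[OF that]]) (rule borel_measurable_indicator[OF assms])
  show ?thesis
    unfolding gibbs_kernel_def
    by (intro borel_measurable_divide borel_measurable_sum borel_measurable_times; erule e i)
qed

lemma gibbs_kernel_denominator_pos:
  assumes "finite \<Lambda>"
  shows "(\<Sum>\<sigma>\<in>configs \<Lambda>. exp (- \<beta> * local_energy J \<Lambda> (glue \<Lambda> \<sigma> \<omega>))) > 0"
  by (rule sum_pos) (auto simp: finite_configs assms configs_nonempty)

lemma gibbs_kernel_bounds:
  assumes "finite \<Lambda>"
  shows "0 \<le> gibbs_kernel J \<beta> \<Lambda> \<omega> A" "gibbs_kernel J \<beta> \<Lambda> \<omega> A \<le> 1"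
proof -
  note D = gibbs_kernel_denominator_pos[OF assms, of \<beta> J \<omega>]
  show "0 \<le> gibbs_kernel J \<beta> \<Lambda> \<omega> A"
    unfolding gibbs_kernel_def using D by (intro divide_nonneg_pos sum_nonneg) auto
  have "(\<Sum>\<sigma>\<in>configs \<Lambda>. exp (- \<beta> * local_energy J \<Lambda> (glue \<Lambda> \<sigma> \<omega>)) * indicator A (glue \<Lambda> \<sigma> \<omega>)) \<le>
      (\<Sum>\<sigma>\<in>configs \<Lambda>. exp (- \<beta> * local_energy J \<Lambda> (glue \<Lambda> \<sigma> \<omega>)))"
    by (rule sum_mono) (simp add: indicator_def)
  then show "gibbs_kernel J \<beta> \<Lambda> \<omega> A \<le> 1"
    unfolding gibbs_kernel_def using D by (simp add: pos_divide_le_eq)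
qed

lemma integrable_gibbs_kernel:
  assumes "prob_space \<mu>" "sets \<mu> = sets config_space" "finite \<Lambda>" "A \<in> sets config_space"
  shows "integrable \<mu> (\<lambda>\<omega>. gibbs_kernel J \<beta> \<Lambda> \<omega> A)"
proof -
  interpret \<mu>: prob_space \<mu> by fact
  have "(\<lambda>\<omega>. gibbs_kernel J \<beta> \<Lambda> \<omega> A) \<in> borel_measurable \<mu>"
    by (subst measurable_cong_sets[OF assms(2) refl]) (rule borel_measurable_gibbs_kernel[OF assms(4)])
  then show ?thesis
    using gibbs_kernel_bounds[OF assms(3)]
    by (intro \<mu>.integrable_const_bound[where B = 1]) simp_all
qed

lemma gibbs_kernel_compl:
  assumes "finite \<Lambda>" "\<omega> \<in> space config_space"
  shows "gibbs_kernel J \<beta> \<Lambda> \<omega> (space config_space - A) = 1 - gibbs_kernel J \<beta> \<Lambda> \<omega> A"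
proof -
  let ?e = "\<lambda>\<sigma>. exp (- \<beta> * local_energy J \<Lambda> (glue \<Lambda> \<sigma> \<omega>))"
  have "(\<Sum>\<sigma>\<in>configs \<Lambda>. ?e \<sigma> * indicator (space config_space - A) (glue \<Lambda> \<sigma> \<omega>)) =
      (\<Sum>\<sigma>\<in>configs \<Lambda>. ?e \<sigma> - ?e \<sigma> * indicator A (glue \<Lambda> \<sigma> \<omega>))"
    by (intro sum.cong refl) (simp add: indicator_def glue_space assms(2))
  then show ?thesis
    unfolding gibbs_kernel_def
    using gibbs_kernel_denominator_pos[OF assms(1), of \<beta> J \<omega>]
    by (simp add: sum_subtractf diff_divide_distrib)
qed

lemma gibbs_kernel_sums:
  assumes "disjoint_family A"
  shows "(\<lambda>i. gibbs_kernel J \<beta> \<Lambda> \<omega> (A i)) sums gibbs_kernel J \<beta> \<Lambda> \<omega> (\<Union>i. A i)"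
  unfolding gibbs_kernel_def
  by (intro sums_divide sums_sum sums_mult indicator_sums) (use assms in \<open>auto simp: disjoint_family_on_def\<close>)

text \<open>Both sides are countably additive in the event, so the DLR equation has to be checked on increasing local events
only.\<close>

lemma gibbs_kernel_invariant_extend:
  assumes "prob_space \<mu>" and sets: "sets \<mu> = sets config_space" and \<Lambda>: "finite \<Lambda>"
    and up: "\<And>L a. finite L \<Longrightarrow>
      measure \<mu> (up_event L a) = (\<integral>\<omega>. gibbs_kernel J \<beta> \<Lambda> \<omega> (up_event L a) \<partial>\<mu>)"
    and A: "A \<in> sets config_space"
  shows "measure \<mu> A = (\<integral>\<omega>. gibbs_kernel J \<beta> \<Lambda> \<omega> A \<partial>\<mu>)"
proof -
  interpret \<mu>: prob_space \<mu> by fact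
  have space: "space \<mu> = space config_space" using sets by (rule sets_eq_imp_space_eq)
  let ?G = "{up_event L a | L a. finite L}"
  note int = integrable_gibbs_kernel[OF \<mu>.prob_space_axioms sets \<Lambda>]
  have sub: "?G \<subseteq> Pow (space config_space)" by (auto simp: up_event_def)
  have "A \<in> sigma_sets (space config_space) ?G"
    using A by (simp add: config_space_generated)
  with Int_stable_up_events sub show ?thesis
  proof (induction rule: sigma_sets_induct_disjoint)
    case (basic A)
    then show ?case using up by auto
  next
    case empty
    show ?case by (simp add: gibbs_kernel_def)
  next
    case (compl A)
    then have A: "A \<in> sets config_space" by (simp add: config_space_generated)
    have "(\<integral>\<omega>. gibbs_kernel J \<beta> \<Lambda> \<omega> (space config_space - A) \<partial>\<mu>) =
        (\<integral>\<omega>. 1 - gibbs_kernel J \<beta> \<Lambda> \<omega> A \<partial>\<mu>)"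
      by (rule Bochner_Integration.integral_cong[OF refl]) (simp add: gibbs_kernel_compl \<Lambda> space)
    also have "\<dots> = 1 - measure \<mu> A"
      using compl int[OF A] by (simp add: \<mu>.prob_space)
    also have "\<dots> = measure \<mu> (space config_space - A)"
      using \<mu>.prob_compl[of A] A by (simp add: sets space)
    finally show ?case by simp
  next
    case (union A)
    then have A: "range A \<subseteq> sets config_space" by (simp add: config_space_generated)
    then have Ai: "A i \<in> sets config_space" for i by auto
    have ms: "(\<lambda>i. measure \<mu> (A i)) sums measure \<mu> (\<Union>i. A i)"
      using A union by (intro \<mu>.finite_measure_UNION) (auto simp: sets)
    note k = gibbs_kernel_sums[OF union(1), of J \<beta> \<Lambda>]
    have n: "norm (gibbs_kernel J \<beta> \<Lambda> \<omega> B) = gibbs_kernel J \<beta> \<Lambda> \<omega> B" for \<omega> B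
      using gibbs_kernel_bounds(1)[OF \<Lambda>] by simp
    have "(\<lambda>i. \<integral>\<omega>. gibbs_kernel J \<beta> \<Lambda> \<omega> (A i) \<partial>\<mu>) sums
        (\<integral>\<omega>. (\<Sum>i. gibbs_kernel J \<beta> \<Lambda> \<omega> (A i)) \<partial>\<mu>)"
    proof (rule sums_integral)
      show "summable (\<lambda>i. \<integral>\<omega>. norm (gibbs_kernel J \<beta> \<Lambda> \<omega> (A i)) \<partial>\<mu>)"
        unfolding n using ms union(3) by (simp add: sums_iff)
      show "AE \<omega> in \<mu>. summable (\<lambda>i. norm (gibbs_kernel J \<beta> \<Lambda> \<omega> (A i)))"
        unfolding n using k by (simp add: sums_iff)
    qed (rule int[OF Ai])
    also have "(\<integral>\<omega>. (\<Sum>i. gibbs_kernel J \<beta> \<Lambda> \<omega> (A i)) \<partial>\<mu>) =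
        (\<integral>\<omega>. gibbs_kernel J \<beta> \<Lambda> \<omega> (\<Union>i. A i) \<partial>\<mu>)"
      using k by (simp add: sums_iff)
    finally show ?case
      using ms union(3) by (simp add: sums_unique2)
  qed
qed

lemma local_energy_cong:
  assumes "touching_edges \<Lambda> \<subseteq> ball_edges n" "\<And>v. v \<in> tree_ball n \<Longrightarrow> \<xi> v = \<eta> v"
  shows "local_energy J \<Lambda> \<xi> = local_energy J \<Lambda> \<eta>"
proof -
  have "(\<Prod>x\<in>e. \<xi> x) = (\<Prod>x\<in>e. \<eta> x)" if "e \<in> touching_edges \<Lambda>" for e
    using that assms by (intro prod.cong) (auto simp: ball_edges_def)
  then show ?thesis by (simp add: local_energy_def)
qed

context ferromagnet
begin

text \<open>Two configurations that differ only inside \<open>\<Lambda>\<close> have field weights in the ratio of their local Boltzmann factors: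
the edges that do not touch \<open>\<Lambda>\<close> and the field on the outermost level contribute equally.\<close>

lemma field_dist_local_exchange:
  assumes \<Lambda>: "\<Lambda> \<subseteq> tree_ball m" and eq: "\<And>v. v \<in> tree_ball (Suc m) - \<Lambda> \<Longrightarrow> \<xi> v = \<eta> v"
  shows "field_dist J \<beta> h (Suc m) \<xi> * exp (- \<beta> * local_energy J \<Lambda> \<eta>) =
    field_dist J \<beta> h (Suc m) \<eta> * exp (- \<beta> * local_energy J \<Lambda> \<xi>)"
proof -
  let ?T = "touching_edges \<Lambda>" and ?O = "ball_edges (Suc m) - touching_edges \<Lambda>"
  have split: "ball_energy J (Suc m) \<zeta> = local_energy J \<Lambda> \<zeta> + (- J * (\<Sum>e\<in>?O. \<Prod>x\<in>e. \<zeta> x))" for \<zeta>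
    using sum.subset_diff[OF touching_edges_subset[OF \<Lambda>] finite_ball_edges, of "\<lambda>e. \<Prod>x\<in>e. \<zeta> x"]
    by (simp add: ball_energy_def local_energy_def algebra_simps)
  have "(\<Sum>e\<in>?O. \<Prod>x\<in>e. \<xi> x) = (\<Sum>e\<in>?O. \<Prod>x\<in>e. \<eta> x)"
    by (intro sum.cong prod.cong refl eq) (auto simp: touching_edges_def ball_edges_def)
  then have b: "boltz (Suc m) \<xi> * exp (- \<beta> * local_energy J \<Lambda> \<eta>) =
      boltz (Suc m) \<eta> * exp (- \<beta> * local_energy J \<Lambda> \<xi>)"
    unfolding boltz_def split exp_add[symmetric] by (simp add: algebra_simps)
  have "v \<in> tree_ball (Suc m) - \<Lambda>" if "v \<in> level (Suc m)" for v
    using that \<Lambda> by (auto simp: level_eq tree_ball_eq)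
  then have "(\<Prod>v\<in>level (Suc m). exp (h v (\<xi> v))) = (\<Prod>v\<in>level (Suc m). exp (h v (\<eta> v)))"
    by (intro prod.cong refl) (simp add: eq)
  with b show ?thesis by (simp add: field_dist_eq mult_ac)
qed

text \<open>The ball is chosen so large that \<open>\<Lambda>\<close> and its neighbours lie in it and the outermost level misses \<open>\<Lambda>\<close>. For fixed
spins \<open>\<zeta>\<close> outside \<open>\<Lambda>\<close>, resampling the spins inside according to the kernel is then reversible with respect to the
marginal of the measure.\<close>

lemma splitting_invariant_up_event:
  assumes \<mu>: "splitting_gibbs_measure J \<beta> h \<mu>" and \<Lambda>: "finite \<Lambda>" and L: "finite L"
  shows "measure \<mu> (up_event L a) = (\<integral>\<omega>. gibbs_kernel J \<beta> \<Lambda> \<omega> (up_event L a) \<partial>\<mu>)"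
proof -
  have prob: "prob_space \<mu>" and sets: "sets \<mu> = sets config_space"
    using \<mu> by (auto simp: splitting_gibbs_measure_def)
  have space: "space \<mu> = space config_space" using sets by (rule sets_eq_imp_space_eq)
  obtain m where m: "\<Lambda> \<union> L \<subseteq> tree_ball m"
    by (rule finite_subset_tree_ball[OF finite_UnI[OF \<Lambda> L]])
  define n where "n = Suc m"
  define B where "B = tree_ball n - \<Lambda>"
  have sub: "\<Lambda> \<subseteq> tree_ball n" "L \<subseteq> tree_ball n"
    using m tree_ball_mono[of m n] by (auto simp: n_def)
  have T: "touching_edges \<Lambda> \<subseteq> ball_edges n"
    using m unfolding n_def by (intro touching_edges_subset) auto
  have ball: "tree_ball n = \<Lambda> \<union> B" "\<Lambda> \<inter> B = {}" using sub by (auto simp: B_def)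
  let ?P = "\<lambda>\<xi>. if \<forall>v\<in>L. a v \<le> \<xi> v then 1 else (0::real)"
  let ?e = "\<lambda>\<xi>. exp (- \<beta> * local_energy J \<Lambda> \<xi>)"
  let ?W = "field_dist J \<beta> h n"
  let ?F = "\<lambda>\<xi>. (\<Sum>\<sigma>\<in>configs \<Lambda>. ?e (glue \<Lambda> \<sigma> \<xi>) * ?P (glue \<Lambda> \<sigma> \<xi>)) / (\<Sum>\<sigma>\<in>configs \<Lambda>. ?e (glue \<Lambda> \<sigma> \<xi>))"
  let ?m = "\<lambda>\<eta> \<zeta>. merge \<Lambda> B (\<eta>, \<zeta>)"
  have e_cong: "?e \<xi> = ?e \<xi>'" if "\<And>v. v \<in> tree_ball n \<Longrightarrow> \<xi> v = \<xi>' v" for \<xi> \<xi>'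
    using local_energy_cong[OF T that] by simp
  have P_cong: "?P \<xi> = ?P \<xi>'" if "\<And>v. v \<in> tree_ball n \<Longrightarrow> \<xi> v = \<xi>' v" for \<xi> \<xi>'
    using that sub(2) by (metis subsetD)
  have kernel: "gibbs_kernel J \<beta> \<Lambda> \<omega> (up_event L a) = ?F (restrict \<omega> (tree_ball n))"
    if \<omega>: "\<omega> \<in> space config_space" for \<omega>
  proof -
    have "?e (glue \<Lambda> \<sigma> \<omega>) = ?e (glue \<Lambda> \<sigma> (restrict \<omega> (tree_ball n)))" for \<sigma>
      by (rule e_cong) (simp add: glue_apply)
    moreover have "indicator (up_event L a) (glue \<Lambda> \<sigma> \<omega>) = ?P (glue \<Lambda> \<sigma> (restrict \<omega> (tree_ball n)))"
      if "\<sigma> \<in> configs \<Lambda>" for \<sigma>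
    proof -
      have "indicator (up_event L a) (glue \<Lambda> \<sigma> \<omega>) = ?P (glue \<Lambda> \<sigma> \<omega>)"
        using glue_space[OF that \<omega>] by (simp add: up_event_def indicator_def)
      also have "\<dots> = ?P (glue \<Lambda> \<sigma> (restrict \<omega> (tree_ball n)))"
        by (rule P_cong) (simp add: glue_apply)
      finally show ?thesis .
    qed
    ultimately show ?thesis
      unfolding gibbs_kernel_def by (intro arg_cong2[where f = "(/)"] sum.cong refl) simp_all
  qed
  have glue_merge: "glue \<Lambda> \<sigma> (?m \<eta> \<zeta>) v = ?m \<sigma> \<zeta> v" if "v \<in> tree_ball n" for \<sigma> \<eta> \<zeta> v
    using that by (auto simp: glue_apply merge_def ball)
  have F_merge: "?F (?m \<eta> \<zeta>) = (\<Sum>\<sigma>\<in>configs \<Lambda>. ?e (?m \<sigma> \<zeta>) * ?P (?m \<sigma> \<zeta>)) / (\<Sum>\<sigma>\<in>configs \<Lambda>. ?e (?m \<sigma> \<zeta>))"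
    for \<eta> \<zeta>
    using e_cong[OF glue_merge] P_cong[OF glue_merge]
    by (intro arg_cong2[where f = "(/)"] sum.cong arg_cong2[where f = "(*)"] refl)
  have exchange: "?W (?m \<eta> \<zeta>) * ?e (?m \<sigma> \<zeta>) = ?W (?m \<sigma> \<zeta>) * ?e (?m \<eta> \<zeta>)" for \<eta> \<sigma> \<zeta>
    unfolding n_def using m
    by (intro field_dist_local_exchange) (auto simp: merge_def B_def)
  have inner: "(\<Sum>\<eta>\<in>configs \<Lambda>. ?W (?m \<eta> \<zeta>) * ?F (?m \<eta> \<zeta>)) = (\<Sum>\<sigma>\<in>configs \<Lambda>. ?W (?m \<sigma> \<zeta>) * ?P (?m \<sigma> \<zeta>))" for \<zeta>
  proof -
    define D where "D = (\<Sum>\<sigma>\<in>configs \<Lambda>. ?e (?m \<sigma> \<zeta>))"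
    have D: "D > 0"
      unfolding D_def by (rule sum_pos) (auto simp: finite_configs \<Lambda> configs_nonempty)
    have "(\<Sum>\<eta>\<in>configs \<Lambda>. ?W (?m \<eta> \<zeta>) * ?F (?m \<eta> \<zeta>)) =
        (\<Sum>\<eta>\<in>configs \<Lambda>. ?W (?m \<eta> \<zeta>) * ((\<Sum>\<sigma>\<in>configs \<Lambda>. ?e (?m \<sigma> \<zeta>) * ?P (?m \<sigma> \<zeta>)) / D))"
      by (intro sum.cong refl) (simp only: F_merge D_def)
    also have "\<dots> =
        (\<Sum>\<eta>\<in>configs \<Lambda>. \<Sum>\<sigma>\<in>configs \<Lambda>. ?W (?m \<eta> \<zeta>) * ?e (?m \<sigma> \<zeta>) * ?P (?m \<sigma> \<zeta>)) / D"
      by (simp only: sum_divide_distrib sum_distrib_left times_divide_eq_right mult.assoc)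
    also have "(\<Sum>\<eta>\<in>configs \<Lambda>. \<Sum>\<sigma>\<in>configs \<Lambda>. ?W (?m \<eta> \<zeta>) * ?e (?m \<sigma> \<zeta>) * ?P (?m \<sigma> \<zeta>)) =
        (\<Sum>\<sigma>\<in>configs \<Lambda>. \<Sum>\<eta>\<in>configs \<Lambda>. ?W (?m \<sigma> \<zeta>) * ?P (?m \<sigma> \<zeta>) * ?e (?m \<eta> \<zeta>))"
      by (subst sum.swap, intro sum.cong refl, subst exchange) (simp only: mult_ac)
    also have "\<dots> = (\<Sum>\<sigma>\<in>configs \<Lambda>. ?W (?m \<sigma> \<zeta>) * ?P (?m \<sigma> \<zeta>)) * D"
      by (simp only: sum_distrib_left[symmetric] sum_distrib_right D_def)
    finally show ?thesis using D by simp
  qed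
  have "(\<integral>\<omega>. gibbs_kernel J \<beta> \<Lambda> \<omega> (up_event L a) \<partial>\<mu>) = (\<integral>\<omega>. ?F (restrict \<omega> (tree_ball n)) \<partial>\<mu>)"
    by (rule Bochner_Integration.integral_cong[OF refl]) (simp only: kernel space)
  also have "\<dots> = (\<Sum>\<xi>\<in>configs (tree_ball n). measure \<mu> (cylinder n \<xi>) * ?F \<xi>)"
    by (rule integral_ball_function[OF prob sets])
  also have "\<dots> = (\<Sum>\<xi>\<in>configs (tree_ball n). ?W \<xi> * ?F \<xi>)"
    by (intro sum.cong refl) (simp only: splitting_cylinder[OF \<mu>])
  also have "\<dots> = (\<Sum>\<zeta>\<in>configs B. \<Sum>\<eta>\<in>configs \<Lambda>. ?W (?m \<eta> \<zeta>) * ?F (?m \<eta> \<zeta>))"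
    unfolding ball(1) sum_configs_Un[OF ball(2)] by (rule sum.swap)
  also have "\<dots> = (\<Sum>\<zeta>\<in>configs B. \<Sum>\<eta>\<in>configs \<Lambda>. ?W (?m \<eta> \<zeta>) * ?P (?m \<eta> \<zeta>))"
    by (simp only: inner)
  also have "\<dots> = (\<Sum>\<xi>\<in>configs (tree_ball n). ?W \<xi> * ?P \<xi>)"
    unfolding ball(1) sum_configs_Un[OF ball(2)] by (rule sum.swap)
  also have "\<dots> = (\<Sum>\<xi>\<in>configs (tree_ball n). measure \<mu> (cylinder n \<xi>) * ?P \<xi>)"
    by (intro sum.cong refl) (simp only: splitting_cylinder[OF \<mu>])
  also have "\<dots> = measure \<mu> (up_event L a)"
    by (rule measure_up_event_ball[OF prob sets sub(2), symmetric])
  finally show ?thesis by simp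
qed

lemma splitting_is_gibbs:
  assumes "splitting_gibbs_measure J \<beta> h \<mu>"
  shows "gibbs_measure J \<beta> \<mu>"
proof -
  have prob: "prob_space \<mu>" and sets: "sets \<mu> = sets config_space"
    using assms by (auto simp: splitting_gibbs_measure_def)
  show ?thesis
    unfolding gibbs_measure_def
  proof (intro conjI prob sets allI impI)
    fix \<Lambda> :: "vertex set" and A
    assume \<Lambda>: "finite \<Lambda>" and A: "A \<in> sets config_space"
    show "measure \<mu> A = (\<integral>\<omega>. gibbs_kernel J \<beta> \<Lambda> \<omega> A \<partial>\<mu>)"
      by (rule gibbs_kernel_invariant_extend[OF prob sets \<Lambda> _ A])
         (rule splitting_invariant_up_event[OF assms \<Lambda>])
  qed
qed

section \<open>Extremality by stochastic domination\<close>

text \<open>A boundary condition acts on the outermost level as the message \<open>w\<close> formed by the fixed spins of the children.\<close>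

lemma gibbs_kernel_up_event_ball:
  assumes \<omega>: "\<omega> \<in> space config_space" and L: "L \<subseteq> tree_ball n"
  defines "w \<equiv> \<lambda>v s. \<Prod>b\<in>UNIV. exp (\<beta> * J * s * \<omega> (b # v))"
  shows "gibbs_kernel J \<beta> (tree_ball n) \<omega> (up_event L a) =
    partition_fun n (up_weight L a) w / partition_fun n (\<lambda>_ _. 1) w"
proof -
  have e: "exp (- \<beta> * local_energy J (tree_ball n) (glue (tree_ball n) \<sigma> \<omega>)) =
      boltz n \<sigma> * (\<Prod>v\<in>level n. w v (\<sigma> v))" for \<sigma>
  proof -
    let ?g = "glue (tree_ball n) \<sigma> \<omega>"
    have "exp (- \<beta> * local_energy J (tree_ball n) ?g) = boltz (Suc n) ?g"
      by (simp add: boltz_def local_energy_def ball_energy_def touching_edges_ball)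
    also have "\<dots> = boltz n ?g * (\<Prod>v\<in>level n. \<Prod>b\<in>UNIV. exp (\<beta> * J * ?g v * ?g (b # v)))"
      by (rule boltz_Suc)
    also have "boltz n ?g = boltz n \<sigma>"
      by (rule boltz_cong) (simp add: glue_apply)
    also have "(\<Prod>v\<in>level n. \<Prod>b\<in>UNIV. exp (\<beta> * J * ?g v * ?g (b # v))) = (\<Prod>v\<in>level n. w v (\<sigma> v))"
      unfolding w_def by (intro prod.cong refl) (auto simp: glue_apply level_eq tree_ball_eq)
    finally show ?thesis .
  qed
  have "indicator (up_event L a) (glue (tree_ball n) \<sigma> \<omega>) = (\<Prod>v\<in>tree_ball n. up_weight L a v (\<sigma> v))"
    if "\<sigma> \<in> configs (tree_ball n)" for \<sigma>
  proof -
    have "(\<forall>v\<in>L. a v \<le> glue (tree_ball n) \<sigma> \<omega> v) \<longleftrightarrow> (\<forall>v\<in>L. a v \<le> \<sigma> v)"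
      using L by (auto simp: glue_apply)
    then show ?thesis
      using glue_space[OF that \<omega>] by (simp add: prod_up_weight[OF L finite_tree_ball] up_event_def indicator_def)
  qed
  then show ?thesis
    unfolding gibbs_kernel_def partition_fun_def e
    by (intro arg_cong2[where f = "(/)"] sum.cong refl) simp_all
qed

definition law_probability :: "nat \<Rightarrow> vertex set \<Rightarrow> (vertex \<Rightarrow> real) \<Rightarrow> real \<Rightarrow> real" where
  "law_probability n L a x =
    partition_fun n (up_weight L a) (boundary_law theta x) / partition_fun n (\<lambda>_ _. 1) (boundary_law theta x)"

text \<open>The boundary condition is imposed on a level of class 0, and \<open>w\<close> is a message on the class-2 level \<open>n\<close> above it.
Two transfers lead to the class-0 level \<open>3 * j + 3 * k\<close>, where the crude bounds of \<open>transfer_law_bounds\<close> apply; each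
further triple of transfers applies \<open>f_map\<close> once to both bounds.\<close>

lemma gibbs_kernel_up_event_bounds:
  fixes j k :: nat
  assumes \<omega>: "\<omega> \<in> space config_space" and L: "L \<subseteq> tree_ball (3 * j)"
  defines "n \<equiv> 3 * j + 3 * k + 2"
  shows "gibbs_kernel J \<beta> (tree_ball n) \<omega> (up_event L a) \<le>
      law_probability (3 * j) L a ((f_map theta ^^ k) (theta^2))"
    and "law_probability (3 * j) L a ((f_map theta ^^ k) (inverse (theta^2))) \<le>
      gibbs_kernel J \<beta> (tree_ball n) \<omega> (up_event L a)"
proof -
  define w where "w = (\<lambda>v s. \<Prod>b\<in>UNIV. exp (\<beta> * J * s * \<omega> (b # v)))"
  have w: "w v s > 0" for v s by (simp add: w_def prod_pos)
  define m where "m = (transfer ^^ (3 * k)) (transfer (transfer w))"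
  have mw: "(transfer ^^ (3 * k + 2)) w = m"
    by (simp add: m_def funpow_add numeral_2_eq_2 funpow_swap1)
  have L': "L \<subseteq> tree_ball n"
    using L tree_ball_mono[of "3 * j" n] by (auto simp: n_def)
  have peel: "partition_fun n u w = partition_fun (3 * j) u m"
    if "\<And>v s. v \<notin> tree_ball (3 * j) \<Longrightarrow> u v s = 1" for u
    unfolding n_def add.assoc mw[symmetric] by (rule partition_fun_peel_pow) (rule that)
  have kernel: "gibbs_kernel J \<beta> (tree_ball n) \<omega> (up_event L a) =
      partition_fun (3 * j) (up_weight L a) m / partition_fun (3 * j) (\<lambda>_ _. 1) m"
  proof -
    have "partition_fun n (up_weight L a) w = partition_fun (3 * j) (up_weight L a) m"
      by (rule peel) (use L in \<open>auto intro: up_weight_props(3)\<close>)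
    moreover have "partition_fun n (\<lambda>_ _. 1) w = partition_fun (3 * j) (\<lambda>_ _. 1) m"
      by (rule peel) simp
    ultimately show ?thesis
      using gibbs_kernel_up_event_ball[OF \<omega> L', of a, folded w_def] by simp
  qed
  have tw: "transfer w v s > 0" "transfer (transfer w) v s > 0" for v s
    by (intro transfer_pos w)+
  have mpos: "m v s > 0" if "s \<in> spin_set v" for v s
    unfolding m_def using that tw by (intro transfer_pow_pos) auto
  have th: "theta^2 > 0" "inverse (theta^2) > 0" by simp_all
  have law: "partition_fun (3 * j) u ((transfer ^^ (3 * k)) (boundary_law theta x)) /
        partition_fun (3 * j) (\<lambda>_ _. 1) ((transfer ^^ (3 * k)) (boundary_law theta x)) =
      partition_fun (3 * j) u (boundary_law theta ((f_map theta ^^ k) x)) /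
        partition_fun (3 * j) (\<lambda>_ _. 1) (boundary_law theta ((f_map theta ^^ k) x))" if "x > 0" for u x
    by (rule partition_ratio_proportional) (auto intro!: transfer_pow_law that simp: level_eq)
  have lpos: "(transfer ^^ (3 * k)) (boundary_law theta x) v s > 0" if "x > 0" "s \<in> spin_set v" for x v s
    using that by (intro transfer_pow_pos) (auto simp: boundary_law_pos)
  show "gibbs_kernel J \<beta> (tree_ball n) \<omega> (up_event L a) \<le>
      law_probability (3 * j) L a ((f_map theta ^^ k) (theta^2))"
    unfolding kernel law_probability_def law[OF th(1), symmetric]
  proof (rule partition_ratio_mono)
    fix v assume v: "v \<in> level (3 * j)"
    show "lr_le (spin_set v) (m v) ((transfer ^^ (3 * k)) (boundary_law theta (theta^2)) v)"
      unfolding m_def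
    proof (rule transfer_pow_lr_le[OF _ _ _ v])
      fix y assume "y \<in> level (3 * j + 3 * k)"
      then show "lr_le (spin_set y) (transfer (transfer w) y) (boundary_law theta (theta^2) y)"
        by (intro transfer_law_bounds tw) (simp add: level_eq)
    qed (use tw th in \<open>auto simp: boundary_law_pos\<close>)
  qed (use mpos lpos th in \<open>auto simp: up_weight_props\<close>)
  show "law_probability (3 * j) L a ((f_map theta ^^ k) (inverse (theta^2))) \<le>
      gibbs_kernel J \<beta> (tree_ball n) \<omega> (up_event L a)"
    unfolding kernel law_probability_def law[OF th(2), symmetric]
  proof (rule partition_ratio_mono)
    fix v assume v: "v \<in> level (3 * j)"
    show "lr_le (spin_set v) ((transfer ^^ (3 * k)) (boundary_law theta (inverse (theta^2))) v) (m v)"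
      unfolding m_def
    proof (rule transfer_pow_lr_le[OF _ _ _ v])
      fix y assume "y \<in> level (3 * j + 3 * k)"
      then show "lr_le (spin_set y) (boundary_law theta (inverse (theta^2)) y) (transfer (transfer w) y)"
        by (intro transfer_law_bounds tw) (simp add: level_eq)
    qed (use tw th in \<open>auto simp: boundary_law_pos\<close>)
  qed (use mpos lpos th in \<open>auto simp: up_weight_props\<close>)
qed

lemma gibbs_up_event_bounds:
  assumes \<nu>: "gibbs_measure J \<beta> \<nu>" and L: "L \<subseteq> tree_ball (3 * j)"
  shows "measure \<nu> (up_event L a) \<le> law_probability (3 * j) L a ((f_map theta ^^ k) (theta^2))"
    and "law_probability (3 * j) L a ((f_map theta ^^ k) (inverse (theta^2))) \<le> measure \<nu> (up_event L a)"
proof -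
  let ?n = "3 * j + 3 * k + 2"
  have prob: "prob_space \<nu>" and sets: "sets \<nu> = sets config_space"
    using \<nu> by (auto simp: gibbs_measure_def)
  interpret \<nu>: prob_space \<nu> by (rule prob)
  have space: "space \<nu> = space config_space" using sets by (rule sets_eq_imp_space_eq)
  have E: "up_event L a \<in> sets config_space"
    using L by (intro sets_up_event finite_subset[OF L finite_tree_ball])
  have eq: "measure \<nu> (up_event L a) = (\<integral>\<omega>. gibbs_kernel J \<beta> (tree_ball ?n) \<omega> (up_event L a) \<partial>\<nu>)"
    using \<nu> E finite_tree_ball by (simp add: gibbs_measure_def)
  note int = integrable_gibbs_kernel[OF prob sets finite_tree_ball E, of J \<beta> ?n]
  have "(\<integral>\<omega>. gibbs_kernel J \<beta> (tree_ball ?n) \<omega> (up_event L a) \<partial>\<nu>) \<le>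
      (\<integral>\<omega>. law_probability (3 * j) L a ((f_map theta ^^ k) (theta^2)) \<partial>\<nu>)"
    by (intro integral_mono int gibbs_kernel_up_event_bounds(1) L) (auto simp: space)
  then show "measure \<nu> (up_event L a) \<le> law_probability (3 * j) L a ((f_map theta ^^ k) (theta^2))"
    by (simp add: eq \<nu>.prob_space)
  have "(\<integral>\<omega>. law_probability (3 * j) L a ((f_map theta ^^ k) (inverse (theta^2))) \<partial>\<nu>) \<le>
      (\<integral>\<omega>. gibbs_kernel J \<beta> (tree_ball ?n) \<omega> (up_event L a) \<partial>\<nu>)"
    by (intro integral_mono int gibbs_kernel_up_event_bounds(2) L) (auto simp: space)
  then show "law_probability (3 * j) L a ((f_map theta ^^ k) (inverse (theta^2))) \<le> measure \<nu> (up_event L a)"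
    by (simp add: eq \<nu>.prob_space)
qed

text \<open>The outermost level \<open>3 * j\<close> is of class 0, where the law is \<open>x^2\<close> or \<open>1\<close>, so the probability is a rational function of \<open>x\<close>
with positive denominator.\<close>

lemma law_probability_tendsto:
  assumes "x > 0" "(\<lambda>k. y k) \<longlonglongrightarrow> x"
  shows "(\<lambda>k. law_probability (3 * j) L a (y k)) \<longlonglongrightarrow> law_probability (3 * j) L a x"
proof -
  have l: "(\<lambda>k. boundary_law theta (y k) v s) \<longlonglongrightarrow> boundary_law theta x v s" if "v \<in> level (3 * j)" for v s
    using that assms(2) by (auto simp: boundary_law_def level_eq intro!: tendsto_power)
  have Z: "(\<lambda>k. partition_fun (3 * j) u (boundary_law theta (y k))) \<longlonglongrightarrow> partition_fun (3 * j) u (boundary_law theta x)" for u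
    unfolding partition_fun_def by (intro tendsto_sum tendsto_mult tendsto_const tendsto_prod l)
  have "partition_fun (3 * j) (\<lambda>_ _. 1) (boundary_law theta x) > 0"
    using assms(1) by (intro partition_fun_pos) (simp add: boundary_law_pos)
  then show ?thesis
    unfolding law_probability_def by (intro tendsto_divide Z) simp
qed

lemma law_measure_up_event:
  assumes "splitting_gibbs_measure J \<beta> h \<mu>"
    and "\<And>v. proportional (spin_set v) (\<lambda>s. exp (h v s)) (boundary_law theta x v)"
    and "L \<subseteq> tree_ball n"
  shows "measure \<mu> (up_event L a) = law_probability n L a x"
  unfolding splitting_up_event[OF assms(1,3)] law_probability_def
  by (rule partition_ratio_proportional) (rule assms(2))

lemma finite_subset_tree_ball_3:
  assumes "finite L"
  obtains j where "L \<subseteq> tree_ball (3 * j)"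
proof -
  obtain n where "L \<subseteq> tree_ball n" using assms by (rule finite_subset_tree_ball)
  then have "L \<subseteq> tree_ball (3 * n)" using tree_ball_mono[of n "3 * n"] by auto
  then show ?thesis by (rule that)
qed

text \<open>The bound of \<open>gibbs_up_event_bounds\<close> holds for every number \<open>k\<close> of iterations; letting it tend to infinity gives the law
of the largest fixed point.\<close>

lemma top_law_dominates:
  assumes \<mu>: "splitting_gibbs_measure J \<beta> h \<mu>"
    "\<And>v. proportional (spin_set v) (\<lambda>s. exp (h v s)) (boundary_law theta x v)"
    and x: "x > 0" "f_map theta x = x" "\<And>y. y > 0 \<Longrightarrow> f_map theta y = y \<Longrightarrow> y \<le> x"
    and \<nu>: "gibbs_measure J \<beta> \<nu>" and L: "finite L"
  shows "measure \<nu> (up_event L a) \<le> measure \<mu> (up_event L a)"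
proof -
  obtain j where j: "L \<subseteq> tree_ball (3 * j)" using L by (rule finite_subset_tree_ball_3)
  have "measure \<nu> (up_event L a) \<le> law_probability (3 * j) L a x"
    by (rule LIMSEQ_le_const[OF law_probability_tendsto[OF x(1) f_iterate_top[OF x]]])
       (use gibbs_up_event_bounds(1)[OF \<nu> j] in auto)
  then show ?thesis by (simp add: law_measure_up_event[OF \<mu> j])
qed

lemma bottom_law_dominated:
  assumes \<mu>: "splitting_gibbs_measure J \<beta> h \<mu>"
    "\<And>v. proportional (spin_set v) (\<lambda>s. exp (h v s)) (boundary_law theta x v)"
    and x: "x > 0" "f_map theta x = x" "\<And>y. y > 0 \<Longrightarrow> f_map theta y = y \<Longrightarrow> x \<le> y"
    and \<nu>: "gibbs_measure J \<beta> \<nu>" and L: "finite L"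
  shows "measure \<mu> (up_event L a) \<le> measure \<nu> (up_event L a)"
proof -
  obtain j where j: "L \<subseteq> tree_ball (3 * j)" using L by (rule finite_subset_tree_ball_3)
  have "law_probability (3 * j) L a x \<le> measure \<nu> (up_event L a)"
    by (rule LIMSEQ_le_const2[OF law_probability_tendsto[OF x(1) f_iterate_bot[OF x]]])
       (use gibbs_up_event_bounds(2)[OF \<nu> j] in auto)
  then show ?thesis by (simp add: law_measure_up_event[OF \<mu> j])
qed

lemma extremal_if_mixtures_agree:
  assumes \<mu>: "gibbs_measure J \<beta> \<mu>"
    and agree: "\<And>\<mu>\<^sub>1 \<mu>\<^sub>2 t L a. gibbs_measure J \<beta> \<mu>\<^sub>1 \<Longrightarrow> gibbs_measure J \<beta> \<mu>\<^sub>2 \<Longrightarrow> 0 < t \<Longrightarrow> t < 1 \<Longrightarrow> finite L \<Longrightarrow>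
      measure \<mu> (up_event L a) = t * measure \<mu>\<^sub>1 (up_event L a) + (1 - t) * measure \<mu>\<^sub>2 (up_event L a) \<Longrightarrow>
      measure \<mu>\<^sub>1 (up_event L a) = measure \<mu> (up_event L a)"
  shows "extremal_gibbs_measure J \<beta> \<mu>"
  unfolding extremal_gibbs_measure_def
proof (intro conjI \<mu> notI, elim exE conjE)
  fix \<mu>\<^sub>1 \<mu>\<^sub>2 t
  assume g: "gibbs_measure J \<beta> \<mu>\<^sub>1" "gibbs_measure J \<beta> \<mu>\<^sub>2" "0 < t" "t < (1::real)" and "\<mu>\<^sub>1 \<noteq> \<mu>"
    and mix: "\<forall>A\<in>sets config_space. measure \<mu> A = t * measure \<mu>\<^sub>1 A + (1 - t) * measure \<mu>\<^sub>2 A"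
  have "\<mu>\<^sub>1 = \<mu>"
  proof (rule config_measure_eqI)
    fix L :: "vertex set" and a assume "finite L"
    then show "measure \<mu>\<^sub>1 (up_event L a) = measure \<mu> (up_event L a)"
      using mix sets_up_event by (intro agree[OF g]) auto
  qed (use g \<mu> in \<open>auto simp: gibbs_measure_def\<close>)
  with \<open>\<mu>\<^sub>1 \<noteq> \<mu>\<close> show False by simp
qed

lemma mixture_extreme:
  fixes x y z t :: real
  assumes "0 < t" "t < 1" "z = t * x + (1 - t) * y" "(x \<le> z \<and> y \<le> z) \<or> (z \<le> x \<and> z \<le> y)"
  shows "x = z"
proof -
  have "t * (x - z) + (1 - t) * (y - z) = 0" using assms(3) by (simp add: algebra_simps)
  moreover have "t * (x - z) \<le> 0 \<and> (1 - t) * (y - z) \<le> 0 \<or> t * (x - z) \<ge> 0 \<and> (1 - t) * (y - z) \<ge> 0"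
    using assms(1,2,4) by (auto simp: mult_le_0_iff zero_le_mult_iff)
  ultimately have "t * (x - z) = 0" by linarith
  then show ?thesis using assms(1) by simp
qed

text \<open>If \<open>z\<close> is a proper convex combination of two numbers lying on the same side of \<open>z\<close>, both are equal to \<open>z\<close>; applied to
each increasing local event, this makes the components of a mixture coincide with \<open>\<mu>\<close>.\<close>

lemma extremal_if_dominating:
  assumes \<mu>: "gibbs_measure J \<beta> \<mu>"
    and dom: "(\<forall>\<nu> L a. gibbs_measure J \<beta> \<nu> \<longrightarrow> finite L \<longrightarrow> measure \<nu> (up_event L a) \<le> measure \<mu> (up_event L a)) \<or>
      (\<forall>\<nu> L a. gibbs_measure J \<beta> \<nu> \<longrightarrow> finite L \<longrightarrow> measure \<mu> (up_event L a) \<le> measure \<nu> (up_event L a))"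
  shows "extremal_gibbs_measure J \<beta> \<mu>"
proof (rule extremal_if_mixtures_agree[OF \<mu>])
  fix \<mu>\<^sub>1 \<mu>\<^sub>2 t L a
  assume g: "gibbs_measure J \<beta> \<mu>\<^sub>1" "gibbs_measure J \<beta> \<mu>\<^sub>2" and t: "0 < t" "t < 1" and L: "finite L"
    and mix: "measure \<mu> (up_event L a) = t * measure \<mu>\<^sub>1 (up_event L a) + (1 - t) * measure \<mu>\<^sub>2 (up_event L a)"
  show "measure \<mu>\<^sub>1 (up_event L a) = measure \<mu> (up_event L a)"
    by (rule mixture_extreme[OF t mix]) (use dom g L in blast)
qed

section \<open>Translation-invariant splitting Gibbs measures\<close>

lemma associated_measure_iff:
  assumes "x > 0"
  shows "associated_measure J \<beta> theta x \<mu> \<longleftrightarrow>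
    (\<exists>h. splitting_gibbs_measure J \<beta> h \<mu> \<and>
      (\<forall>v. proportional (spin_set v) (\<lambda>s. exp (h v s)) (boundary_law theta x v)))"
  by (simp add: associated_measure_def constant_ratios_iff[OF _ assms])

text \<open>Fields with the same ratios differ by a constant at each vertex, and these constants cancel in the marginals.\<close>

lemma associated_measure_unique:
  assumes "x > 0" "associated_measure J \<beta> theta x \<mu>" "associated_measure J \<beta> theta x \<nu>"
  shows "\<mu> = \<nu>"
proof -
  obtain h where h: "splitting_gibbs_measure J \<beta> h \<mu>"
      "\<And>v. proportional (spin_set v) (\<lambda>s. exp (h v s)) (boundary_law theta x v)"
    using assms by (auto simp: associated_measure_iff)
  obtain h' where h': "splitting_gibbs_measure J \<beta> h' \<nu>"
      "\<And>v. proportional (spin_set v) (\<lambda>s. exp (h' v s)) (boundary_law theta x v)"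
    using assms by (auto simp: associated_measure_iff)
  show ?thesis
    by (rule splitting_unique[OF h(1) h'(1)]) (rule proportional_trans[OF h(2) proportional_sym[OF h'(2)]])
qed

lemma associated_measure_exists:
  assumes x: "x > 0" "f_map theta x = x"
  shows "\<exists>\<mu>. associated_measure J \<beta> theta x \<mu>"
proof -
  let ?h = "\<lambda>v s. ln (boundary_law theta x v s)"
  have e: "(\<lambda>s. exp (?h v s)) = boundary_law theta x v" for v
    using boundary_law_pos[of theta x] x by (simp add: fun_eq_iff)
  have "compatible J \<beta> ?h"
    using boundary_law_compatible_iff[OF x(1), of "boundary_law theta x"] x(2)
    by (simp only: compatible_iff e proportional_refl)
  then obtain \<mu> where "splitting_gibbs_measure J \<beta> ?h \<mu>"
    using splitting_exists by blast
  then have "associated_measure J \<beta> theta x \<mu>"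
    unfolding associated_measure_iff[OF x(1)] using e proportional_refl by metis
  then show ?thesis ..
qed

lemma associated_measure_ex1:
  assumes "x \<in> positive_fixed_points theta"
  obtains \<mu> where "\<And>\<nu>. associated_measure J \<beta> theta x \<nu> \<longleftrightarrow> \<nu> = \<mu>"
proof -
  have x: "x > 0" "f_map theta x = x" using assms by (auto simp: positive_fixed_points_def)
  obtain \<mu> where "associated_measure J \<beta> theta x \<mu>" using associated_measure_exists[OF x] by blast
  then show ?thesis using associated_measure_unique[OF x(1)] that by blast
qed

lemma TISGM_eq:
  "TISGM J \<beta> = {\<mu>. \<exists>x\<in>positive_fixed_points theta. associated_measure J \<beta> theta x \<mu>}"
proof (intro set_eqI iffI)
  fix \<mu> assume "\<mu> \<in> TISGM J \<beta>"
  then obtain h X Y Z T U N where h: "splitting_gibbs_measure J \<beta> h \<mu>" "constant_ratios h X Y Z T U N"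
    by (auto simp: TISGM_def)
  then have "compatible J \<beta> h" by (simp add: splitting_gibbs_measure_def)
  with h(2) obtain x where x: "x > 0" "f_map theta x = x"
      "\<And>v. proportional (spin_set v) (\<lambda>s. exp (h v s)) (boundary_law theta x v)"
    by (rule constant_ratios_compatible) (rule that)
  have "associated_measure J \<beta> theta x \<mu>"
    unfolding associated_measure_iff[OF x(1)] using h(1) x(3) by blast
  moreover have "x \<in> positive_fixed_points theta"
    using x(1,2) by (simp add: positive_fixed_points_def)
  ultimately show "\<mu> \<in> {\<mu>. \<exists>x\<in>positive_fixed_points theta. associated_measure J \<beta> theta x \<mu>}"
    by blast
next
  fix \<mu> assume "\<mu> \<in> {\<mu>. \<exists>x\<in>positive_fixed_points theta. associated_measure J \<beta> theta x \<mu>}"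
  then show "\<mu> \<in> TISGM J \<beta>"
    unfolding TISGM_def associated_measure_def by blast
qed

lemma associated_measure_extremal:
  assumes x: "x \<in> positive_fixed_points theta" and \<mu>: "associated_measure J \<beta> theta x \<mu>"
    and ext: "(\<forall>y\<in>positive_fixed_points theta. y \<le> x) \<or> (\<forall>y\<in>positive_fixed_points theta. x \<le> y)"
  shows "extremal_gibbs_measure J \<beta> \<mu>"
proof -
  have x': "x > 0" "f_map theta x = x" using x by (auto simp: positive_fixed_points_def)
  obtain h where h: "splitting_gibbs_measure J \<beta> h \<mu>"
      "\<And>v. proportional (spin_set v) (\<lambda>s. exp (h v s)) (boundary_law theta x v)"
    using \<mu> x'(1) by (auto simp: associated_measure_iff)
  show ?thesis
  proof (rule extremal_if_dominating[OF splitting_is_gibbs[OF h(1)]])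
    show "(\<forall>\<nu> L a. gibbs_measure J \<beta> \<nu> \<longrightarrow> finite L \<longrightarrow> measure \<nu> (up_event L a) \<le> measure \<mu> (up_event L a)) \<or>
      (\<forall>\<nu> L a. gibbs_measure J \<beta> \<nu> \<longrightarrow> finite L \<longrightarrow> measure \<mu> (up_event L a) \<le> measure \<nu> (up_event L a))"
      using ext
    proof (elim disjE)
      assume "\<forall>y\<in>positive_fixed_points theta. y \<le> x"
      then have "y \<le> x" if "y > 0" "f_map theta y = y" for y
        using that by (simp add: positive_fixed_points_def)
      then show ?thesis using top_law_dominates[OF h x'] by blast
    next
      assume "\<forall>y\<in>positive_fixed_points theta. x \<le> y"
      then have "x \<le> y" if "y > 0" "f_map theta y = y" for y
        using that by (simp add: positive_fixed_points_def)
      then show ?thesis using bottom_law_dominated[OF h x'] by blast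
    qed
  qed
qed

end

theorem theorem14:
  fixes J \<beta> \<theta> :: real
  assumes "J > 0" and "\<beta> > 0" and "\<theta> = exp (\<beta> * J / 2)"
  shows
    "(positive_fixed_points \<theta> = {1} \<longrightarrow>
       (\<exists>\<mu>\<^sub>0. (\<forall>\<nu>. associated_measure J \<beta> \<theta> 1 \<nu> \<longleftrightarrow> \<nu> = \<mu>\<^sub>0) \<and> TISGM J \<beta> = {\<mu>\<^sub>0})) \<and>
     (s2 \<theta> \<le> 0 \<and> (\<forall>x>0. x = f_map \<theta> x \<longrightarrow> x = 1) \<longrightarrow> positive_fixed_points \<theta> = {1}) \<and>
     (\<forall>x\<^sub>m x\<^sub>p. x\<^sub>m < 1 \<and> 1 < x\<^sub>p \<and> positive_fixed_points \<theta> = {x\<^sub>m, 1, x\<^sub>p} \<longrightarrow>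
       (\<exists>\<mu>\<^sub>m \<mu>\<^sub>0 \<mu>\<^sub>p.
          (\<forall>\<nu>. associated_measure J \<beta> \<theta> x\<^sub>m \<nu> \<longleftrightarrow> \<nu> = \<mu>\<^sub>m) \<and>
          (\<forall>\<nu>. associated_measure J \<beta> \<theta> 1 \<nu> \<longleftrightarrow> \<nu> = \<mu>\<^sub>0) \<and>
          (\<forall>\<nu>. associated_measure J \<beta> \<theta> x\<^sub>p \<nu> \<longleftrightarrow> \<nu> = \<mu>\<^sub>p) \<and>
          TISGM J \<beta> = {\<mu>\<^sub>m, \<mu>\<^sub>0, \<mu>\<^sub>p} \<and>
          extremal_gibbs_measure J \<beta> \<mu>\<^sub>m \<and>
          extremal_gibbs_measure J \<beta> \<mu>\<^sub>p))"
proof -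
  interpret ferromagnet J \<beta> using assms(1,2) by unfold_locales
  note \<theta> = assms(3)
  show ?thesis
  proof (intro conjI impI allI)
    assume P: "positive_fixed_points \<theta> = {1}"
    then have "1 \<in> positive_fixed_points theta" by (simp add: \<theta>)
    then obtain \<mu>\<^sub>0 where \<mu>\<^sub>0: "\<And>\<nu>. associated_measure J \<beta> theta 1 \<nu> \<longleftrightarrow> \<nu> = \<mu>\<^sub>0"
      by (rule associated_measure_ex1) blast
    moreover have "TISGM J \<beta> = {\<mu>\<^sub>0}"
      using P by (simp add: TISGM_eq \<mu>\<^sub>0 \<theta>)
    ultimately show "\<exists>\<mu>\<^sub>0. (\<forall>\<nu>. associated_measure J \<beta> \<theta> 1 \<nu> \<longleftrightarrow> \<nu> = \<mu>\<^sub>0) \<and> TISGM J \<beta> = {\<mu>\<^sub>0}"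
      unfolding \<theta> by blast
  next
    assume "s2 \<theta> \<le> 0 \<and> (\<forall>x>0. x = f_map \<theta> x \<longrightarrow> x = 1)"
    then show "positive_fixed_points \<theta> = {1}"
      using f_map_one[of \<theta>] by (auto simp: positive_fixed_points_def \<theta>)
  next
    fix x\<^sub>m x\<^sub>p
    assume "x\<^sub>m < 1 \<and> 1 < x\<^sub>p \<and> positive_fixed_points \<theta> = {x\<^sub>m, 1, x\<^sub>p}"
    then have order: "x\<^sub>m < 1" "1 < x\<^sub>p" and P: "positive_fixed_points theta = {x\<^sub>m, 1, x\<^sub>p}"
      by (auto simp: \<theta>)
    obtain \<mu>\<^sub>m where m: "\<And>\<nu>. associated_measure J \<beta> theta x\<^sub>m \<nu> \<longleftrightarrow> \<nu> = \<mu>\<^sub>m"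
      by (rule associated_measure_ex1[of x\<^sub>m]) (auto simp: P)
    obtain \<mu>\<^sub>0 where 0: "\<And>\<nu>. associated_measure J \<beta> theta 1 \<nu> \<longleftrightarrow> \<nu> = \<mu>\<^sub>0"
      by (rule associated_measure_ex1[of 1]) (auto simp: P)
    obtain \<mu>\<^sub>p where p: "\<And>\<nu>. associated_measure J \<beta> theta x\<^sub>p \<nu> \<longleftrightarrow> \<nu> = \<mu>\<^sub>p"
      by (rule associated_measure_ex1[of x\<^sub>p]) (auto simp: P)
    have "TISGM J \<beta> = {\<mu>\<^sub>m, \<mu>\<^sub>0, \<mu>\<^sub>p}"
      by (auto simp: TISGM_eq P m 0 p)
    moreover have "extremal_gibbs_measure J \<beta> \<mu>\<^sub>m"
      by (rule associated_measure_extremal[of x\<^sub>m]) (use order in \<open>auto simp: P m\<close>)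
    moreover have "extremal_gibbs_measure J \<beta> \<mu>\<^sub>p"
      by (rule associated_measure_extremal[of x\<^sub>p]) (use order in \<open>auto simp: P p\<close>)
    ultimately show "\<exists>\<mu>\<^sub>m \<mu>\<^sub>0 \<mu>\<^sub>p.
        (\<forall>\<nu>. associated_measure J \<beta> \<theta> x\<^sub>m \<nu> \<longleftrightarrow> \<nu> = \<mu>\<^sub>m) \<and>
        (\<forall>\<nu>. associated_measure J \<beta> \<theta> 1 \<nu> \<longleftrightarrow> \<nu> = \<mu>\<^sub>0) \<and>
        (\<forall>\<nu>. associated_measure J \<beta> \<theta> x\<^sub>p \<nu> \<longleftrightarrow> \<nu> = \<mu>\<^sub>p) \<and>
        TISGM J \<beta> = {\<mu>\<^sub>m, \<mu>\<^sub>0, \<mu>\<^sub>p} \<and>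
        extremal_gibbs_measure J \<beta> \<mu>\<^sub>m \<and>
        extremal_gibbs_measure J \<beta> \<mu>\<^sub>p"
      unfolding \<theta> using m 0 p by blast
  qed
qed

end
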